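(* Let $\mathbb{K}$ be a field and let $G$ be a graph with $n$ vertices $v_1,\dots,v_n$, with edge ideal $I(G)\subseteq S=\mathbb{K}[x_1,\dots,x_n]$, such that (i) $G$ is a non-bipartite graph, or (ii) at least one of the connected components of $G$ is a tree with at least one edge. Then for every integer $k\geq n-1$, the ideal $I(G)^k$ satisfies Stanley's inequality, i.e. $\mathrm{depth}(I(G)^k)\leq \mathrm{sdepth}(I(G)^k)$.
   Context: Graphs are finite and simple. A tree is a connected graph with no cycle. The edge ideal $I(G)$ is the ideal of $S=\mathbb{K}[x_1,\dots,x_n]$ generated by the squarefree monomials $x_ix_j$ with $\{v_i,v_j\}$ an edge of $G$. Depth is that of $I(G)^k$ as an $S$-module, taken with respect to the maximal ideal $\mathfrak{m}=(x_1,\dots,x_n)$. Stanley depth: let $M$ be a finitely generated $\mathbb{Z}^n$-graded $S$-module, $u\in M$ a homogeneous element and $Z\subseteq\{x_1,\dots,x_n\}$. The $\mathbb{K}$-subspace $u\mathbb{K}[Z]$ generated by all $uv$ with $v\in\mathbb{K}[Z]$ is called a Stanley space of dimension $|Z|$ if it is a free $\mathbb{K}[Z]$-module. A Stanley decomposition $\mathcal{D}$ of $M$ is a decomposition of $M$ (as a $\mathbb{K}$-vector space) as a finite direct sum of Stanley spaces; $\mathrm{sdepth}(\mathcal{D})$ is the minimum dimension of a Stanley space in $\mathcal{D}$, and $\mathrm{sdepth}(M)$ is the maximum of $\mathrm{sdepth}(\mathcal{D})$ over all Stanley decompositions $\mathcal{D}$ of $M$. *)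

theory Defs
  imports "HOL-Library.Poly_Mapping" "HOL-Library.Extended_Nat" "HOL-Library.FuncSet"
    "HOL-Library.Cardinality"
begin

section \<open>Graphs\<close>

definition simple_graph :: "'v set \<Rightarrow> 'v set set \<Rightarrow> bool" where
  "simple_graph V E \<longleftrightarrow> finite V \<and> (\<forall>e\<in>E. e \<subseteq> V \<and> card e = 2)"

definition bipartite :: "'v set \<Rightarrow> 'v set set \<Rightarrow> bool" where
  "bipartite V E \<longleftrightarrow>
     (\<exists>A B. A \<union> B = V \<and> A \<inter> B = {} \<and> (\<forall>e\<in>E. \<exists>a\<in>A. \<exists>b\<in>B. e = {a, b}))"

definition adjacency :: "'v set set \<Rightarrow> ('v \<times> 'v) set" where
  "adjacency E = {(u, w). {u, w} \<in> E}"

definition graph_connected :: "'v set \<Rightarrow> 'v set set \<Rightarrow> bool" where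
  "graph_connected V E \<longleftrightarrow> V \<noteq> {} \<and> (\<forall>u\<in>V. \<forall>w\<in>V. (u, w) \<in> (adjacency E)\<^sup>*)"

definition graph_cycle :: "'v set set \<Rightarrow> 'v list \<Rightarrow> bool" where
  "graph_cycle E c \<longleftrightarrow> 3 \<le> length c \<and> distinct c \<and>
     (\<forall>i. Suc i < length c \<longrightarrow> {c ! i, c ! Suc i} \<in> E) \<and> {last c, hd c} \<in> E"

definition tree :: "'v set \<Rightarrow> 'v set set \<Rightarrow> bool" where
  "tree V E \<longleftrightarrow> graph_connected V E \<and> (\<nexists>c. graph_cycle E c)"

definition component_vertices :: "'v set \<Rightarrow> 'v set set \<Rightarrow> 'v set set" where
  "component_vertices V E = {{w \<in> V. (u, w) \<in> (adjacency E)\<^sup>*} | u. u \<in> V}"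

definition induced_edges :: "'v set set \<Rightarrow> 'v set \<Rightarrow> 'v set set" where
  "induced_edges E C = {e \<in> E. e \<subseteq> C}"


section \<open>Polynomial rings and ideals\<close>

text \<open>
  Polynomials over \<open>'k\<close> in the variables \<open>x\<^sub>v\<close>, where \<open>v\<close> ranges over the
  finite type \<open>'v\<close>: a monomial is its exponent vector, a polynomial maps
  monomials to coefficients.
\<close>

type_synonym ('v, 'k) mpol = "('v \<Rightarrow>\<^sub>0 nat) \<Rightarrow>\<^sub>0 'k"

definition var :: "'v \<Rightarrow> ('v, 'k::field) mpol" where
  "var v = Poly_Mapping.single (Poly_Mapping.single v 1) 1"

definition subpolynomials :: "'v set \<Rightarrow> ('v, 'k::field) mpol set" where
  \<comment> \<open>the subring \<open>K[Z]\<close> of polynomials involving only the variables indexed by \<open>Z\<close>\<close>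
  "subpolynomials Z = {p. \<forall>t\<in>Poly_Mapping.keys p. Poly_Mapping.keys t \<subseteq> Z}"

definition ideal_gen :: "'r::comm_ring_1 set \<Rightarrow> 'r set" where
  "ideal_gen A = module.span (*) A"

primrec ideal_power :: "'r::comm_ring_1 set \<Rightarrow> nat \<Rightarrow> 'r set" where
  "ideal_power I 0 = UNIV"
| "ideal_power I (Suc k) = ideal_gen {a * b | a b. a \<in> I \<and> b \<in> ideal_power I k}"

definition maximal_ideal :: "('v, 'k::field) mpol set" where
  "maximal_ideal = ideal_gen (range var)"

definition edge_ideal :: "'v set set \<Rightarrow> ('v, 'k::field) mpol set" where
  "edge_ideal E = ideal_gen {var u * var w | u w. {u, w} \<in> E}"


section \<open>Depth\<close>

text \<open>
  In the following, modules are submodules \<open>M\<close> of an ambient module \<open>'m\<close> with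
  scalar multiplication \<open>scale\<close>; an ideal is a submodule of the ring, with \<open>(*)\<close>.
\<close>

definition list_multiples :: "('r::comm_ring_1 \<Rightarrow> 'm::ab_group_add \<Rightarrow> 'm) \<Rightarrow> 'r list \<Rightarrow> 'm set \<Rightarrow> 'm set" where
  \<comment> \<open>the submodule \<open>(f\<^sub>1, \<dots>, f\<^sub>r) M\<close>\<close>
  "list_multiples scale fs M = module.span scale {scale f x | f x. f \<in> set fs \<and> x \<in> M}"

text \<open>
  The first conjunct says that each \<open>f\<^sub>i\<close> is a nonzerodivisor on
  \<open>M / (f\<^sub>1, \<dots>, f\<^sub>i\<^sub>-\<^sub>1) M\<close>.
\<close>

definition regular_sequence :: "('r::comm_ring_1 \<Rightarrow> 'm::ab_group_add \<Rightarrow> 'm) \<Rightarrow> 'm set \<Rightarrow> 'r list \<Rightarrow> bool" where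
  "regular_sequence scale M fs \<longleftrightarrow>
     (\<forall>i<length fs. \<forall>x\<in>M. scale (fs ! i) x \<in> list_multiples scale (take i fs) M
        \<longrightarrow> x \<in> list_multiples scale (take i fs) M) \<and>
     list_multiples scale fs M \<noteq> M"

text \<open>
  Depth with respect to an ideal \<open>J\<close>. The supremum is over the empty set only if \<open>M = 0\<close>.
\<close>

definition depth :: "('r::comm_ring_1 \<Rightarrow> 'm::ab_group_add \<Rightarrow> 'm) \<Rightarrow> 'r set \<Rightarrow> 'm set \<Rightarrow> enat" where
  "depth scale J M = (SUP fs \<in> {fs. set fs \<subseteq> J \<and> regular_sequence scale M fs}. enat (length fs))"


section \<open>Stanley depth\<close>

text \<open>
  A \<open>\<int>\<^sup>n\<close>-grading of the ambient module is given by its homogeneous components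
  \<open>gr a\<close>; a graded submodule \<open>M\<close> has the components \<open>M \<inter> gr a\<close>.
\<close>

definition multidegree_component :: "('v \<Rightarrow> int) \<Rightarrow> ('v, 'k::field) mpol set" where
  \<comment> \<open>the standard grading of the polynomial ring\<close>
  "multidegree_component a = {p. \<forall>t\<in>Poly_Mapping.keys p. \<forall>v. int (Poly_Mapping.lookup t v) = a v}"

definition linear_combinations :: "('r::comm_ring_1 \<Rightarrow> 'm::ab_group_add \<Rightarrow> 'm) \<Rightarrow> 'r set \<Rightarrow> 'm set \<Rightarrow> 'm set" where
  "linear_combinations scale R B =
     {(\<Sum>b\<in>F. scale (c b) b) | F c. finite F \<and> F \<subseteq> B \<and> (\<forall>b\<in>F. c b \<in> R)}"

definition free_over :: "('r::comm_ring_1 \<Rightarrow> 'm::ab_group_add \<Rightarrow> 'm) \<Rightarrow> 'r set \<Rightarrow> 'm set \<Rightarrow> bool" where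
  \<comment> \<open>\<open>N\<close> has a basis as a module over the subring \<open>R\<close>\<close>
  "free_over scale R N \<longleftrightarrow>
     (\<exists>B. linear_combinations scale R B = N \<and>
        (\<forall>F c. finite F \<and> F \<subseteq> B \<and> (\<forall>b\<in>F. c b \<in> R) \<and> (\<Sum>b\<in>F. scale (c b) b) = 0
           \<longrightarrow> (\<forall>b\<in>F. c b = 0)))"

definition stanley_subspace ::
  "(('v, 'k::field) mpol \<Rightarrow> 'm::ab_group_add \<Rightarrow> 'm) \<Rightarrow> 'm \<times> 'v set \<Rightarrow> 'm set" where
  \<comment> \<open>\<open>u K[Z]\<close>\<close>
  "stanley_subspace scale = (\<lambda>(u, Z). {scale f u | f. f \<in> subpolynomials Z})"

definition stanley_space ::
  "(('v, 'k::field) mpol \<Rightarrow> 'm::ab_group_add \<Rightarrow> 'm) \<Rightarrow> (('v \<Rightarrow> int) \<Rightarrow> 'm set) \<Rightarrow> 'm set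
     \<Rightarrow> 'm \<times> 'v set \<Rightarrow> bool" where
  "stanley_space scale gr M = (\<lambda>(u, Z).
     u \<in> M \<and> (\<exists>a. u \<in> gr a) \<and>
     free_over scale (subpolynomials Z) (stanley_subspace scale (u, Z)))"

text \<open>
  A decomposition is recorded by its pairs \<open>(u, Z)\<close>. The sum of the subspaces
  \<open>u K[Z]\<close> is \<open>M\<close> and direct iff each element of \<open>M\<close> is uniquely a sum of
  elements of them.
\<close>

definition stanley_decomposition ::
  "(('v, 'k::field) mpol \<Rightarrow> 'm::ab_group_add \<Rightarrow> 'm) \<Rightarrow> (('v \<Rightarrow> int) \<Rightarrow> 'm set) \<Rightarrow> 'm set
     \<Rightarrow> ('m \<times> 'v set) set \<Rightarrow> bool" where
  "stanley_decomposition scale gr M D \<longleftrightarrow>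
     finite D \<and> (\<forall>d\<in>D. stanley_space scale gr M d \<and> stanley_subspace scale d \<subseteq> M) \<and>
     (\<forall>x\<in>M. \<exists>!s. s \<in> (\<Pi>\<^sub>E d\<in>D. stanley_subspace scale d) \<and> x = (\<Sum>d\<in>D. s d))"

definition decomposition_sdepth :: "('m \<times> 'v set) set \<Rightarrow> enat" where
  "decomposition_sdepth D = (INF (u, Z) \<in> D. enat (card Z))"

definition sdepth ::
  "(('v, 'k::field) mpol \<Rightarrow> 'm::ab_group_add \<Rightarrow> 'm) \<Rightarrow> (('v \<Rightarrow> int) \<Rightarrow> 'm set) \<Rightarrow> 'm set \<Rightarrow> enat" where
  "sdepth scale gr M = (SUP D \<in> {D. stanley_decomposition scale gr M D}. decomposition_sdepth D)"

definition stanley_inequality :: "('v, 'k::field) mpol set \<Rightarrow> bool" where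
  "stanley_inequality I \<longleftrightarrow> depth (*) maximal_ideal I \<le> sdepth (*) multidegree_component I"

end

theory Submission
  imports Defs
begin

text \<open>
  Let \<open>p\<close> be the number of bipartite components; then \<open>depth I(G)\<^sup>k \<le> p + 1 \<le> sdepth I(G)\<^sup>k\<close>.

  Stanley depth: the powers of the edge ideal of a disjoint union \<open>G \<union> H\<close> decompose into the
  products of a layer \<open>I(G)\<^sup>i - I(G)\<^sup>i\<^sup>+\<^sup>1\<close> with a power of \<open>I(H)\<close>, so it suffices that the layers of a bipartite
  component contribute dimension \<open>1\<close> and that the powers of one further component contribute \<open>1\<close> if it is
  not bipartite and \<open>2\<close> if it is a tree. By Koenig's theorem each monomial in a layer of a bipartite graph has
  a vertex outside a minimal cover as a free direction, and for trees one removes leaves.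

  Depth: a regular sequence of length \<open>p + 2\<close> would kill the Koszul cohomology of \<open>I(G)\<^sup>k\<close> in
  degree \<open>p + 1\<close>. A nonzero class is obtained in a multidegree for which the degree complex is the join of
  the pairs of simplices on the two sides of each bipartite component. Such a multidegree, with respect to
  \<open>k \<ge> n - 1\<close>, is found by growing each component from an edge or an odd cycle, at the cost of
  one edge for each new vertex.
\<close>

section \<open>Exponents of powers of edge ideals\<close>

text \<open>The number p + 1 is topological. The join of p pairs of disjoint simplices is a sphere
  of dimension p - 1 up to homotopy; its class is represented by the wedge of the p indicator
  functions of one side of each bipartite component. Lifted to the polynomial ring this is a cochain
  of degree p that is a cocycle only modulo I(G)^k, and its coboundary is the class of degree p + 1
  with values in I(G)^k. It is detected by a signed sum over all choices of one of two vertices for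
  each bipartite component, that is, by a cross-polytope. The bound n - 1 is a budget. A component C
  with edges needs at most |C| - 2 edges before its monomial can be completed to the next power by
  any two vertices on opposite sides (or by any single vertex, if C is not bipartite), and one more
  edge completes the product over all components. Isolated vertices can absorb no edges, so a
  component \<open>C0\<close> that has an edge takes up whatever is left of k; each of the
  hypotheses (i) and (ii) supplies one.\<close>

abbreviation "lookup \<equiv> Poly_Mapping.lookup"
abbreviation "keys \<equiv> Poly_Mapping.keys"
abbreviation "single \<equiv> Poly_Mapping.single"

definition mvar :: "'v \<Rightarrow> 'v \<Rightarrow>\<^sub>0 nat" where
  "mvar v = single v 1"

lemma lookup_mvar: "lookup (mvar u) v = of_bool (u = v)"
  by (simp add: mvar_def lookup_single when_def)

lemma poly_mapping_le_iff_add: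
  fixes s t :: "'v \<Rightarrow>\<^sub>0 nat"
  shows "(\<forall>v. lookup s v \<le> lookup t v) \<longleftrightarrow> (\<exists>r. t = s + r)"
proof
  assume "\<forall>v. lookup s v \<le> lookup t v"
  then have "t = s + (t - s)"
    by (intro poly_mapping_eqI) (simp add: lookup_add lookup_minus)
  then show "\<exists>r. t = s + r" by blast
qed (auto simp: lookup_add)

lemma keys_subset_iff: "keys t \<subseteq> W \<longleftrightarrow> (\<forall>v. v \<notin> W \<longrightarrow> lookup t v = 0)"
  by (auto simp: in_keys_iff)

lemma keys_add_nat:
  fixes s t :: "'v \<Rightarrow>\<^sub>0 nat"
  shows "keys (s + t) = keys s \<union> keys t"
  by (auto simp: in_keys_iff lookup_add)

text \<open>The value type is general because both kinds of restriction occur: of an exponent vector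
  to some variables, and of a polynomial to some monomials.\<close>

definition restr :: "'a set \<Rightarrow> ('a \<Rightarrow>\<^sub>0 'b::zero) \<Rightarrow> 'a \<Rightarrow>\<^sub>0 'b" where
  "restr W t = Abs_poly_mapping (\<lambda>v. if v \<in> W then lookup t v else 0)"

lemma lookup_restr [simp]: "lookup (restr W t) v = (if v \<in> W then lookup t v else 0)"
proof -
  have "finite {v. (if v \<in> W then lookup t v else 0) \<noteq> 0}"
    by (rule finite_subset [OF _ finite_keys [of t]]) (auto simp: in_keys_iff)
  then show ?thesis by (simp add: restr_def)
qed

lemma keys_restr: "keys (restr W t) \<subseteq> W"
  by (auto simp: in_keys_iff split: if_splits)

text \<open>Membership in a power of an edge ideal does not see exponents beyond a bound; truncation
  reduces it to finitely many cases.\<close>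

definition trunc :: "nat \<Rightarrow> ('v \<Rightarrow>\<^sub>0 nat) \<Rightarrow> 'v \<Rightarrow>\<^sub>0 nat" where
  "trunc c t = Abs_poly_mapping (\<lambda>v. min c (lookup t v))"

lemma lookup_trunc [simp]: "lookup (trunc c t) v = min c (lookup t v)"
proof -
  have "finite {v. min c (lookup t v) \<noteq> 0}"
    by (rule finite_subset [OF _ finite_keys [of t]]) (auto simp: in_keys_iff)
  then show ?thesis by (simp add: trunc_def)
qed

lemma trunc_eq_iff: "trunc c s = trunc c t \<longleftrightarrow> (\<forall>v. min c (lookup s v) = min c (lookup t v))"
  by (metis lookup_trunc poly_mapping_eqI)

lemma trunc_add_cong:
  fixes s t r :: "'v \<Rightarrow>\<^sub>0 nat"
  assumes "trunc c s = trunc c t"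
  shows "trunc c (s + r) = trunc c (t + r)"
  unfolding trunc_eq_iff
proof
  fix v
  from assms have "min c (lookup s v) = min c (lookup t v)" by (simp add: trunc_eq_iff)
  then show "min c (lookup (s + r) v) = min c (lookup (t + r) v)"
    by (simp add: lookup_add min_def split: if_splits)
qed

text \<open>The monomials of I(G)^k: \<open>t\<close> is the exponent of a product of k edges and an
  arbitrary cofactor, which is why \<open>zero\<close> admits every \<open>t\<close>. The link with
  polynomials is \<open>ideal_power_edge_ideal\<close>.\<close>

inductive edge_pow :: "'v set set \<Rightarrow> nat \<Rightarrow> ('v \<Rightarrow>\<^sub>0 nat) \<Rightarrow> bool" for E where
  zero [intro!, simp]: "edge_pow E 0 t"
| step: "{u, w} \<in> E \<Longrightarrow> edge_pow E k t \<Longrightarrow> edge_pow E (Suc k) (mvar u + mvar w + t)"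

lemma edge_pow_Suc:
  "edge_pow E (Suc k) t \<longleftrightarrow>
     (\<exists>u w s. {u, w} \<in> E \<and> edge_pow E k s \<and> t = mvar u + mvar w + s)"
  using edge_pow.step by (subst edge_pow.simps) blast

lemma edge_pow_add_right: "edge_pow E k t \<Longrightarrow> edge_pow E k (t + s)"
proof (induction rule: edge_pow.induct)
  case (step u w k t)
  from edge_pow.step [OF step(1) step.IH] show ?case by (simp add: add.assoc)
qed simp

lemma edge_pow_le:
  assumes "edge_pow E k s" "\<And>v. lookup s v \<le> lookup t v"
  shows "edge_pow E k t"
  using assms edge_pow_add_right poly_mapping_le_iff_add by metis

lemma edge_pow_add: "edge_pow E i s \<Longrightarrow> edge_pow E j t \<Longrightarrow> edge_pow E (i + j) (s + t)"
proof (induction rule: edge_pow.induct)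
  case (zero s)
  then show ?case using edge_pow_add_right [of E j t s] by (simp add: add.commute)
next
  case (step u w k s)
  from edge_pow.step [OF step.hyps(1) step.IH [OF step.prems]] show ?case by (simp add: add.assoc)
qed

lemma edge_pow_SucD: "edge_pow E (Suc k) t \<Longrightarrow> edge_pow E k t"
  unfolding edge_pow_Suc by (metis add.commute edge_pow_add_right)

lemma edge_pow_antimono: "edge_pow E k t \<Longrightarrow> j \<le> k \<Longrightarrow> edge_pow E j t"
proof (induction k)
  case (Suc k)
  then show ?case by (cases "j = Suc k") (auto dest: edge_pow_SucD)
qed simp

lemma edge_pow_mono: "edge_pow E k t \<Longrightarrow> E \<subseteq> F \<Longrightarrow> edge_pow F k t"
  by (induction rule: edge_pow.induct) (auto intro: edge_pow.step)

lemma edge_pow_empty [simp]: "edge_pow {} k t \<longleftrightarrow> k = 0"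
  by (cases k) (auto simp: edge_pow_Suc)

lemma edge_pow_edge: "{u, w} \<in> E \<Longrightarrow> edge_pow E 1 (mvar u + mvar w)"
  using edge_pow.step [of u w E 0 0] by simp

text \<open>Edges inside W divide only the part of a monomial supported on W; this is what allows a
  monomial to be restricted to the vertices of a subgraph.\<close>

lemma edge_pow_cong_on:
  assumes "edge_pow E k t" and "\<forall>e\<in>E. e \<subseteq> W" and "\<And>v. v \<in> W \<Longrightarrow> lookup t v \<le> lookup t' v"
  shows "edge_pow E k t'"
  using assms(1,3)
proof (induction arbitrary: t' rule: edge_pow.induct)
  case (step u w k t)
  from step(1) assms(2) have uw: "u \<in> W" "w \<in> W" by auto
  have "edge_pow E k (t' - (mvar u + mvar w))"
  proof (rule step.IH)
    fix v assume "v \<in> W"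
    from step.prems [OF this] show "lookup t v \<le> lookup (t' - (mvar u + mvar w)) v"
      by (simp add: lookup_add lookup_minus)
  qed
  then have *: "edge_pow E (Suc k) (mvar u + mvar w + (t' - (mvar u + mvar w)))"
    by (rule edge_pow.step [OF step(1)])
  have "lookup (mvar u + mvar w) v \<le> lookup t' v" for v
  proof (cases "v \<in> W")
    case True
    from step.prems [OF this] show ?thesis by (simp add: lookup_add)
  next
    case False
    with uw show ?thesis by (auto simp: lookup_add lookup_mvar)
  qed
  then have "mvar u + mvar w + (t' - (mvar u + mvar w)) = t'"
    by (intro poly_mapping_eqI) (simp add: lookup_add[of "mvar u + mvar w"] lookup_minus)
  with * show ?case by simp
qed simp

text \<open>An edge has two distinct ends, so each of the k edges lowers any single exponent by at
  most one, and an exponent of k suffices at every vertex.\<close>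

lemma edge_pow_trunc:
  assumes "\<forall>e\<in>E. card e = 2" "edge_pow E k t" "k \<le> c"
  shows "edge_pow E k (trunc c t)"
  using assms(2,3)
proof (induction arbitrary: c rule: edge_pow.induct)
  case (step u w k t)
  then obtain d where c: "c = Suc d" "k \<le> d" by (cases c) auto
  from step(1) assms(1) have "u \<noteq> w" by fastforce
  then have "lookup (mvar u + mvar w + trunc d t) v \<le> lookup (trunc c (mvar u + mvar w + t)) v" for v
    by (auto simp: c lookup_add lookup_mvar)
  with step.IH [of d] show ?case
    by (intro edge_pow_le [OF edge_pow.step [OF step(1), of k "trunc d t"]]) (use c in auto)
qed simp

text \<open>Weak duality: \<phi> is a fractional cover, and each of the k edges contributes at least
  c to the weight of t. It is applied to the indicator of a vertex cover with c = 1 and to that of a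
  whole component with c = 2.\<close>

lemma edge_pow_weight:
  fixes t :: "'v::finite \<Rightarrow>\<^sub>0 nat"
  assumes "edge_pow E k t" and "\<And>u w. {u, w} \<in> E \<Longrightarrow> c \<le> \<phi> u + \<phi> w"
  shows "c * k \<le> (\<Sum>v\<in>UNIV. \<phi> v * lookup t v)"
  using assms(1)
proof (induction rule: edge_pow.induct)
  case (step u w k t)
  have "(\<Sum>v\<in>UNIV. \<phi> v * lookup (mvar u + mvar w + t) v)
      = \<phi> u + \<phi> w + (\<Sum>v\<in>UNIV. \<phi> v * lookup t v)"
    by (simp add: lookup_add lookup_mvar distrib_left sum.distrib)
  with step.IH assms(2) [OF step(1)] show ?case by simp
qed simp

section \<open>Vertex covers and Koenig duality\<close>

definition vertex_cover :: "'v set set \<Rightarrow> 'v set \<Rightarrow> bool" where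
  "vertex_cover E C \<longleftrightarrow> (\<forall>e\<in>E. e \<inter> C \<noteq> {})"

lemma edge_pow_vertex_cover:
  fixes t :: "'v::finite \<Rightarrow>\<^sub>0 nat"
  assumes "vertex_cover E C" "edge_pow E k t"
  shows "k \<le> sum (lookup t) C"
proof -
  have "1 * k \<le> (\<Sum>v\<in>UNIV. of_bool (v \<in> C) * lookup t v)"
    using assms by (intro edge_pow_weight) (auto simp: vertex_cover_def)
  also have "\<dots> = sum (lookup t) C"
    by (simp add: of_bool_def if_distrib[of "\<lambda>x. x * _"] sum.If_cases)
  finally show ?thesis by simp
qed

text \<open>
  If the edge \<open>ab\<close> cannot be deleted, then some cover of the
  other edges, avoiding \<open>a\<close> and \<open>b\<close>, has weight at most \<open>k\<close>; by submodularity every cover containing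
  both \<open>a\<close> and \<open>b\<close> then has weight at least \<open>k + 2\<close>, so that \<open>ab\<close> can be used.
\<close>

lemma koenig:
  fixes t :: "'v::finite \<Rightarrow>\<^sub>0 nat"
  assumes "A \<inter> B = {}" and "\<forall>e\<in>E. \<exists>a\<in>A. \<exists>b\<in>B. e = {a, b}"
    and "\<And>C. vertex_cover E C \<Longrightarrow> k \<le> sum (lookup t) C"
  shows "edge_pow E k t"
  using assms(2,3)
proof (induction k arbitrary: E t)
  case (Suc k)
  show ?case
    using finite [of E] Suc.prems
  proof (induction E rule: finite_induct)
    case empty
    from empty(2) [of "{}"] show ?case by (simp add: vertex_cover_def)
  next
    case (insert e E)
    show ?case
    proof (cases "\<forall>C. vertex_cover E C \<longrightarrow> Suc k \<le> sum (lookup t) C")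
      case True
      with insert have "edge_pow E (Suc k) t" by auto
      then show ?thesis by (rule edge_pow_mono) auto
    next
      case False
      then obtain C where C: "vertex_cover E C" "sum (lookup t) C \<le> k" by force
      from insert.prems(1) obtain a b where ab: "a \<in> A" "b \<in> B" "e = {a, b}" by blast
      from ab assms(1) have "a \<noteq> b" by blast
      have "\<not> vertex_cover (insert e E) C" using insert.prems(2) [of C] C by auto
      with C ab have notC: "a \<notin> C" "b \<notin> C" by (auto simp: vertex_cover_def)
      have both: "k + 2 \<le> sum (lookup t) D"
        if D: "vertex_cover (insert e E) D" "a \<in> D" "b \<in> D" for D
      proof -
        \<comment> \<open>Covers of a bipartite graph form a lattice: intersect on one side and
          unite on the other. Both combinations cover e as well, because D contains both of its
          ends.\<close>
        define X where "X = (A \<inter> (D \<inter> C)) \<union> (B \<inter> (D \<union> C))"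
        define Y where "Y = (A \<inter> (D \<union> C)) \<union> (B \<inter> (D \<inter> C))"
        have "e' \<inter> X \<noteq> {} \<and> e' \<inter> Y \<noteq> {}" if e': "e' \<in> insert e E" for e'
        proof (cases "e' = e")
          case True
          then show ?thesis using ab D by (auto simp: X_def Y_def)
        next
          case False
          with e' have "e' \<in> E" by simp
          from bspec [OF insert.prems(1) e'] obtain x y where xy: "x \<in> A" "y \<in> B" "e' = {x, y}"
            by blast
          have "e' \<inter> C \<noteq> {}" "e' \<inter> D \<noteq> {}"
            using C(1) D(1) \<open>e' \<in> E\<close> e' by (simp_all add: vertex_cover_def)
          with xy show ?thesis by (auto simp: X_def Y_def)
        qed
        then have "vertex_cover (insert e E) X" "vertex_cover (insert e E) Y"
          unfolding vertex_cover_def by blast+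
        then have "Suc k \<le> sum (lookup t) X" "Suc k \<le> sum (lookup t) Y"
          using insert.prems(2) by blast+
        moreover have "sum (lookup t) X + sum (lookup t) Y \<le> sum (lookup t) D + sum (lookup t) C"
        proof -
          have "sum (lookup t) X = sum (lookup t) (A \<inter> (D \<inter> C)) + sum (lookup t) (B \<inter> (D \<union> C))"
            unfolding X_def using assms(1) by (intro sum.union_disjoint) auto
          moreover have "sum (lookup t) Y = sum (lookup t) (A \<inter> (D \<union> C)) + sum (lookup t) (B \<inter> (D \<inter> C))"
            unfolding Y_def using assms(1) by (intro sum.union_disjoint) auto
          moreover have "sum (lookup t) (A \<inter> (D \<union> C)) + sum (lookup t) (A \<inter> (D \<inter> C))
              = sum (lookup t) (A \<inter> D) + sum (lookup t) (A \<inter> C)"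
            using sum.union_inter [of "A \<inter> D" "A \<inter> C" "lookup t"]
            by (simp add: Int_Un_distrib Int_ac)
          moreover have "sum (lookup t) (B \<inter> (D \<union> C)) + sum (lookup t) (B \<inter> (D \<inter> C))
              = sum (lookup t) (B \<inter> D) + sum (lookup t) (B \<inter> C)"
            using sum.union_inter [of "B \<inter> D" "B \<inter> C" "lookup t"]
            by (simp add: Int_Un_distrib Int_ac)
          moreover have "sum (lookup t) (A \<inter> Z) + sum (lookup t) (B \<inter> Z) \<le> sum (lookup t) Z" for Z
          proof -
            have "sum (lookup t) (A \<inter> Z) + sum (lookup t) (B \<inter> Z) = sum (lookup t) ((A \<inter> Z) \<union> (B \<inter> Z))"
              using assms(1) by (intro sum.union_disjoint [symmetric]) auto
            also have "\<dots> \<le> sum (lookup t) Z" by (intro sum_mono2) auto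
            finally show ?thesis .
          qed
          from this [of C] this [of D] calculation show ?thesis by linarith
        qed
        ultimately show ?thesis using C(2) by linarith
      qed
      \<comment> \<open>Adding either end of e to C gives a cover, which must weigh more than C;
        hence both ends divide t.\<close>
      have pos: "0 < lookup t z" if "z = a \<or> z = b" for z
      proof -
        have "vertex_cover (insert e E) (insert z C)"
          using C that ab by (auto simp: vertex_cover_def)
        from insert.prems(2) [OF this] have "Suc k \<le> lookup t z + sum (lookup t) C"
          using that notC by (auto simp: sum.insert)
        with C(2) show ?thesis by linarith
      qed
      define s where "s = t - (mvar a + mvar b)"
      have t: "t = mvar a + mvar b + s"
        using pos \<open>a \<noteq> b\<close>
        by (intro poly_mapping_eqI) (auto simp: s_def lookup_add lookup_minus lookup_mvar Suc_le_eq)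
      have "edge_pow (insert e E) k s"
      proof (rule Suc.IH)
        show "\<forall>e\<in>insert e E. \<exists>a\<in>A. \<exists>b\<in>B. e = {a, b}" by (rule insert.prems(1))
        \<comment> \<open>Removing one copy of e costs a cover as many units as it has ends of e:
          one unit is made up for by the bound k + 1, two units by \<open>both\<close>.\<close>
        fix D assume D: "vertex_cover (insert e E) D"
        have "sum (lookup t) D = of_bool (a \<in> D) + of_bool (b \<in> D) + sum (lookup s) D"
          by (simp add: t lookup_add lookup_mvar sum.distrib of_bool_def)
        with both [of D] insert.prems(2) [of D] D show "k \<le> sum (lookup s) D"
          by (auto simp: of_bool_def split: if_splits)
      qed
      from edge_pow.step [OF _ this, of a b] ab t show ?thesis by simp
    qed
  qed
qed simp

section \<open>Stanley decompositions of sets of monomials\<close>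

definition cone :: "('v \<Rightarrow>\<^sub>0 nat) \<Rightarrow> 'v set \<Rightarrow> ('v \<Rightarrow>\<^sub>0 nat) set" where
  "cone b Z = {b + z | z. keys z \<subseteq> Z}"

text \<open>A finite partition into sets \<open>cone b Z\<close>, the monomials of the Stanley
  spaces x^b K[Z], all of dimension at least d. The variables are confined to W so that such
  partitions over disjoint sets of variables can be multiplied.\<close>

inductive stanley_set :: "'v set \<Rightarrow> nat \<Rightarrow> ('v \<Rightarrow>\<^sub>0 nat) set \<Rightarrow> bool" for W d where
  empty [intro!, simp]: "stanley_set W d {}"
| cone: "keys b \<subseteq> W \<Longrightarrow> Z \<subseteq> W \<Longrightarrow> d \<le> card Z \<Longrightarrow> stanley_set W d (cone b Z)"
| union: "stanley_set W d L \<Longrightarrow> stanley_set W d M \<Longrightarrow> L \<inter> M = {} \<Longrightarrow> stanley_set W d (L \<union> M)"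

lemma stanley_set_keys: "stanley_set W d L \<Longrightarrow> t \<in> L \<Longrightarrow> keys t \<subseteq> W"
proof (induction rule: stanley_set.induct)
  case (cone b Z)
  then obtain z where "t = b + z" "keys z \<subseteq> Z" by (auto simp: cone_def)
  moreover have "Z \<subseteq> W" "keys b \<subseteq> W" by fact+
  ultimately show ?case by (auto simp: keys_add_nat)
qed auto

lemma stanley_set_UN:
  assumes "finite I" and "\<And>i. i \<in> I \<Longrightarrow> stanley_set W d (L i)"
    and "\<And>i j. i \<in> I \<Longrightarrow> j \<in> I \<Longrightarrow> i \<noteq> j \<Longrightarrow> L i \<inter> L j = {}"
  shows "stanley_set W d (\<Union>i\<in>I. L i)"
  using assms
proof (induction I rule: finite_induct)
  case (insert i I)
  have "stanley_set W d (L i \<union> (\<Union>j\<in>I. L j))"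
  proof (rule stanley_set.union)
    show "L i \<inter> (\<Union>j\<in>I. L j) = {}" using insert.hyps(2) insert.prems(2) [of i] by blast
  qed (use insert in auto)
  then show ?case by simp
qed simp

lemma stanley_set_shift:
  assumes "stanley_set W d L" "W \<subseteq> W'" "keys b \<subseteq> W'"
  shows "stanley_set W' d ((+) b ` L)"
  using assms(1)
proof (induction rule: stanley_set.induct)
  case (cone a Z)
  have "(+) b ` cone a Z = cone (b + a) Z"
    by (simp add: cone_def image_def set_eq_iff add.assoc) metis
  then show ?case
    using cone assms(2,3) stanley_set.cone [of "b + a" W' Z d] by (simp add: keys_add_nat)
next
  case (union L M)
  then have "stanley_set W' d ((+) b ` L \<union> (+) b ` M)" by (intro stanley_set.union) auto
  then show ?case by (simp add: image_Un)
qed simp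

section \<open>Products in disjoint sets of variables\<close>

definition msum :: "('v \<Rightarrow>\<^sub>0 nat) set \<Rightarrow> ('v \<Rightarrow>\<^sub>0 nat) set \<Rightarrow> ('v \<Rightarrow>\<^sub>0 nat) set" where
  "msum L M = {s + t | s t. s \<in> L \<and> t \<in> M}"

lemma restr_add_left:
  fixes s t :: "'v \<Rightarrow>\<^sub>0 nat"
  assumes "W \<inter> W' = {}" "keys s \<subseteq> W" "keys t \<subseteq> W'"
  shows "restr W (s + t) = s"
  using assms by (intro poly_mapping_eqI) (auto simp: lookup_add in_keys_iff)

lemma restr_add_right:
  fixes s t :: "'v \<Rightarrow>\<^sub>0 nat"
  assumes "W \<inter> W' = {}" "keys s \<subseteq> W" "keys t \<subseteq> W'"
  shows "restr W' (s + t) = t"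
  using assms by (intro poly_mapping_eqI) (auto simp: lookup_add in_keys_iff)

lemma restr_add_restr:
  assumes "W \<inter> W' = {}" "keys t \<subseteq> W \<union> W'"
  shows "restr W t + restr W' t = t"
  using assms by (intro poly_mapping_eqI) (auto simp: lookup_add in_keys_iff)

lemma msum_cone_cone:
  fixes W W' :: "'v::finite set"
  assumes "W \<inter> W' = {}" "keys b \<subseteq> W" "Z \<subseteq> W" "keys b' \<subseteq> W'" "Z' \<subseteq> W'"
  shows "msum (cone b Z) (cone b' Z') = cone (b + b') (Z \<union> Z')"
proof -
  have "\<exists>z z'. r = z + z' \<and> keys z \<subseteq> Z \<and> keys z' \<subseteq> Z'" if "keys r \<subseteq> Z \<union> Z'" for r :: "'v \<Rightarrow>\<^sub>0 nat"
  proof (intro exI conjI)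
    show "r = restr Z r + restr Z' r"
      using that assms by (intro restr_add_restr [symmetric]) auto
  qed (rule keys_restr)+
  note split = this
  show ?thesis
  proof (intro set_eqI iffI)
    fix t assume "t \<in> msum (cone b Z) (cone b' Z')"
    then obtain z z' where z: "keys z \<subseteq> Z" "keys z' \<subseteq> Z'" "t = (b + z) + (b' + z')"
      unfolding msum_def cone_def by blast
    then have "t = (b + b') + (z + z')" "keys (z + z') \<subseteq> Z \<union> Z'"
      by (simp_all add: add_ac keys_add_nat) blast
    then show "t \<in> cone (b + b') (Z \<union> Z')" unfolding cone_def by blast
  next
    fix t assume "t \<in> cone (b + b') (Z \<union> Z')"
    then obtain r where r: "t = (b + b') + r" "keys r \<subseteq> Z \<union> Z'" unfolding cone_def by blast
    from split [OF r(2)] obtain z z' where z: "r = z + z'" "keys z \<subseteq> Z" "keys z' \<subseteq> Z'" by blast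
    with r(1) have "t = (b + z) + (b' + z')" by (simp add: add_ac)
    with z show "t \<in> msum (cone b Z) (cone b' Z')"
      unfolding msum_def cone_def by blast
  qed
qed

text \<open>A product of cones in disjoint variables is a cone and the dimensions add. Pieces stay
  disjoint because both factors of a product are recovered from it by restriction.\<close>

lemma stanley_set_msum:
  fixes W W' :: "'v::finite set"
  assumes "W \<inter> W' = {}" "stanley_set W d L" "stanley_set W' d' L'"
  shows "stanley_set (W \<union> W') (d + d') (msum L L')"
  using assms(2)
proof (induction rule: stanley_set.induct)
  case empty
  then show ?case by (simp add: msum_def)
next
  case (cone b Z)
  show ?case using assms(3)
  proof (induction rule: stanley_set.induct)
    case empty
    then show ?case by (simp add: msum_def)
  next
    case (cone b' Z')
    have "card (Z \<union> Z') = card Z + card Z'"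
      using cone(2) \<open>Z \<subseteq> W\<close> assms(1) by (intro card_Un_disjoint) auto
    then show ?case
      using cone \<open>keys b \<subseteq> W\<close> \<open>Z \<subseteq> W\<close> \<open>d \<le> card Z\<close> assms(1)
      by (auto simp: msum_cone_cone keys_add_nat intro!: stanley_set.cone)
  next
    case (union L M)
    have "msum (cone b Z) (L \<union> M) = msum (cone b Z) L \<union> msum (cone b Z) M"
      by (auto simp: msum_def)
    moreover have "msum (cone b Z) L \<inter> msum (cone b Z) M = {}"
    proof -
      have "keys s \<subseteq> W" if "s \<in> cone b Z" for s
        using that stanley_set_keys [OF stanley_set.cone [OF cone]] by blast
      then show ?thesis
        using union.hyps stanley_set_keys [of W' d'] restr_add_right [OF assms(1)]
        by (auto simp: msum_def) (metis disjoint_iff)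
    qed
    ultimately show ?case using union.IH by (metis stanley_set.union)
  qed
next
  case (union L M)
  have "msum (L \<union> M) L' = msum L L' \<union> msum M L'"
    by (auto simp: msum_def)
  moreover have "msum L L' \<inter> msum M L' = {}"
    using union.hyps stanley_set_keys [of W d] stanley_set_keys [OF assms(3)] restr_add_left [OF assms(1)]
    by (auto simp: msum_def) (metis disjoint_iff)
  ultimately show ?case using union.IH by (metis stanley_set.union)
qed

section \<open>Sets determined by truncated exponents\<close>

definition determined :: "nat \<Rightarrow> ('v \<Rightarrow>\<^sub>0 nat) set \<Rightarrow> bool" where
  "determined c L \<longleftrightarrow> (\<forall>s t. trunc c s = trunc c t \<longrightarrow> s \<in> L \<longrightarrow> t \<in> L)"

lemma determinedD: "determined c L \<Longrightarrow> trunc c s = trunc c t \<Longrightarrow> s \<in> L \<Longrightarrow> t \<in> L"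
  unfolding determined_def by blast

lemma finite_trunc_range: "finite {w. trunc c w = (w :: 'v::finite \<Rightarrow>\<^sub>0 nat)}"
proof -
  have "lookup w v \<le> c" if "trunc c w = w" for w and v :: 'v
    using that lookup_trunc [of c w v] by simp
  then have "lookup ` {w. trunc c w = (w :: 'v \<Rightarrow>\<^sub>0 nat)} \<subseteq> (UNIV :: 'v set) \<rightarrow>\<^sub>E {..c}"
    by auto
  moreover have "finite ((UNIV :: 'v set) \<rightarrow>\<^sub>E {..c})" by (intro finite_PiE) auto
  ultimately show ?thesis
    by (meson finite_imageD finite_subset inj_onI poly_mapping_eq_iff [THEN iffD2])
qed

lemma trunc_trunc [simp]: "trunc c (trunc c t) = trunc c t"
  by (simp add: trunc_eq_iff)

text \<open>Each fibre of the truncation is a cone: it is based at a truncated vector w, and the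
  variables with exponent exactly c in w are free. They divide w because c is positive, so they lie
  in W. A fibre may have no free variable, hence the dimension 0.\<close>

lemma stanley_set_determined:
  fixes L :: "('v::finite \<Rightarrow>\<^sub>0 nat) set"
  assumes "determined c L" "0 < c" "\<And>t. t \<in> L \<Longrightarrow> keys t \<subseteq> W"
  shows "stanley_set W 0 L"
proof -
  define Z where "Z w = {v. lookup w v = c}" for w :: "'v \<Rightarrow>\<^sub>0 nat"
  define I where "I = {w. trunc c w = w \<and> w \<in> L}"
  have fib: "{t. trunc c t = w} = cone w (Z w)" if "trunc c w = w" for w :: "'v \<Rightarrow>\<^sub>0 nat"
  proof (intro set_eqI iffI)
    fix t assume t: "t \<in> {t. trunc c t = w}"
    then have w: "lookup w v = min c (lookup t v)" for v by auto
    have "t = w + (t - w)"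
      by (intro poly_mapping_eqI) (simp add: lookup_add lookup_minus w)
    moreover have "keys (t - w) \<subseteq> Z w"
      by (auto simp: in_keys_iff lookup_minus w Z_def)
    ultimately show "t \<in> cone w (Z w)" unfolding cone_def by blast
  next
    fix t assume "t \<in> cone w (Z w)"
    then obtain z where z: "t = w + z" "keys z \<subseteq> Z w" by (auto simp: cone_def)
    have "min c (lookup (w + z) v) = lookup w v" for v
    proof (cases "v \<in> Z w")
      case False
      with z(2) have "lookup z v = 0" by (auto simp: in_keys_iff)
      with that show ?thesis by (metis add.right_neutral lookup_add lookup_trunc)
    qed (simp add: Z_def lookup_add)
    with z show "t \<in> {t. trunc c t = w}" by (auto intro: poly_mapping_eqI)
  qed
  have "stanley_set W 0 (\<Union>w\<in>I. cone w (Z w))"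
  proof (rule stanley_set_UN)
    show "finite I" unfolding I_def by (rule finite_subset [OF _ finite_trunc_range]) auto
    show "stanley_set W 0 (cone w (Z w))" if "w \<in> I" for w
    proof (rule stanley_set.cone)
      show *: "keys w \<subseteq> W" using that assms(3) by (auto simp: I_def)
      with assms(2) show "Z w \<subseteq> W" by (auto simp: Z_def in_keys_iff)
    qed simp
    show "cone v (Z v) \<inter> cone w (Z w) = {}" if "v \<in> I" "w \<in> I" "v \<noteq> w" for v w
      using that fib [of v] fib [of w] by (auto simp: I_def)
  qed
  moreover have "(\<Union>w\<in>I. cone w (Z w)) = L"
  proof (intro set_eqI iffI)
    fix t assume "t \<in> (\<Union>w\<in>I. cone w (Z w))"
    then obtain w where w: "w \<in> I" "t \<in> cone w (Z w)" by blast
    then have "trunc c w = trunc c t" using fib [of w] by (auto simp: I_def)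
    with w assms(1) show "t \<in> L" by (auto simp: I_def dest: determinedD)
  next
    fix t assume "t \<in> L"
    then have "trunc c t \<in> I"
      using determinedD [OF assms(1), of t "trunc c t"] by (simp add: I_def)
    moreover have "t \<in> cone (trunc c t) (Z (trunc c t))" using fib [of "trunc c t"] by auto
    ultimately show "t \<in> (\<Union>w\<in>I. cone w (Z w))" by blast
  qed
  ultimately show ?thesis by simp
qed

definition ray :: "'v \<Rightarrow> nat \<Rightarrow> 'v \<Rightarrow>\<^sub>0 nat" where
  "ray v m = single v m"

lemma lookup_ray: "lookup (ray v m) u = (if u = v then m else 0)"
  by (simp add: ray_def lookup_single when_def)

lemma keys_ray: "keys (ray v m) \<subseteq> {v}"
  by (auto simp: in_keys_iff lookup_ray split: if_splits)

lemma ray_add: "ray v (m + n) = ray v m + ray v n"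
  by (simp add: ray_def single_add)

lemma cone_ray: "cone (ray v m) {v} = {ray v n | n. m \<le> n}"
proof (intro set_eqI iffI)
  fix t assume "t \<in> cone (ray v m) {v}"
  then obtain z where z: "t = ray v m + z" "keys z \<subseteq> {v}" by (auto simp: cone_def)
  then have "t = ray v (m + lookup z v)"
    by (intro poly_mapping_eqI) (auto simp: lookup_add lookup_ray keys_subset_iff)
  then show "t \<in> {ray v n | n. m \<le> n}" by (metis (mono_tags, lifting) CollectI le_add1)
next
  fix t assume "t \<in> {ray v n | n. m \<le> n}"
  then obtain n where "t = ray v n" "m \<le> n" by blast
  then have "t = ray v m + ray v (n - m)" by (simp flip: ray_add)
  with keys_ray [of v "n - m"] show "t \<in> cone (ray v m) {v}" unfolding cone_def by blast
qed

text \<open>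
  A set closed under a direction \<open>v\<close> is sliced by the first exponent of \<open>v\<close> at which it contains a
  given monomial in the other variables.
\<close>

lemma stanley_set_closed_direction:
  fixes L :: "('v::finite \<Rightarrow>\<^sub>0 nat) set"
  assumes det: "determined c L" "0 < c" and keys: "\<And>t. t \<in> L \<Longrightarrow> keys t \<subseteq> W"
    and "v \<in> W" and closed: "\<And>t m. t \<in> L \<Longrightarrow> t + ray v m \<in> L"
  shows "stanley_set W 1 L"
proof -
  define M where "M m = {r. v \<notin> keys r \<and> r + ray v m \<in> L \<and> (\<forall>i<m. r + ray v i \<notin> L)}" for m
  \<comment> \<open>Finitely many slices suffice: beyond the exponent c membership no longer
    changes, so the first entry into L is at most c.\<close>
  have le: "m \<le> c" if "r + ray v m \<in> L" "\<forall>i<m. r + ray v i \<notin> L" "v \<notin> keys r" for r m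
  proof (rule ccontr)
    assume "\<not> m \<le> c"
    then have "trunc c (r + ray v m) = trunc c (r + ray v c)"
      using that(3) by (auto simp: trunc_eq_iff lookup_add lookup_ray)
    with det(1) that(1) have "r + ray v c \<in> L" by (metis determinedD)
    with that \<open>\<not> m \<le> c\<close> show False by auto
  qed
  have L: "L = (\<Union>m\<le>c. msum (M m) (cone (ray v m) {v}))"
  proof (intro set_eqI iffI)
    fix t assume t: "t \<in> L"
    define r where "r = restr (- {v}) t"
    have r: "v \<notin> keys r" by (simp add: r_def in_keys_iff)
    have t': "t = r + ray v (lookup t v)"
      by (intro poly_mapping_eqI) (auto simp: r_def lookup_add lookup_ray)
    define m where "m = (LEAST m. r + ray v m \<in> L)"
    have m: "r + ray v m \<in> L" "m \<le> lookup t v" "\<forall>i<m. r + ray v i \<notin> L"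
    proof -
      have *: "r + ray v (lookup t v) \<in> L" using t t' by simp
      show "r + ray v m \<in> L" unfolding m_def using * by (rule LeastI [of "\<lambda>m. r + ray v m \<in> L"])
      show "m \<le> lookup t v" unfolding m_def using * by (rule Least_le [of "\<lambda>m. r + ray v m \<in> L"])
      show "\<forall>i<m. r + ray v i \<notin> L" unfolding m_def using not_less_Least by blast
    qed
    then have "r \<in> M m" "m \<le> c" using r le by (auto simp: M_def)
    moreover have "ray v (lookup t v) \<in> cone (ray v m) {v}" using m(2) by (auto simp: cone_ray)
    ultimately show "t \<in> (\<Union>m\<le>c. msum (M m) (cone (ray v m) {v}))"
      using t' by (auto simp: msum_def)
  next
    fix t assume "t \<in> (\<Union>m\<le>c. msum (M m) (cone (ray v m) {v}))"
    then obtain m r n where "r \<in> M m" "m \<le> n" "t = r + ray v n"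
      by (auto simp: msum_def cone_ray)
    with closed [of "r + ray v m" "n - m"] show "t \<in> L"
      by (simp add: M_def add.assoc flip: ray_add)
  qed
  have W: "W = (W - {v}) \<union> {v}" using \<open>v \<in> W\<close> by auto
  have "stanley_set W 1 (\<Union>m\<le>c. msum (M m) (cone (ray v m) {v}))"
  proof (rule stanley_set_UN)
    fix m assume "m \<in> {..c}"
    have "stanley_set (W - {v}) 0 (M m)"
    proof (rule stanley_set_determined)
      show "determined c (M m)"
      proof -
        have "r + ray v n \<in> L \<longleftrightarrow> r' + ray v n \<in> L" if "trunc c r = trunc c r'" for r r' n
        proof -
          from that have "trunc c (r + ray v n) = trunc c (r' + ray v n)"
            by (rule trunc_add_cong)
          then show ?thesis using determinedD [OF det(1)] by metis
        qed
        moreover have "v \<in> keys r \<longleftrightarrow> v \<in> keys r'" if "trunc c r = trunc c r'" for r r'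
        proof -
          have "min c (lookup r v) = min c (lookup r' v)" using that by (simp add: trunc_eq_iff)
          with det(2) show ?thesis by (auto simp: in_keys_iff min_def split: if_splits)
        qed
        ultimately show ?thesis unfolding determined_def M_def by blast
      qed
    next
      fix r assume "r \<in> M m"
      with keys [of "r + ray v m"] show "keys r \<subseteq> W - {v}" by (auto simp: M_def keys_add_nat)
    qed (rule det)
    moreover have "stanley_set {v} 1 (cone (ray v m) {v})" by (rule stanley_set.cone) (auto simp: keys_ray)
    ultimately show "stanley_set W 1 (msum (M m) (cone (ray v m) {v}))"
      by (subst W) (use stanley_set_msum [of "W - {v}" "{v}" 0 "M m" 1] in auto)
  next
    fix i j :: nat assume "i \<noteq> j"
    have "r = r'" "n = n'"
      if "r \<in> M i" "r' \<in> M j" "r + ray v n = r' + ray v n'" for r r' n n'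
    proof -
      have *: "lookup r u + lookup (ray v n) u = lookup r' u + lookup (ray v n') u" for u
        using that(3) by (metis lookup_add)
      show "r = r'"
      proof (rule poly_mapping_eqI)
        fix u
        show "lookup r u = lookup r' u"
          using * [of u] that(1,2) by (cases "u = v") (simp_all add: lookup_ray M_def in_keys_iff)
      qed
      with * [of v] show "n = n'" by (simp add: lookup_ray)
    qed
    moreover have "\<not> (r \<in> M i \<and> r \<in> M j)" for r
      using \<open>i \<noteq> j\<close> by (auto simp: M_def) (metis linorder_neqE_nat)
    ultimately show "msum (M i) (cone (ray v i) {v}) \<inter> msum (M j) (cone (ray v j) {v}) = {}"
      by (fastforce simp: msum_def cone_ray)
  qed simp
  with L show ?thesis by simp
qed

text \<open>Order convexity with respect to divisibility, the property of a difference of two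
  monomial ideals that survives the removal of the monomials with a given free direction.\<close>

definition mconvex :: "('v \<Rightarrow>\<^sub>0 nat) set \<Rightarrow> bool" where
  "mconvex L \<longleftrightarrow> (\<forall>r s t. r \<in> L \<longrightarrow> r + s + t \<in> L \<longrightarrow> r + s \<in> L)"

lemma mconvexD: "mconvex L \<Longrightarrow> r \<in> L \<Longrightarrow> r + s + t \<in> L \<Longrightarrow> r + s \<in> L"
  unfolding mconvex_def by blast

text \<open>
  Splitting off the monomials for which a given direction is free leaves a convex set: by convexity,
  a direction that is free for a multiple of \<open>t\<close> is free for \<open>t\<close>.
\<close>

lemma stanley_set_free_directions:
  fixes L :: "('v::finite \<Rightarrow>\<^sub>0 nat) set"
  assumes "finite D" "D \<subseteq> W" "0 < c" "determined c L" "mconvex L" "\<And>t. t \<in> L \<Longrightarrow> keys t \<subseteq> W"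
    and "\<And>t. t \<in> L \<Longrightarrow> \<exists>v\<in>D. \<forall>m. t + ray v m \<in> L"
  shows "stanley_set W 1 L"
  using assms(1,2,4-)
proof (induction D arbitrary: L rule: finite_induct)
  case empty
  then have "L = {}" by blast
  then show ?case by simp
next
  case (insert v D)
  define M where "M = {t \<in> L. \<forall>m. t + ray v m \<in> L}"
  note conv = mconvexD [OF insert.prems(3)]
  have free: "r \<in> M" if "r \<in> L" "r + s \<in> M" for r s
  proof -
    have "r + ray v m \<in> L" for m
      using that conv [of r "ray v m" s] by (simp add: M_def add_ac)
    with that show ?thesis by (simp add: M_def)
  qed
  have ray: "r + ray v m \<in> M" if "r \<in> M" for r m
    using that by (simp add: M_def add.assoc flip: ray_add)
  have M: "determined c M"
  proof -
    have "t + ray v m \<in> L" if "trunc c s = trunc c t" "s + ray v m \<in> L" for s t m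
    proof -
      have "trunc c (s + ray v m) = trunc c (t + ray v m)"
        using that(1) by (rule trunc_add_cong)
      with insert.prems(2) that(2) show ?thesis by (metis determinedD)
    qed
    with determinedD [OF insert.prems(2)] show ?thesis unfolding determined_def M_def by blast
  qed
  have "stanley_set W 1 M"
    using M assms(3) insert.prems(1,4) ray by (intro stanley_set_closed_direction) (auto simp: M_def)
  moreover have "stanley_set W 1 (L - M)"
  proof (rule insert.IH)
    show "determined c (L - M)"
      using M insert.prems(2) unfolding determined_def by (metis Diff_iff)
    show "mconvex (L - M)"
      unfolding mconvex_def using conv free by (metis Diff_iff add.assoc)
    fix t assume t: "t \<in> L - M"
    with insert.prems(5) obtain u where u: "u \<in> insert v D" "\<forall>m. t + ray u m \<in> L" by blast
    with t have "u \<in> D" by (auto simp: M_def)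
    with u t free show "\<exists>v\<in>D. \<forall>m. t + ray v m \<in> L - M" by blast
  qed (use insert.prems in auto)
  ultimately have "stanley_set W 1 (M \<union> (L - M))" by (rule stanley_set.union) auto
  moreover have "M \<union> (L - M) = L" by (auto simp: M_def)
  ultimately show ?case by simp
qed

text \<open>The inductive closure is unfolded into an explicit set of cones. Unique existence is the
  form in which directness of the sum is checked later.\<close>

lemma stanley_set_partition:
  assumes "stanley_set W d L"
  shows "\<exists>D. finite D \<and> (\<forall>p\<in>D. d \<le> card (snd p) \<and> cone (fst p) (snd p) \<subseteq> L) \<and>
    (\<forall>t\<in>L. \<exists>!p. p \<in> D \<and> t \<in> cone (fst p) (snd p))"
  using assms
proof (induction rule: stanley_set.induct)
  case empty
  show ?case by (rule exI [of _ "{}"]) auto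
next
  case (cone b Z)
  then show ?case by (intro exI [of _ "{(b, Z)}"]) auto
next
  case (union L M)
  from union.IH(1) obtain D where D: "finite D"
      "\<forall>p\<in>D. d \<le> card (snd p) \<and> cone (fst p) (snd p) \<subseteq> L"
      "\<forall>t\<in>L. \<exists>!p. p \<in> D \<and> t \<in> cone (fst p) (snd p)" by (elim exE conjE)
  from union.IH(2) obtain D' where D': "finite D'"
      "\<forall>p\<in>D'. d \<le> card (snd p) \<and> cone (fst p) (snd p) \<subseteq> M"
      "\<forall>t\<in>M. \<exists>!p. p \<in> D' \<and> t \<in> cone (fst p) (snd p)" by (elim exE conjE)
  have "\<exists>!p. p \<in> D \<union> D' \<and> t \<in> cone (fst p) (snd p)" if "t \<in> L \<union> M" for t
  proof (cases "t \<in> L")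
    case True
    with union.hyps have "t \<notin> M" by blast
    with D'(2) have "p \<in> D \<union> D' \<and> t \<in> cone (fst p) (snd p)
        \<longleftrightarrow> p \<in> D \<and> t \<in> cone (fst p) (snd p)" for p by blast
    with D(3) True show ?thesis by simp
  next
    case False
    with D(2) have "p \<in> D \<union> D' \<and> t \<in> cone (fst p) (snd p)
        \<longleftrightarrow> p \<in> D' \<and> t \<in> cone (fst p) (snd p)" for p by blast
    with D'(3) False that show ?thesis by simp
  qed
  moreover have "\<forall>p\<in>D \<union> D'. d \<le> card (snd p) \<and> cone (fst p) (snd p) \<subseteq> L \<union> M"
    using D(2) D'(2) by blast
  ultimately show ?case using D(1) D'(1) by (intro exI [of _ "D \<union> D'"]) simp
qed

section \<open>Layers of powers of edge ideals\<close>

definition edge_pow_on :: "'v set set \<Rightarrow> 'v set \<Rightarrow> nat \<Rightarrow> ('v \<Rightarrow>\<^sub>0 nat) set" where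
  "edge_pow_on E W k = {t. keys t \<subseteq> W \<and> edge_pow E k t}"

definition layer :: "'v set set \<Rightarrow> 'v set \<Rightarrow> nat \<Rightarrow> ('v \<Rightarrow>\<^sub>0 nat) set" where
  "layer E W k = edge_pow_on E W k - edge_pow_on E W (Suc k)"

text \<open>Truncation at a value of at least k keeps the k edges, by \<open>edge_pow_trunc\<close>;
  positivity of c keeps the support, and with it the confinement to W.\<close>

lemma determined_edge_pow_on:
  assumes "\<forall>e\<in>E. card e = 2" "k \<le> c" "0 < c"
  shows "determined c (edge_pow_on E W k)"
  unfolding determined_def
proof (intro allI impI)
  fix s t :: "'a \<Rightarrow>\<^sub>0 nat" assume st: "trunc c s = trunc c t" "s \<in> edge_pow_on E W k"
  then have "edge_pow E k (trunc c t)"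
    using edge_pow_trunc [OF assms(1), of k s c] assms(2) by (simp add: edge_pow_on_def)
  then have "edge_pow E k t" by (rule edge_pow_le) simp
  moreover have "lookup s v = 0 \<longleftrightarrow> lookup t v = 0" for v
  proof -
    have "min c (lookup s v) = min c (lookup t v)" using st(1) by (simp add: trunc_eq_iff)
    with assms(3) show ?thesis by (auto simp: min_def split: if_splits)
  qed
  ultimately show "t \<in> edge_pow_on E W k" using st(2) by (simp add: edge_pow_on_def keys_subset_iff)
qed

lemma determined_layer:
  assumes "\<forall>e\<in>E. card e = 2"
  shows "determined (Suc k) (layer E W k)"
  using determined_edge_pow_on [OF assms, of k "Suc k" W] determined_edge_pow_on [OF assms, of "Suc k" "Suc k" W]
  unfolding determined_def layer_def by (metis Diff_iff le_Suc_eq order_refl zero_less_Suc)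

lemma edge_pow_on_add_right: "t \<in> edge_pow_on E W k \<Longrightarrow> keys s \<subseteq> W \<Longrightarrow> t + s \<in> edge_pow_on E W k"
  by (simp add: edge_pow_on_def keys_add_nat edge_pow_add_right)

lemma mconvex_layer: "mconvex (layer E W k)"
  by (auto simp: mconvex_def layer_def edge_pow_on_def keys_add_nat edge_pow_add_right)

lemma stanley_set_0_edge_pow_on:
  fixes E :: "'v::finite set set"
  assumes "\<forall>e\<in>E. card e = 2"
  shows "stanley_set W 0 (edge_pow_on E W k)"
  by (rule stanley_set_determined [OF determined_edge_pow_on [OF assms, of k "Suc k"]]) (auto simp: edge_pow_on_def)

lemma stanley_set_0_layer:
  fixes E :: "'v::finite set set"
  assumes "\<forall>e\<in>E. card e = 2"
  shows "stanley_set W 0 (layer E W k)"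
  by (rule stanley_set_determined [OF determined_layer [OF assms]]) (auto simp: edge_pow_on_def layer_def)

text \<open>An ideal is closed under multiplication, so every variable in W is a free
  direction.\<close>

lemma stanley_set_1_edge_pow_on:
  fixes E :: "'v::finite set set"
  assumes "\<forall>e\<in>E. card e = 2" "v \<in> W"
  shows "stanley_set W 1 (edge_pow_on E W k)"
proof (rule stanley_set_closed_direction [OF determined_edge_pow_on [OF assms(1), of k "Suc k"]])
  fix t m assume "t \<in> edge_pow_on E W k"
  then show "t + ray v m \<in> edge_pow_on E W k"
    using keys_ray [of v m] assms(2) by (intro edge_pow_on_add_right) auto
qed (use assms in \<open>auto simp: edge_pow_on_def\<close>)

text \<open>
  By Koenig's theorem a monomial outside the power \<open>k + 1\<close> has a vertex cover of weight at most \<open>k\<close>;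
  a vertex outside the cover is a free direction.
\<close>

lemma stanley_set_1_layer:
  fixes E :: "'v::finite set set"
  assumes E: "\<forall>e\<in>E. card e = 2" "\<forall>e\<in>E. e \<subseteq> W" and bip: "bipartite W E" and "W \<noteq> {}"
  shows "stanley_set W 1 (layer E W k)"
proof (rule stanley_set_free_directions [OF _ _ _ determined_layer [OF E(1)] mconvex_layer])
  fix t assume t: "t \<in> layer E W k"
  from bip obtain A B where AB: "A \<union> B = W" "A \<inter> B = {}" "\<forall>e\<in>E. \<exists>a\<in>A. \<exists>b\<in>B. e = {a, b}"
    unfolding bipartite_def by auto
  have "\<exists>C. vertex_cover E C \<and> sum (lookup t) C < Suc k"
    using koenig [OF AB(2,3), of "Suc k" t] t by (force simp: layer_def edge_pow_on_def)
  then obtain C where C: "vertex_cover E C" "sum (lookup t) C < Suc k" by blast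
  obtain C' v where C': "vertex_cover E C'" "sum (lookup t) C' < Suc k" "v \<in> W" "v \<notin> C'"
  proof (cases "W \<subseteq> C")
    case False
    with C that show ?thesis by blast
  next
    case True
    show ?thesis
    proof (cases "E = {}")
      case True
      with \<open>W \<noteq> {}\<close> that [of "{}"] show ?thesis by (auto simp: vertex_cover_def)
    next
      case False
      with AB(3) obtain b where "b \<in> B" by blast
      \<comment> \<open>A cover that exhausts W can lose one vertex of the side B, since every edge
        keeps its end in A.\<close>
      have "vertex_cover E (C - {b})"
        unfolding vertex_cover_def
      proof
        fix e assume "e \<in> E"
        with AB(3) obtain a where "a \<in> A" "a \<in> e" by blast
        with AB \<open>b \<in> B\<close> True show "e \<inter> (C - {b}) \<noteq> {}" by blast
      qed
      moreover have "sum (lookup t) (C - {b}) \<le> sum (lookup t) C" by (rule sum_mono2) auto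
      ultimately show ?thesis using that [of "C - {b}" b] C(2) AB(1) \<open>b \<in> B\<close> by auto
    qed
  qed
  have "t + ray v m \<in> layer E W k" for m
  proof -
    have "sum (lookup (t + ray v m)) C' = sum (lookup t) C'"
      using C'(4) by (intro sum.cong) (auto simp: lookup_add lookup_ray)
    with edge_pow_vertex_cover [OF C'(1), of "Suc k" "t + ray v m"] C'(2)
    have "\<not> edge_pow E (Suc k) (t + ray v m)" by linarith
    moreover have "t + ray v m \<in> edge_pow_on E W k"
      using t keys_ray [of v m] C'(3) by (intro edge_pow_on_add_right) (auto simp: layer_def)
    ultimately show ?thesis by (simp add: layer_def edge_pow_on_def)
  qed
  with C'(3) show "\<exists>v\<in>W. \<forall>m. t + ray v m \<in> layer E W k" by blast
qed (auto simp: layer_def edge_pow_on_def)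

lemma edge_pow_Un_split:
  assumes "edge_pow (E \<union> F) k t"
  shows "\<exists>i j. i + j = k \<and> edge_pow E i t \<and> edge_pow F j t"
  using assms
proof (induction rule: edge_pow.induct)
  case (step u w k t)
  then obtain i j where ij: "i + j = k" "edge_pow E i t" "edge_pow F j t" by blast
  have add: "edge_pow G n t \<Longrightarrow> edge_pow G n (mvar u + mvar w + t)" for G n
    by (metis add.commute edge_pow_add_right)
  from step(1) show ?case
  proof
    assume "{u, w} \<in> E"
    with ij add show ?thesis by (intro exI [of _ "Suc i"] exI [of _ j]) (auto intro: edge_pow.step)
  next
    assume "{u, w} \<in> F"
    with ij add show ?thesis by (intro exI [of _ i] exI [of _ "Suc j"]) (auto intro: edge_pow.step)
  qed
qed auto

text \<open>The order of a product s r in disjoint variables is the sum of the orders. Sort by the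
  order i of s in the powers for E: if i < k, the cofactor r must lie in the power k - i for F, and
  all s of order at least k form one last piece, where r is arbitrary. This is why layers are needed
  for E but only powers for F.\<close>

lemma stanley_set_Un_edge_pow_on:
  fixes E F :: "'v::finite set set"
  assumes disj: "W \<inter> X = {}" and E: "\<forall>e\<in>E. e \<subseteq> W" and F: "\<forall>e\<in>F. e \<subseteq> X"
    and layer: "\<And>i. stanley_set W d (layer E W i)" and pow: "\<And>i. stanley_set W d (edge_pow_on E W i)"
    and pow': "\<And>i. stanley_set X d' (edge_pow_on F X i)"
  shows "stanley_set (W \<union> X) (d + d') (edge_pow_on (E \<union> F) (W \<union> X) k)"
proof -
  define L where "L i = (if i < k then layer E W i else edge_pow_on E W i)" for i
  have sub: "L i \<subseteq> edge_pow_on E W i" for i by (auto simp: L_def layer_def)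
  have eq: "edge_pow_on (E \<union> F) (W \<union> X) k = (\<Union>i\<le>k. msum (L i) (edge_pow_on F X (k - i)))"
  proof (intro set_eqI iffI)
    fix t assume "t \<in> edge_pow_on (E \<union> F) (W \<union> X) k"
    then have t: "keys t \<subseteq> W \<union> X" "edge_pow (E \<union> F) k t" by (auto simp: edge_pow_on_def)
    from edge_pow_Un_split [OF t(2)] obtain i j
      where ij: "i + j = k" "edge_pow E i t" "edge_pow F j t" by blast
    define s r where "s = restr W t" and "r = restr X t"
    have s: "edge_pow E i s" using edge_pow_cong_on [OF ij(2) E, of s] by (simp add: s_def)
    have r: "edge_pow F j r" using edge_pow_cong_on [OF ij(3) F, of r] by (simp add: r_def)
    have keys: "keys s \<subseteq> W" "keys r \<subseteq> X" by (simp_all add: s_def r_def keys_restr)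
    \<comment> \<open>The order of s, capped at k.\<close>
    define m where "m = Max {n. n \<le> k \<and> edge_pow E n s}"
    have fin: "finite {n. n \<le> k \<and> edge_pow E n s}" by simp
    have m: "m \<le> k" "edge_pow E m s"
      using Max_in [OF fin] s ij(1) unfolding m_def by blast+
    have max: "n \<le> m" if "n \<le> k" "edge_pow E n s" for n
      unfolding m_def using that by (intro Max_ge) auto
    have "s \<in> L m"
    proof (cases "m < k")
      case True
      with max [of "Suc m"] have "\<not> edge_pow E (Suc m) s" by fastforce
      with True m keys show ?thesis by (simp add: L_def layer_def edge_pow_on_def)
    qed (use m keys in \<open>simp add: L_def edge_pow_on_def\<close>)
    moreover have "r \<in> edge_pow_on F X (k - m)"
      using max [of i] s r ij(1) keys by (auto simp: edge_pow_on_def intro: edge_pow_antimono)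
    moreover have "t = s + r"
      unfolding s_def r_def by (rule restr_add_restr [OF disj t(1), symmetric])
    ultimately show "t \<in> (\<Union>i\<le>k. msum (L i) (edge_pow_on F X (k - i)))"
      using m(1) by (auto simp: msum_def)
  next
    fix t assume "t \<in> (\<Union>i\<le>k. msum (L i) (edge_pow_on F X (k - i)))"
    then obtain i s r where i: "i \<le> k" "s \<in> L i" "r \<in> edge_pow_on F X (k - i)" "t = s + r"
      unfolding msum_def by blast
    with sub have sr: "s \<in> edge_pow_on E W i" "r \<in> edge_pow_on F X (k - i)" by blast+
    then have "edge_pow (E \<union> F) (i + (k - i)) (s + r)"
      by (intro edge_pow_add) (auto simp: edge_pow_on_def intro: edge_pow_mono)
    with i sr show "t \<in> edge_pow_on (E \<union> F) (W \<union> X) k" by (auto simp: edge_pow_on_def keys_add_nat)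
  qed
  show ?thesis unfolding eq
  proof (rule stanley_set_UN)
    show "stanley_set (W \<union> X) (d + d') (msum (L i) (edge_pow_on F X (k - i)))" for i
      using disj layer pow pow' by (intro stanley_set_msum) (auto simp: L_def)
  next
    fix i j assume ij: "i \<in> {..k}" "j \<in> {..k}" "i \<noteq> j"
    have disj_lt: "L i \<inter> L j = {}" if "i < j" "j \<le> k" for i j
    proof -
      have "edge_pow E (Suc i) s" if "s \<in> L j" for s
        using sub [of j] that edge_pow_antimono [of E j s "Suc i"] \<open>i < j\<close>
        by (auto simp: edge_pow_on_def)
      moreover have "\<not> edge_pow E (Suc i) s" if "s \<in> L i" for s
        using that \<open>i < j\<close> \<open>j \<le> k\<close> by (auto simp: L_def layer_def edge_pow_on_def)
      ultimately show ?thesis by blast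
    qed
    have "L i \<inter> L j = {}"
      using disj_lt [of i j] disj_lt [of j i] ij by (metis Int_commute atMost_iff linorder_neqE_nat)
    moreover have "restr W t \<in> L i" if "t \<in> msum (L i) (edge_pow_on F X n)" for t i n
    proof -
      from that obtain s r where sr: "s \<in> L i" "r \<in> edge_pow_on F X n" "t = s + r"
        unfolding msum_def by blast
      then have "keys s \<subseteq> W" "keys r \<subseteq> X" using sub [of i] by (auto simp: edge_pow_on_def)
      from restr_add_left [OF disj this] sr show ?thesis by simp
    qed
    ultimately show "msum (L i) (edge_pow_on F X (k - i)) \<inter> msum (L j) (edge_pow_on F X (k - j)) = {}"
      by blast
  qed simp
qed

section \<open>Forests\<close>

lemma graph_cycle_mono: "graph_cycle E c \<Longrightarrow> E \<subseteq> F \<Longrightarrow> graph_cycle F c"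
  by (auto simp: graph_cycle_def)

text \<open>The first vertex of a longest path is such a leaf: a second neighbour would extend the
  path or, if it lies on the path, close a cycle.\<close>

lemma forest_leaf:
  fixes E :: "'v::finite set set"
  assumes E: "\<forall>e\<in>E. card e = 2" "E \<noteq> {}" and acyclic: "\<nexists>c. graph_cycle E c"
  obtains x y where "{x, y} \<in> E" "x \<noteq> y" "\<And>z. {x, z} \<in> E \<Longrightarrow> z = y"
proof -
  define P where "P c \<longleftrightarrow> 2 \<le> length c \<and> distinct c \<and>
    (\<forall>i. Suc i < length c \<longrightarrow> {c ! i, c ! Suc i} \<in> E)" for c :: "'v list"
  from E obtain e where "e \<in> E" "card e = 2" by blast
  then obtain u w where "{u, w} \<in> E" "u \<noteq> w" by (auto simp: card_2_iff)
  then have "P [u, w]" by (auto simp: P_def less_Suc_eq nth_Cons split: nat.splits)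
  moreover have "length c \<le> CARD('v)" if "P c" for c
    using that distinct_card [of c] card_mono [of UNIV "set c"] by (simp add: P_def)
  ultimately obtain c where c: "P c" "\<And>c'. P c' \<Longrightarrow> length c' \<le> length c"
    using Lattices_Big.ex_has_greatest_nat [of P _ length "Suc CARD('v)"] by (metis le_imp_less_Suc)
  then obtain x y cs where xy: "c = x # y # cs"
    by (cases c; cases "tl c") (auto simp: P_def)
  show thesis
  proof (rule that [of x y])
    show "{x, y} \<in> E" using c(1) by (force simp: P_def xy)
    show "x \<noteq> y" using c(1) by (simp add: P_def xy)
    fix z assume z: "{x, z} \<in> E"
    show "z = y"
    proof (rule ccontr)
      assume "z \<noteq> y"
      from z E have "z \<noteq> x" by fastforce
      have "z \<in> set c"
      proof (rule ccontr)
        assume "z \<notin> set c"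
        have "P (z # c)"
          unfolding P_def
        proof (intro conjI allI impI)
          fix i assume "Suc i < length (z # c)"
          then show "{(z # c) ! i, (z # c) ! Suc i} \<in> E"
            using c(1) z by (cases i) (auto simp: P_def xy insert_commute)
        qed (use c(1) \<open>z \<notin> set c\<close> in \<open>auto simp: P_def\<close>)
        with c(2) show False by fastforce
      qed
      then obtain i where i: "i < length c" "c ! i = z" by (auto simp: in_set_conv_nth)
      with \<open>z \<noteq> y\<close> \<open>z \<noteq> x\<close> have "2 \<le> i"
        by (cases i; cases "i - 1") (auto simp: xy)
      have "graph_cycle E (take (Suc i) c)"
        unfolding graph_cycle_def
      proof (intro conjI allI impI)
        have "last (take (Suc i) c) = z"
          unfolding take_Suc_conv_app_nth [OF i(1)] i(2) by simp
        moreover have "hd (take (Suc i) c) = x" by (simp add: xy)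
        ultimately show "{last (take (Suc i) c), hd (take (Suc i) c)} \<in> E" using z
          by (simp add: insert_commute)
      qed (use c(1) i \<open>2 \<le> i\<close> in \<open>auto simp: P_def\<close>)
      with acyclic show False by blast
    qed
  qed
qed

section \<open>Cancelling a leaf edge\<close>

lemma mvar_le_split:
  fixes t :: "'v \<Rightarrow>\<^sub>0 nat"
  assumes "0 < lookup t x"
  shows "t = mvar x + (t - mvar x)"
proof (rule poly_mapping_eqI)
  fix v
  from assms show "lookup t v = lookup (mvar x + (t - mvar x)) v"
    by (cases "x = v") (simp_all add: lookup_add lookup_minus lookup_mvar)
qed

text \<open>The only edge through the leaf x is xy, and wy serves in its place; if no edge of the
  factorization uses x, then x sits in the cofactor and can be traded freely.\<close>

lemma edge_pow_leaf_replace: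
  assumes "edge_pow E k t" "t = mvar x + s" and leaf: "\<And>z. {x, z} \<in> E \<Longrightarrow> z = y" and "{w, y} \<in> E"
  shows "edge_pow E k (mvar w + s)"
  using assms(1,2)
proof (induction arbitrary: s rule: edge_pow.induct)
  case (step u v k t)
  show ?case
  proof (cases "x \<in> {u, v}")
    case True
    moreover from step(1) have "{v, u} \<in> E" by (simp add: insert_commute)
    ultimately have "mvar u + mvar v = mvar x + mvar y"
      using leaf [of u] leaf [of v] step(1) by (auto simp: add.commute)
    with step.prems have "s = mvar y + t" by (simp add: add.assoc)
    then show ?thesis
      using edge_pow.step [OF assms(4) step(2)] by (simp add: add.assoc)
  next
    case False
    have "0 < lookup (mvar u + mvar v + t) x" unfolding step.prems by (simp add: lookup_add lookup_mvar)
    with False have "0 < lookup t x" by (auto simp: lookup_add lookup_mvar)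
    then have t: "t = mvar x + (t - mvar x)" by (rule mvar_le_split)
    with step.prems have "mvar x + s = mvar x + (mvar u + mvar v + (t - mvar x))"
      by (metis add.left_commute)
    then have "s = mvar u + mvar v + (t - mvar x)" by simp
    with edge_pow.step [OF step(1) step.IH [OF t]] show ?thesis
      by (simp add: add_ac)
  qed
qed simp

text \<open>Take one edge of a factorization. If it is xy, cancel it. If it is yw with another w,
  the remaining factors contain x, which is traded for w. If it avoids y, it also avoids the leaf x,
  and the induction hypothesis applies to the remaining factors. This is the nontrivial half of the
  colon identity I^(k+1) : xy = I^k.\<close>

lemma edge_pow_leaf_cancel:
  assumes "edge_pow E (Suc k) (mvar x + mvar y + t)"
    and leaf: "\<And>z. {x, z} \<in> E \<Longrightarrow> z = y" and "x \<noteq> y"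
  shows "edge_pow E k t"
  using assms(1)
proof (induction k arbitrary: t)
  case (Suc k)
  then obtain u w s where uw: "{u, w} \<in> E" "edge_pow E (Suc k) s"
      "mvar x + mvar y + t = mvar u + mvar w + s"
    by (subst (asm) edge_pow_Suc) blast
  have *: "edge_pow E (Suc k) t"
    if "{y, w} \<in> E" "mvar x + mvar y + t = mvar y + mvar w + s" for w
  proof (cases "w = x")
    case True
    with that(2) have "mvar x + mvar y + t = mvar x + mvar y + s" by (simp add: add_ac)
    with uw(2) show ?thesis by simp
  next
    case False
    from that(2) have "mvar y + (mvar x + t) = mvar y + (mvar w + s)" by (simp add: add_ac)
    then have eq: "mvar x + t = mvar w + s" by simp
    have "0 < lookup (mvar w + s) x" unfolding eq [symmetric] by (simp add: lookup_add lookup_mvar)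
    with False have "0 < lookup s x" by (auto simp: lookup_add lookup_mvar)
    then have s: "s = mvar x + (s - mvar x)" by (rule mvar_le_split)
    with eq have "mvar x + t = mvar x + (mvar w + (s - mvar x))" by (metis add.left_commute)
    then have t: "t = mvar w + (s - mvar x)" by simp
    from that(1) have "{w, y} \<in> E" by (simp add: insert_commute)
    from edge_pow_leaf_replace [OF uw(2) s leaf this] show ?thesis
      by (simp add: t)
  qed
  show ?case
  proof (cases "y \<in> {u, w}")
    case True
    then show ?thesis
      using uw * [of w] * [of u] by (auto simp: insert_commute add_ac)
  next
    case False
    with uw(1) leaf have x: "x \<notin> {u, w}" by (auto simp: insert_commute)
    have "lookup (mvar u + mvar w + s) z = lookup (mvar x + mvar y + t) z" for z
      using uw(3) by simp
    from this [of x] this [of y] x False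
    have "0 < lookup s x" "0 < lookup s y" by (auto simp: lookup_add lookup_mvar)
    then have "s = mvar x + (s - mvar x)" "s - mvar x = mvar y + (s - mvar x - mvar y)"
      using \<open>x \<noteq> y\<close> by (auto intro!: mvar_le_split simp: lookup_minus lookup_mvar)
    then obtain r where s: "s = mvar x + mvar y + r" by (metis add.assoc)
    with uw(3) have "mvar x + mvar y + t = mvar x + mvar y + (mvar u + mvar w + r)"
      by (simp add: add_ac)
    then have "t = mvar u + mvar w + r" by simp
    moreover have "edge_pow E k r" using Suc.IH uw(2) s by blast
    ultimately show ?thesis using uw(1) by (auto intro: edge_pow.step)
  qed
qed simp

lemma ray_Suc: "ray x (Suc m) = mvar x + ray x m"
  using ray_add [of x 1 m] by (simp add: ray_def mvar_def)

lemma ray_0 [simp]: "ray x 0 = 0"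
  by (simp add: ray_def)

lemma edge_pow_leaf_iff:
  assumes "{x, y} \<in> E" and "\<And>z. {x, z} \<in> E \<Longrightarrow> z = y" and "x \<noteq> y"
  shows "edge_pow E (m + k) (ray x m + ray y m + t) \<longleftrightarrow> edge_pow E k t"
proof (induction m)
  case (Suc m)
  have "edge_pow E (Suc (m + k)) (mvar x + mvar y + s) \<longleftrightarrow> edge_pow E (m + k) s" for s
    using edge_pow_leaf_cancel [of E "m + k" x y s] edge_pow.step [OF assms(1), of "m + k" s]
      assms(2,3) by blast
  moreover have "ray x (Suc m) + ray y (Suc m) + t = mvar x + mvar y + (ray x m + ray y m + t)"
    by (simp add: ray_Suc add_ac)
  ultimately show ?case using Suc by simp
qed simp

lemma edge_pow_avoid:
  assumes "edge_pow E k t" "lookup t v = 0"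
  shows "edge_pow {e \<in> E. v \<notin> e} k t"
  using assms
proof (induction rule: edge_pow.induct)
  case (step u w k t)
  then have "v \<noteq> u" "v \<noteq> w" "lookup t v = 0" by (auto simp: lookup_add lookup_mvar)
  with step show ?case by (intro edge_pow.step) auto
qed simp

text \<open>
  For a leaf \<open>x\<close> with neighbour \<open>y\<close> one may use the edge \<open>xy\<close> greedily. This splits the monomials
  according to which of the exponents of \<open>x\<close> and \<open>y\<close> is smaller than the other one and than \<open>k\<close>; in
  the case where it is that of \<open>y\<close>, the direction \<open>x\<close> becomes free.
\<close>

lemma stanley_set_2_forest:
  fixes E :: "'v::finite set set"
  assumes "\<forall>e\<in>E. card e = 2" "\<forall>e\<in>E. e \<subseteq> W" "\<nexists>c. graph_cycle E c" "0 < k"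
  shows "stanley_set W 2 (edge_pow_on E W k)"
  using assms
proof (induction "card W" arbitrary: E W k rule: less_induct)
  case less
  show ?case
  proof (cases "E = {}")
    case True
    with less.prems(4) show ?thesis by (simp add: edge_pow_on_def)
  next
    case False
    with less.prems obtain x y where xy: "{x, y} \<in> E" "x \<noteq> y" "\<And>z. {x, z} \<in> E \<Longrightarrow> z = y"
      using forest_leaf by metis
    have W: "x \<in> W" "y \<in> W" using less.prems(2) xy(1) by auto
    define E1 where "E1 = {e \<in> E. x \<notin> e}"
    define E2 where "E2 = {e \<in> E. y \<notin> e}"
    have E1: "\<forall>e\<in>E1. e \<subseteq> W - {x}" using less.prems(2) by (auto simp: E1_def)
    have E2: "\<forall>e\<in>E2. e \<subseteq> W - {x, y}"
    proof
      fix e assume e: "e \<in> E2"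
      have "x \<notin> e"
      proof
        assume "x \<in> e"
        moreover from e less.prems(1) have "card e = 2" by (auto simp: E2_def)
        ultimately obtain z where "e = {x, z}" by (auto simp: card_2_iff)
        with e xy(3) [of z] show False by (auto simp: E2_def)
      qed
      with e less.prems(2) show "e \<subseteq> W - {x, y}" by (auto simp: E2_def)
    qed
    note leaf_iff = edge_pow_leaf_iff [OF xy(1) xy(3) xy(2)]
    have split: "\<exists>r. t = ray x m + ray y m + r" if "m \<le> lookup t x" "m \<le> lookup t y" for t m
    proof -
      have "\<forall>v. lookup (ray x m + ray y m) v \<le> lookup t v"
        using that xy(2) by (auto simp: lookup_add lookup_ray)
      then show ?thesis using poly_mapping_le_iff_add by blast
    qed
    define T1 where "T1 s = {t \<in> edge_pow_on E W k. lookup t x = s \<and> s \<le> lookup t y}" for s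
    define T2 where "T2 s = {t \<in> edge_pow_on E W k. lookup t y = s \<and> s < lookup t x}" for s
    define T3 where "T3 = {t \<in> edge_pow_on E W k. k \<le> lookup t x \<and> k \<le> lookup t y}"
    have T1: "stanley_set W 2 (T1 s)" if "s < k" for s
    proof -
      \<comment> \<open>After division by the s-th power of xy the variable x is gone, so only edges
        avoiding x can be used and the induction hypothesis applies to W - {x}.\<close>
      have "T1 s = (+) (ray x s + ray y s) ` edge_pow_on E1 (W - {x}) (k - s)"
      proof (intro set_eqI iffI)
        fix t assume t: "t \<in> T1 s"
        then obtain r where r: "t = ray x s + ray y s + r"
          using split [of s t] by (auto simp: T1_def)
        then have rx: "lookup r x = 0" using t xy(2) by (auto simp: T1_def lookup_add lookup_ray)
        from t have "edge_pow E k t" "keys t \<subseteq> W" by (auto simp: T1_def edge_pow_on_def)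
        then have "edge_pow E (k - s) r" using leaf_iff [of s "k - s" r] r that by simp
        then have "edge_pow E1 (k - s) r" unfolding E1_def using rx by (rule edge_pow_avoid)
        moreover have "keys r \<subseteq> W - {x}"
          using \<open>keys t \<subseteq> W\<close> rx by (auto simp: r keys_add_nat in_keys_iff)
        ultimately show "t \<in> (+) (ray x s + ray y s) ` edge_pow_on E1 (W - {x}) (k - s)"
          by (auto simp: edge_pow_on_def r)
      next
        fix t assume "t \<in> (+) (ray x s + ray y s) ` edge_pow_on E1 (W - {x}) (k - s)"
        then obtain r where r: "t = ray x s + ray y s + r" "keys r \<subseteq> W - {x}" "edge_pow E1 (k - s) r"
          by (auto simp: edge_pow_on_def)
        then have "edge_pow E (k - s) r" by (auto simp: E1_def intro: edge_pow_mono)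
        then have "edge_pow E k t" using leaf_iff [of s "k - s" r] r that by simp
        moreover have "keys t \<subseteq> W"
          using r(2) keys_ray [of x s] keys_ray [of y s] W by (auto simp: r(1) keys_add_nat)
        moreover have "lookup r x = 0" using r(2) by (auto simp: in_keys_iff)
        ultimately show "t \<in> T1 s" using xy(2) by (simp add: T1_def edge_pow_on_def r(1) lookup_add lookup_ray)
      qed
      moreover have "stanley_set W 2 ((+) (ray x s + ray y s) ` edge_pow_on E1 (W - {x}) (k - s))"
      proof (rule stanley_set_shift)
        show "stanley_set (W - {x}) 2 (edge_pow_on E1 (W - {x}) (k - s))"
        proof (rule less.hyps)
          show "card (W - {x}) < card W" using W by (intro card_Diff1_less) auto
          show "\<nexists>c. graph_cycle E1 c"
            using less.prems(3) graph_cycle_mono [of E1 _ E] by (auto simp: E1_def)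
        qed (use less.prems that E1 in \<open>auto simp: E1_def\<close>)
        show "keys (ray x s + ray y s) \<subseteq> W"
          using keys_ray [of x s] keys_ray [of y s] W by (auto simp: keys_add_nat)
      qed auto
      ultimately show ?thesis by simp
    qed
    have T2: "stanley_set W 2 (T2 s)" if "s < k" for s
    proof -
      \<comment> \<open>The additional factor x encodes the strict inequality between the exponents
        of y and x. With y used up, the leaf x has no edge left and is a free direction.\<close>
      define b where "b = ray x (Suc s) + ray y s"
      have b: "b = ray x s + ray y s + mvar x" by (simp add: b_def ray_Suc add_ac)
      have keys_b: "keys b \<subseteq> W"
        using keys_ray [of x "Suc s"] keys_ray [of y s] W by (auto simp: b_def keys_add_nat)
      define L where "L = msum (cone 0 {x}) (edge_pow_on E2 (W - {x, y}) (k - s))"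
      have "T2 s = (+) b ` L"
      proof (intro set_eqI iffI)
        fix t assume t: "t \<in> T2 s"
        then obtain r where r: "t = ray x s + ray y s + r"
          using split [of s t] by (auto simp: T2_def)
        have rxy: "0 < lookup r x" "lookup r y = 0"
          using t xy(2) by (auto simp: r T2_def lookup_add lookup_ray)
        from t have "edge_pow E k t" "keys t \<subseteq> W" by (auto simp: T2_def edge_pow_on_def)
        then have "edge_pow E (k - s) r" using leaf_iff [of s "k - s" r] r that by simp
        then have "edge_pow E2 (k - s) r" unfolding E2_def using rxy(2) by (rule edge_pow_avoid)
        then have e: "edge_pow E2 (k - s) (restr (W - {x, y}) r)"
          using E2 by (rule edge_pow_cong_on) simp
        define q where "q = ray x (lookup r x - 1) + restr (W - {x, y}) r"
        have "r = mvar x + q"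
        proof (rule poly_mapping_eqI)
          fix v
          have "v \<in> W" if "lookup r v \<noteq> 0"
            using \<open>keys t \<subseteq> W\<close> that by (auto simp: r keys_add_nat in_keys_iff)
          with rxy xy(2) show "lookup r v = lookup (mvar x + q) v"
            by (cases "v = x"; cases "v = y") (auto simp: q_def lookup_add lookup_ray lookup_mvar)
        qed
        then have "t = b + q" using r b by (simp add: add_ac)
        moreover have "ray x (lookup r x - 1) \<in> cone 0 {x}"
          using keys_ray [of x "lookup r x - 1"] by (auto simp: cone_def)
        ultimately show "t \<in> (+) b ` L"
          using e keys_restr [of "W - {x, y}" r] unfolding q_def L_def msum_def edge_pow_on_def by blast
      next
        fix t assume "t \<in> (+) b ` L"
        then obtain z r where r: "t = b + (z + r)" "keys z \<subseteq> {x}" "keys r \<subseteq> W - {x, y}" "edge_pow E2 (k - s) r"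
          by (auto simp: L_def msum_def edge_pow_on_def cone_def)
        then have "edge_pow E (k - s) r" by (auto simp: E2_def intro: edge_pow_mono)
        then have "edge_pow E (k - s) (mvar x + z + r)"
          by (metis add.commute edge_pow_add_right)
        then have "edge_pow E k t"
          using leaf_iff [of s "k - s" "mvar x + z + r"] that by (simp add: r(1) b add_ac)
        moreover have "keys t \<subseteq> W" using r(2,3) keys_b W by (auto simp: r(1) keys_add_nat)
        moreover have "lookup r x = 0" "lookup r y = 0" "lookup z y = 0"
          using r(2,3) xy(2) by (auto simp: in_keys_iff)
        ultimately show "t \<in> T2 s"
          using xy(2) by (simp add: T2_def edge_pow_on_def r(1) b_def lookup_add lookup_ray)
      qed
      moreover have "stanley_set W 2 ((+) b ` L)"
      proof (rule stanley_set_shift [OF _ _ keys_b])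
        \<comment> \<open>Since x already gives one free direction, one more suffices, and any
          further vertex provides it. Without further vertices there are no edges left, and as k - s
          is positive the set is empty.\<close>
        have pow: "stanley_set (W - {x, y}) 1 (edge_pow_on E2 (W - {x, y}) (k - s))"
        proof (cases "W - {x, y} = {}")
          case True
          then have "e = {}" if "e \<in> E2" for e using E2 that by blast
          then have "E2 = {}" using less.prems(1) by (fastforce simp: E2_def)
          with that show ?thesis by (simp add: edge_pow_on_def)
        next
          case False
          then obtain v where "v \<in> W - {x, y}" by blast
          then show ?thesis using less.prems(1) by (intro stanley_set_1_edge_pow_on) (auto simp: E2_def)
        qed
        have "stanley_set {x} 1 (cone 0 {x})" by (rule stanley_set.cone) auto
        from stanley_set_msum [OF _ this pow] show "stanley_set ({x} \<union> (W - {x, y})) 2 L"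
          by (simp add: L_def numeral_2_eq_2)
      qed (use W in auto)
      ultimately show ?thesis by simp
    qed
    have T3: "stanley_set W 2 T3"
    proof -
      have keys: "keys (ray x k + ray y k) \<subseteq> W"
        using keys_ray [of x k] keys_ray [of y k] W by (auto simp: keys_add_nat)
      \<comment> \<open>The k-th power of xy already lies in the k-th power of the ideal, so all its
        multiples do.\<close>
      have "T3 = cone (ray x k + ray y k) W"
      proof (intro set_eqI iffI)
        fix t assume t: "t \<in> T3"
        then obtain r where "t = ray x k + ray y k + r"
          using split [of k t] by (auto simp: T3_def)
        with t show "t \<in> cone (ray x k + ray y k) W"
          by (auto simp: T3_def edge_pow_on_def keys_add_nat cone_def)
      next
        fix t assume "t \<in> cone (ray x k + ray y k) W"
        then obtain r where "t = ray x k + ray y k + r" "keys r \<subseteq> W" by (auto simp: cone_def)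
        with leaf_iff [of k 0 r] keys show "t \<in> T3"
          by (auto simp: T3_def edge_pow_on_def keys_add_nat lookup_add lookup_ray)
      qed
      moreover have "2 \<le> card W" using card_mono [of W "{x, y}"] xy(2) W by simp
      ultimately show ?thesis using stanley_set.cone [OF keys order_refl, of 2] by simp
    qed
    have "edge_pow_on E W k = (\<Union>s<k. T1 s) \<union> ((\<Union>s<k. T2 s) \<union> T3)"
      by (auto simp: T1_def T2_def T3_def not_less)
    moreover have "stanley_set W 2 (\<Union>s<k. T1 s)" "stanley_set W 2 (\<Union>s<k. T2 s)"
      using T1 T2 by (auto intro!: stanley_set_UN simp: T1_def T2_def)
    moreover have "(\<Union>s<k. T2 s) \<inter> T3 = {}" "(\<Union>s<k. T1 s) \<inter> ((\<Union>s<k. T2 s) \<union> T3) = {}"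
      by (auto simp: T1_def T2_def T3_def)
    ultimately show ?thesis using T3 by (simp add: stanley_set.union)
  qed
qed

section \<open>Vanishing of Koszul cohomology\<close>

text \<open>Unfolded, this is the alternating sum over positions i of g at the i-th entry times c at
  the list without that entry. Cochains live on all lists, repetitions included, so no ordering of
  the variables is chosen; recursion on the head makes prefixing a vertex a homotopy by
  definition.\<close>

primrec koszul_diff :: "('v \<Rightarrow> 'r::comm_ring_1) \<Rightarrow> ('v list \<Rightarrow> 'r) \<Rightarrow> 'v list \<Rightarrow> 'r" where
  "koszul_diff g c [] = 0"
| "koszul_diff g c (v # vs) = g v * c vs - koszul_diff g (\<lambda>l. c (v # l)) vs"

lemma koszul_diff_cong:
  assumes "\<And>m. Suc (length m) = length l \<Longrightarrow> set m \<subseteq> set l \<Longrightarrow> c m = c' m"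
    and "\<And>v. v \<in> set l \<Longrightarrow> g v = g' v"
  shows "koszul_diff g c l = koszul_diff g' c' l"
  using assms
proof (induction l arbitrary: c c')
  case (Cons v l)
  have "koszul_diff g (\<lambda>m. c (v # m)) l = koszul_diff g' (\<lambda>m. c' (v # m)) l"
  proof (rule Cons.IH)
    fix m assume "Suc (length m) = length l" "set m \<subseteq> set l"
    then show "c (v # m) = c' (v # m)" by (intro Cons.prems(1)) auto
  qed (use Cons.prems(2) in auto)
  moreover have "c l = c' l" by (rule Cons.prems(1)) auto
  ultimately show ?case using Cons.prems(2) by simp
qed simp

lemma koszul_diff_zero [simp]: "koszul_diff g (\<lambda>_. 0) l = 0"
  by (induction l) auto

lemma koszul_diff_add: "koszul_diff g (\<lambda>l. c l + c' l) l = koszul_diff g c l + koszul_diff g c' l"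
  by (induction l arbitrary: c c') (auto simp: algebra_simps)

lemma koszul_diff_uminus: "koszul_diff g (\<lambda>l. - c l) l = - koszul_diff g c l"
  by (induction l arbitrary: c) (auto simp: algebra_simps)

lemma koszul_diff_diff: "koszul_diff g (\<lambda>l. c l - c' l) l = koszul_diff g c l - koszul_diff g c' l"
  using koszul_diff_add [of g c "\<lambda>l. - c' l" l] by (simp add: koszul_diff_uminus)

lemma koszul_diff_mult: "koszul_diff g (\<lambda>l. a * c l) l = a * koszul_diff g c l"
  by (induction l arbitrary: c) (auto simp: algebra_simps)

lemma koszul_diff_sum_coeff: "koszul_diff (\<lambda>v. \<Sum>i\<in>I. g i v) c l = (\<Sum>i\<in>I. koszul_diff (g i) c l)"
  by (induction l arbitrary: c) (auto simp: sum_distrib_right sum_subtractf)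

lemma koszul_diff_anticommute: "koszul_diff g (koszul_diff h c) l = - koszul_diff h (koszul_diff g c) l"
proof (induction l arbitrary: c)
  case (Cons v l)
  show ?case by (simp add: koszul_diff_diff koszul_diff_mult Cons.IH)
qed simp

lemma koszul_diff_square [simp]: "koszul_diff g (koszul_diff g c) l = 0"
proof (induction l arbitrary: c)
  case (Cons v l)
  show ?case by (simp add: koszul_diff_diff koszul_diff_mult Cons.IH)
qed simp

lemma koszul_diff_vanish:
  assumes "\<And>m. set m \<subseteq> set l \<Longrightarrow> Suc (length m) = length l \<Longrightarrow> c m = 0"
  shows "koszul_diff g c l = 0"
  using koszul_diff_cong [of l c "\<lambda>_. 0" g g] assms by simp

lemma koszul_diff_vanish_coeff:
  assumes "\<And>v. v \<in> set l \<Longrightarrow> g v = 0"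
  shows "koszul_diff g c l = 0"
proof -
  have "koszul_diff g c l = koszul_diff (\<lambda>v. 0 * g v) c l" using assms by (intro koszul_diff_cong) auto
  also have "\<dots> = 0" by (induction l arbitrary: c) auto
  finally show ?thesis .
qed

interpretation ring_module: module "(*) :: 'r::comm_ring_1 \<Rightarrow> 'r \<Rightarrow> 'r"
  by unfold_locales (auto simp: algebra_simps)

(* As a rewrite rule it is the reverse of mult.assoc. *)
declare ring_module.scale_scale [simp del]

lemma koszul_diff_mem:
  assumes "ring_module.subspace M" "\<And>l. c l \<in> M"
  shows "koszul_diff g c l \<in> M"
  using assms(2)
  by (induction l arbitrary: c)
    (auto intro!: ring_module.subspace_0 [OF assms(1)] ring_module.subspace_diff [OF assms(1)]
      ring_module.subspace_scale [OF assms(1)])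

lemma ideal_gen_range:
  fixes g :: "'v::finite \<Rightarrow> 'r::comm_ring_1"
  assumes "f \<in> ideal_gen (range g)"
  shows "\<exists>\<alpha>. f = (\<Sum>v\<in>UNIV. \<alpha> v * g v)"
  using assms unfolding ideal_gen_def
proof (induction rule: ring_module.span_induct_alt)
  case base
  show ?case by (rule exI [of _ "\<lambda>_. 0"]) simp
next
  case (step c x y)
  then obtain u \<alpha> where "x = g u" "y = (\<Sum>v\<in>UNIV. \<alpha> v * g v)" by blast
  then have "c * x + y = (\<Sum>v\<in>UNIV. ((if v = u then c else 0) + \<alpha> v) * g v)"
    by (simp add: distrib_right sum.distrib if_distrib [of "\<lambda>z. z * _"] cong: if_cong)
  then show ?case by (rule exI [of _ "\<lambda>v. (if v = u then c else 0) + \<alpha> v"])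
qed

lemma list_multiples_subset:
  assumes "ring_module.subspace M"
  shows "list_multiples (*) fs M \<subseteq> M"
  unfolding list_multiples_def
  using assms by (intro ring_module.span_minimal) (auto intro: ring_module.subspace_scale)

lemma list_multiples_snoc:
  assumes "ring_module.subspace M" "z \<in> list_multiples (*) (fs @ [f]) M"
  shows "\<exists>n\<in>list_multiples (*) fs M. \<exists>m\<in>M. z = n + f * m"
  using assms(2) unfolding list_multiples_def [of _ "fs @ [f]"]
proof (induction rule: ring_module.span_induct_alt)
  case base
  show ?case
    using ring_module.subspace_0 [OF assms(1)]
    by (intro bexI [of _ 0]) (auto simp: list_multiples_def ring_module.span_zero)
next
  case (step c x y)
  then obtain n m where nm: "n \<in> list_multiples (*) fs M" "m \<in> M" "y = n + f * m" by blast
  from step(1) obtain h w where h: "h \<in> set (fs @ [f])" "w \<in> M" "x = h * w" by blast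
  then consider "h \<in> set fs" | "h = f" by auto
  then show ?case
  proof cases
    case 1
    have "c * x + n \<in> list_multiples (*) fs M"
      using nm(1) 1 h(2,3) unfolding list_multiples_def
      by (intro ring_module.span_add ring_module.span_scale) (auto intro: ring_module.span_base)
    moreover have "c * x + y = (c * x + n) + f * m" using nm(3) by simp
    ultimately show ?thesis using nm(2) by (intro bexI [of _ "c * x + n"] bexI [of _ m])
  next
    case 2
    have "c * w + m \<in> M"
      using h(2) nm(2) assms(1)
      by (intro ring_module.subspace_add ring_module.subspace_scale)
    moreover have "c * x + y = n + f * (c * w + m)"
      unfolding nm(3) h(3) 2 by (simp add: algebra_simps)
    ultimately show ?thesis using nm(1) by (intro bexI [of _ n] bexI [of _ "c * w + m"])
  qed
qed

lemma list_multiples_snocI: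
  assumes "n \<in> list_multiples (*) fs M" "m \<in> M"
  shows "n + f * m \<in> list_multiples (*) (fs @ [f]) M"
proof -
  have "n \<in> list_multiples (*) (fs @ [f]) M"
    using assms(1) unfolding list_multiples_def by (rule rev_subsetD) (intro ring_module.span_mono, auto)
  moreover have "f * m \<in> list_multiples (*) (fs @ [f]) M"
    using assms(2) unfolding list_multiples_def by (intro ring_module.span_base) auto
  ultimately show ?thesis unfolding list_multiples_def by (rule ring_module.span_add)
qed

text \<open>
  Functions on lists of length \<open>j\<close> with values in \<open>M\<close> are the cochains of degree \<open>j\<close> of a (non-alternating)
  Koszul complex on the elements \<open>g v\<close>, and \<open>koszul_diff g\<close> is its differential. Prefixing \<open>v\<close> is a homotopy
  from multiplication by \<open>g v\<close> to \<open>0\<close>. Hence \<open>f c\<close> is a coboundary \<open>koszul_diff g m'\<close> for each \<open>f\<close> in the ideal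
  generated by the \<open>g v\<close>; then \<open>m'\<close> is a cocycle modulo \<open>f M\<close> and the induction proceeds to \<open>M / f M\<close>.
\<close>

lemma koszul_vanishing:
  fixes g :: "'v::finite \<Rightarrow> 'r::comm_ring_1"
  assumes M: "ring_module.subspace M" and fs: "set fs \<subseteq> ideal_gen (range g)"
    and reg: "regular_sequence (*) M fs"
    and "i + j < length fs"
    and "\<And>l. c l \<in> M" "\<And>l. length l = Suc j \<Longrightarrow> koszul_diff g c l \<in> list_multiples (*) (take i fs) M"
  shows "\<exists>b. (\<forall>l. b l \<in> M) \<and> (\<forall>l. length l = j \<longrightarrow> c l - koszul_diff g b l \<in> list_multiples (*) (take i fs) M)"
  using assms(4-)
proof (induction j arbitrary: i c)
  case (0 i c)
  define N where "N = list_multiples (*) (take i fs) M"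
  have N: "ring_module.subspace N" by (simp add: N_def list_multiples_def)
  obtain \<alpha> where \<alpha>: "fs ! i = (\<Sum>v\<in>UNIV. \<alpha> v * g v)"
    using ideal_gen_range [of "fs ! i" g] fs 0(1) nth_mem [of i fs] by (metis add_0_right subsetD)
  have "g v * c [] \<in> N" for v using 0(3) [of "[v]"] by (simp add: N_def)
  then have "fs ! i * c [] \<in> N"
    unfolding \<alpha> sum_distrib_right mult.assoc
    by (intro ring_module.subspace_sum [OF N] ring_module.subspace_scale [OF N, of "g _ * c []"])
  with reg 0(1,2) have "c [] \<in> N" by (simp add: regular_sequence_def N_def)
  then show ?case
    using ring_module.subspace_0 [OF M] by (intro exI [of _ "\<lambda>_. 0"]) (simp add: N_def)
next
  case (Suc j i c)
  define N where "N = list_multiples (*) (take i fs) M"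
  define f where "f = fs ! i"
  have N: "ring_module.subspace N" by (simp add: N_def list_multiples_def)
  have NM: "N \<subseteq> M" unfolding N_def by (rule list_multiples_subset [OF M])
  have take: "take (Suc i) fs = take i fs @ [f]"
    using Suc.prems(1) by (simp add: f_def take_Suc_conv_app_nth)
  have nzd: "x \<in> N" if "f * x \<in> N" "x \<in> M" for x
    using reg that Suc.prems(1) by (simp add: regular_sequence_def N_def f_def)
  obtain \<alpha> where \<alpha>: "f = (\<Sum>v\<in>UNIV. \<alpha> v * g v)"
    using ideal_gen_range [of f g] fs Suc.prems(1) nth_mem [of i fs]
    by (metis add_lessD1 f_def subsetD)
  define h where "h l = (\<Sum>v\<in>UNIV. \<alpha> v * c (v # l))" for l
  have koszul_diff_h: "koszul_diff g h l = (\<Sum>v\<in>UNIV. \<alpha> v * koszul_diff g (\<lambda>m. c (v # m)) l)" for l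
  proof -
    have "koszul_diff g (\<lambda>l. \<Sum>v\<in>V. \<alpha> v * c (v # l)) l = (\<Sum>v\<in>V. \<alpha> v * koszul_diff g (\<lambda>m. c (v # m)) l)"
      if "finite V" for V
      using that by (induction V rule: finite_induct) (auto simp: koszul_diff_add koszul_diff_mult)
    then show ?thesis by (simp add: h_def [abs_def])
  qed
  \<comment> \<open>Cartan's formula: contracting the coboundary of c with the coefficients \<alpha>
    of f leaves f c minus the coboundary of the contraction h.\<close>
  have homotopy: "f * c l - koszul_diff g h l \<in> N" if "length l = Suc j" for l
  proof -
    have "f * c l - koszul_diff g h l = (\<Sum>v\<in>UNIV. \<alpha> v * koszul_diff g c (v # l))"
      by (simp add: \<alpha> koszul_diff_h sum_distrib_right right_diff_distrib sum_subtractf mult.assoc)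
    also have "\<dots> \<in> N"
      using Suc.prems(3) [of "_ # l"] that unfolding N_def [symmetric]
      by (intro ring_module.subspace_sum [OF N] ring_module.subspace_scale [OF N])
        (simp del: koszul_diff.simps)
    finally show ?thesis .
  qed
  have "h l \<in> M" for l
    unfolding h_def using M Suc.prems(2)
    by (intro ring_module.subspace_sum ring_module.subspace_scale) auto
  moreover have "koszul_diff g h l \<in> list_multiples (*) (take (Suc i) fs) M" if "length l = Suc j" for l
  proof -
    have "- (f * c l - koszul_diff g h l) \<in> N" using homotopy [OF that] N by (metis ring_module.subspace_neg)
    from list_multiples_snocI [OF this [unfolded N_def] Suc.prems(2) [of l], of f] show ?thesis
      by (simp add: take)
  qed
  ultimately obtain b where b: "\<And>l. b l \<in> M"
      "\<And>l. length l = j \<Longrightarrow> h l - koszul_diff g b l \<in> list_multiples (*) (take (Suc i) fs) M"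
    using Suc.IH [of "Suc i" h] Suc.prems(1) by auto
  have "\<exists>n\<in>N. \<exists>m\<in>M. length l = j \<longrightarrow> h l - koszul_diff g b l = n + f * m" for l
  proof (cases "length l = j")
    case True
    from list_multiples_snoc [OF M b(2) [OF True, unfolded take]] show ?thesis by (auto simp: N_def)
  next
    case False
    with ring_module.subspace_0 [OF N] ring_module.subspace_0 [OF M] show ?thesis by blast
  qed
  then obtain n m where nm: "\<And>l. n l \<in> N" "\<And>l. m l \<in> M"
      "\<And>l. length l = j \<Longrightarrow> h l - koszul_diff g b l = n l + f * m l" by metis
  \<comment> \<open>The coboundary of h is that of n + f m, because the square of the differential
    kills the term with b. So f times the difference lies in N, and f can be cancelled.\<close>
  have "c l - koszul_diff g m l \<in> N" if l: "length l = Suc j" for l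
  proof (rule nzd)
    have "koszul_diff g h l = koszul_diff g (\<lambda>l. koszul_diff g b l + (n l + f * m l)) l"
    proof (rule koszul_diff_cong)
      fix l' :: "'v list" assume "Suc (length l') = length l"
      with nm(3) [of l'] l show "h l' = koszul_diff g b l' + (n l' + f * m l')" by (simp add: algebra_simps)
    qed simp
    also have "\<dots> = koszul_diff g n l + f * koszul_diff g m l" by (simp add: koszul_diff_add koszul_diff_mult)
    finally have "f * (c l - koszul_diff g m l) = (f * c l - koszul_diff g h l) + koszul_diff g n l"
      by (simp add: algebra_simps)
    also have "\<dots> \<in> N"
      using homotopy [OF l] koszul_diff_mem [OF N nm(1)] by (intro ring_module.subspace_add [OF N])
    finally show "f * (c l - koszul_diff g m l) \<in> N" .
    show "c l - koszul_diff g m l \<in> M"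
      using Suc.prems(2) koszul_diff_mem [OF M nm(2)] by (intro ring_module.subspace_diff [OF M])
  qed
  with nm(2) show ?case unfolding N_def by blast
qed

section \<open>Koszul classes and an upper bound for the depth\<close>

text \<open>Exterior multiplication by a cochain of degree one has the same formula as the
  differential. On lists as long as the list of factors, the value is the determinant of the matrix
  of the values of the factors at the entries, expanded along its first row; on other lists it is
  0.\<close>

primrec wedge :: "('v \<Rightarrow> 'r::comm_ring_1) list \<Rightarrow> 'v list \<Rightarrow> 'r" where
  "wedge [] = (\<lambda>l. of_bool (l = []))"
| "wedge (\<theta> # \<theta>s) = koszul_diff \<theta> (wedge \<theta>s)"

lemma koszul_diff_vanish_entry:
  assumes "\<theta> v = 0" "v \<in> set l" "\<And>m. v \<in> set m \<Longrightarrow> c m = 0"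
  shows "koszul_diff \<theta> c l = 0"
  using assms(2,3)
proof (induction l arbitrary: c)
  case (Cons u l)
  have "\<theta> u * c l = 0" using assms(1) Cons.prems by (cases "v = u") auto
  moreover have "koszul_diff \<theta> (\<lambda>m. c (u # m)) l = 0"
  proof (cases "v \<in> set l")
    case True
    with Cons.prems show ?thesis by (intro Cons.IH) auto
  next
    case False
    with Cons.prems show ?thesis by (intro koszul_diff_vanish) auto
  qed
  ultimately show ?case by simp
qed simp

text \<open>A zero column of the determinant; the next lemma is the case of a zero row.\<close>

lemma wedge_vanish_entry:
  assumes "\<And>\<theta>. \<theta> \<in> set \<theta>s \<Longrightarrow> \<theta> v = 0" "v \<in> set l"
  shows "wedge \<theta>s l = 0"
  using assms by (induction \<theta>s arbitrary: l) (auto intro!: koszul_diff_vanish_entry)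

lemma wedge_vanish_coeff:
  assumes "\<theta> \<in> set \<theta>s" "\<And>v. v \<in> set l \<Longrightarrow> \<theta> v = 0"
  shows "wedge \<theta>s l = 0"
  using assms
proof (induction \<theta>s arbitrary: l)
  case (Cons \<theta>' \<theta>s)
  show ?case
  proof (cases "\<theta> = \<theta>'")
    case True
    with Cons.prems show ?thesis by (simp add: koszul_diff_vanish_coeff)
  next
    case False
    with Cons show ?thesis by (auto intro!: koszul_diff_vanish)
  qed
qed simp

lemma koszul_diff_wedge_self:
  assumes "\<theta> \<in> set \<theta>s"
  shows "koszul_diff \<theta> (wedge \<theta>s) l = 0"
  using assms
proof (induction \<theta>s arbitrary: l)
  case (Cons \<theta>' \<theta>s)
  show ?case
  proof (cases "\<theta> = \<theta>'")
    case False
    with Cons.prems have "\<theta> \<in> set \<theta>s" by simp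
    then have "koszul_diff \<theta> (wedge \<theta>s) = (\<lambda>_. 0)" by (intro ext Cons.IH)
    then show ?thesis by (simp add: koszul_diff_anticommute [of \<theta>])
  qed simp
qed simp

text \<open>On the entries of l the constant 1 is the sum of the \<open>\<theta> C\<close>, so the
  differential multiplies by factors that already occur in the wedge product, and each of these
  products vanishes.\<close>

lemma koszul_diff_wedge_sum_coeff:
  assumes "distinct Cs" "\<And>v. v \<in> set l \<Longrightarrow> (\<Sum>C\<in>set Cs. \<theta> C v) = 1"
  shows "koszul_diff (\<lambda>_. 1) (wedge (map \<theta> Cs)) l = 0"
proof -
  have "koszul_diff (\<lambda>_. 1) (wedge (map \<theta> Cs)) l = koszul_diff (\<lambda>v. \<Sum>C\<in>set Cs. \<theta> C v) (wedge (map \<theta> Cs)) l"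
    using assms(2) by (intro koszul_diff_cong) auto
  then show ?thesis by (simp add: koszul_diff_sum_coeff koszul_diff_wedge_self)
qed

lemma wedge_diagonal:
  assumes "distinct Cs" "\<And>C D. C \<in> set Cs \<Longrightarrow> D \<in> set Cs \<Longrightarrow> \<theta> C (\<alpha> D) = of_bool (C = D)"
  shows "wedge (map \<theta> Cs) (map \<alpha> Cs) = 1"
  using assms
proof (induction Cs)
  case (Cons C Cs)
  have "wedge (map \<theta> Cs) (\<alpha> C # m) = 0" for m
    using Cons.prems by (intro wedge_vanish_entry [of _ "\<alpha> C"]) auto
  then have "koszul_diff (\<theta> C) (\<lambda>m. wedge (map \<theta> Cs) (\<alpha> C # m)) (map \<alpha> Cs) = 0"
    by (intro koszul_diff_vanish) auto
  with Cons show ?case by simp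
qed simp

text \<open>Pairing of a cochain with the fundamental cycle of the boundary of a cross-polytope
  whose pairs of opposite vertices are \<open>\<alpha> C\<close> and \<open>\<beta> C\<close>: all
  choices occur, with a sign for each \<beta>.\<close>

primrec alt_sum :: "('c \<Rightarrow> 'v) \<Rightarrow> ('c \<Rightarrow> 'v) \<Rightarrow> 'c list \<Rightarrow> ('v list \<Rightarrow> 'r::comm_ring_1) \<Rightarrow> 'r" where
  "alt_sum \<alpha> \<beta> [] F = F []"
| "alt_sum \<alpha> \<beta> (C # Cs) F =
     alt_sum \<alpha> \<beta> Cs (\<lambda>l. F (\<alpha> C # l)) - alt_sum \<alpha> \<beta> Cs (\<lambda>l. F (\<beta> C # l))"

lemma alt_sum_diff: "alt_sum \<alpha> \<beta> Cs (\<lambda>l. F l - G l) = alt_sum \<alpha> \<beta> Cs F - alt_sum \<alpha> \<beta> Cs G"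
  by (induction Cs arbitrary: F G) auto

lemma alt_sum_zero: "alt_sum \<alpha> \<beta> Cs (\<lambda>_. 0) = 0"
  by (induction Cs) auto

text \<open>The cycle has no boundary: a list with the entry of C deleted arises from both choices
  for C, with opposite signs.\<close>

lemma alt_sum_koszul_diff: "alt_sum \<alpha> \<beta> Cs (koszul_diff (\<lambda>_. 1) F) = 0"
  by (induction Cs arbitrary: F) (auto simp: alt_sum_diff)

lemma alt_sum_cong:
  assumes "distinct Cs"
    and "\<And>sel. (\<And>C. C \<in> set Cs \<Longrightarrow> sel C = \<alpha> C \<or> sel C = \<beta> C) \<Longrightarrow> F (map sel Cs) = G (map sel Cs)"
  shows "alt_sum \<alpha> \<beta> Cs F = alt_sum \<alpha> \<beta> Cs G"
  using assms
proof (induction Cs arbitrary: F G)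
  case (Cons C Cs)
  have "F (v # map sel Cs) = G (v # map sel Cs)"
    if "v = \<alpha> C \<or> v = \<beta> C" "\<And>C. C \<in> set Cs \<Longrightarrow> sel C = \<alpha> C \<or> sel C = \<beta> C" for v sel
  proof -
    have "map (sel(C := v)) (C # Cs) = v # map sel Cs" using Cons.prems(1) by auto
    moreover have "F (map (sel(C := v)) (C # Cs)) = G (map (sel(C := v)) (C # Cs))"
      using that by (intro Cons.prems(2)) auto
    ultimately show ?thesis by metis
  qed
  note eq = this
  have "alt_sum \<alpha> \<beta> Cs (\<lambda>l. F (v # l)) = alt_sum \<alpha> \<beta> Cs (\<lambda>l. G (v # l))"
    if v: "v = \<alpha> C \<or> v = \<beta> C" for v
  proof (rule Cons.IH)
    show "distinct Cs" using Cons.prems(1) by simp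
  qed (rule eq [OF v])
  then show ?case by simp
next
  case Nil
  from Nil(2) [of \<alpha>] show ?case by simp
qed

lemma alt_sum_single:
  assumes "distinct Cs"
    and "\<And>sel C. (\<And>C. C \<in> set Cs \<Longrightarrow> sel C = \<alpha> C \<or> sel C = \<beta> C) \<Longrightarrow> C \<in> set Cs \<Longrightarrow> sel C = \<beta> C
      \<Longrightarrow> F (map sel Cs) = 0"
  shows "alt_sum \<alpha> \<beta> Cs F = F (map \<alpha> Cs)"
  using assms
proof (induction Cs arbitrary: F)
  case (Cons C Cs)
  have upd: "map (sel(C := v)) (C # Cs) = v # map sel Cs" for sel v using Cons.prems(1) by auto
  have "alt_sum \<alpha> \<beta> Cs (\<lambda>l. F (\<alpha> C # l)) = F (\<alpha> C # map \<alpha> Cs)"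
  proof (rule Cons.IH)
    fix sel D assume sel: "\<And>C. C \<in> set Cs \<Longrightarrow> sel C = \<alpha> C \<or> sel C = \<beta> C" "D \<in> set Cs" "sel D = \<beta> D"
    with Cons.prems(1) have "D \<noteq> C" by auto
    have "F (map (sel(C := \<alpha> C)) (C # Cs)) = 0"
      by (rule Cons.prems(2) [of _ D]) (use sel \<open>D \<noteq> C\<close> in auto)
    then show "F (\<alpha> C # map sel Cs) = 0" unfolding upd .
  qed (use Cons.prems in auto)
  moreover have "alt_sum \<alpha> \<beta> Cs (\<lambda>l. F (\<beta> C # l)) = alt_sum \<alpha> \<beta> Cs (\<lambda>_. 0)"
  proof (rule alt_sum_cong)
    fix sel assume sel: "\<And>C. C \<in> set Cs \<Longrightarrow> sel C = \<alpha> C \<or> sel C = \<beta> C"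
    have "F (map (sel(C := \<beta> C)) (C # Cs)) = 0"
      by (rule Cons.prems(2) [of _ C]) (use sel in auto)
    then show "F (\<beta> C # map sel Cs) = 0" unfolding upd .
  qed (use Cons.prems in auto)
  ultimately show ?case by (simp add: alt_sum_zero)
qed simp

text \<open>By the cocycle condition, prefixing a fixed vertex u exhibits e as a coboundary on the
  lists at hand, so its signed sum is 0. In the signed sum of the wedge product only the choice of
  all \<alpha> survives, with value 1. The cone point u is arbitrary, so \<open>undefined\<close>
  serves.\<close>

lemma wedge_not_cohomologous_to_zero:
  fixes \<theta> :: "'c \<Rightarrow> 'v \<Rightarrow> 'r::comm_ring_1"
  assumes "distinct Cs"
    and \<alpha>: "\<And>C D. C \<in> set Cs \<Longrightarrow> D \<in> set Cs \<Longrightarrow> \<theta> C (\<alpha> D) = of_bool (C = D)"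
    and \<beta>: "\<And>C D. C \<in> set Cs \<Longrightarrow> D \<in> set Cs \<Longrightarrow> \<theta> C (\<beta> D) = 0"
    and e: "\<And>sel. (\<And>C. C \<in> set Cs \<Longrightarrow> sel C = \<alpha> C \<or> sel C = \<beta> C) \<Longrightarrow>
      e (map sel Cs) = wedge (map \<theta> Cs) (map sel Cs)"
    and cocycle: "\<And>l. length l = Suc (length Cs) \<Longrightarrow> koszul_diff (\<lambda>_. 1) e l = 0"
  shows False
proof -
  define u :: 'v where "u = undefined"
  have cone: "e (map sel Cs) = koszul_diff (\<lambda>_. 1) (\<lambda>m. e (u # m)) (map sel Cs)" for sel
    using cocycle [of "u # map sel Cs"] by simp
  have "alt_sum \<alpha> \<beta> Cs e = alt_sum \<alpha> \<beta> Cs (koszul_diff (\<lambda>_. 1) (\<lambda>m. e (u # m)))"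
    by (rule alt_sum_cong) (use assms(1) cone in auto)
  also have "\<dots> = 0" by (rule alt_sum_koszul_diff)
  finally have "alt_sum \<alpha> \<beta> Cs e = 0" .
  moreover have "alt_sum \<alpha> \<beta> Cs e = alt_sum \<alpha> \<beta> Cs (wedge (map \<theta> Cs))"
    by (rule alt_sum_cong) (use assms(1) e in auto)
  moreover have "alt_sum \<alpha> \<beta> Cs (wedge (map \<theta> Cs)) = wedge (map \<theta> Cs) (map \<alpha> Cs)"
  proof (rule alt_sum_single [OF assms(1)])
    fix sel C assume "C \<in> set Cs" "sel C = \<beta> C"
    then show "wedge (map \<theta> Cs) (map sel Cs) = 0"
      using \<beta> by (intro wedge_vanish_entry [of _ "\<beta> C"]) (auto simp: image_iff intro: bexI [of _ C])
  qed
  moreover have "wedge (map \<theta> Cs) (map \<alpha> Cs) = 1"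
    using assms(1) \<alpha> by (rule wedge_diagonal)
  ultimately show False by simp
qed

section \<open>Coefficients in a single multidegree\<close>

lemma lookup_single_mult:
  fixes s t :: "'v \<Rightarrow>\<^sub>0 nat" and p :: "('v \<Rightarrow>\<^sub>0 nat) \<Rightarrow>\<^sub>0 'k::comm_ring_1"
  shows "lookup (single s 1 * p) (s + t) = lookup p t"
proof -
  have "lookup (single s 1 * p) (s + t) = (\<Sum>l. lookup (single s 1) l * (\<Sum>q. lookup p q when s + t = l + q))"
    by (simp add: lookup_mult)
  also have "\<dots> = (\<Sum>l. ((\<Sum>q. lookup p q when s + t = l + q)) when s = l)"
    by (rule Sum_any.cong) (simp add: lookup_single when_def)
  also have "\<dots> = lookup p t"
    by (simp add: Sum_any_when_equal')
  finally show ?thesis .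
qed

lemma keys_single_mult:
  fixes s t :: "'v \<Rightarrow>\<^sub>0 nat" and p :: "('v \<Rightarrow>\<^sub>0 nat) \<Rightarrow>\<^sub>0 'k::comm_ring_1"
  assumes "t \<in> keys (single s 1 * p)"
  shows "\<exists>r\<in>keys p. t = s + r"
proof -
  have "keys (single s 1 * p) \<subseteq> {a + b | a b. a \<in> keys (single s (1::'k)) \<and> b \<in> keys p}"
    by (rule keys_mult)
  with assms show ?thesis by auto
qed

definition mon :: "'v list \<Rightarrow> 'v \<Rightarrow>\<^sub>0 nat" where
  "mon l = (\<Sum>v\<leftarrow>l. mvar v)"

lemma mon_simps [simp]: "mon [] = 0" "mon (v # l) = mvar v + mon l"
  by (simp_all add: mon_def)

lemma lookup_mon: "lookup (mon l) v = count_list l v"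
  by (induction l) (auto simp: lookup_add lookup_mvar)

lemma var_eq: "var v = single (mvar v) 1"
  by (simp add: var_def mvar_def)

text \<open>Weighting the value at l by the monomial of l absorbs the variables in the differential,
  so that in one multidegree the Koszul complex on the variables becomes a complex of scalars. Here
  scalars are inserted; the following lemma extracts them.\<close>

lemma koszul_diff_var_single:
  fixes D :: "'v list \<Rightarrow> 'k::field"
  shows "koszul_diff var (\<lambda>m. single (a + mon m) (D m)) l = single (a + mon l) (koszul_diff (\<lambda>_. 1) D l)"
proof (induction l arbitrary: a D)
  case (Cons v l)
  have "koszul_diff var (\<lambda>m. single (a + mon (v # m)) (D (v # m))) l
      = single (a + mon (v # l)) (koszul_diff (\<lambda>_. 1) (\<lambda>m. D (v # m)) l)"
    using Cons.IH [of "a + mvar v" "\<lambda>m. D (v # m)"] by (simp add: add.assoc)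
  moreover have "var v * single (a + mon l) (D l) = single (a + mon (v # l)) (D l)"
    by (simp add: var_eq mult_single add_ac)
  ultimately show ?case by (simp add: single_diff)
qed simp

lemma lookup_koszul_diff_var:
  fixes X :: "('v, 'k::field) mpol"
  shows "lookup (X * koszul_diff var f l) (a + mon l) = koszul_diff (\<lambda>_. 1) (\<lambda>m. lookup (X * f m) (a + mon m)) l"
proof (induction l arbitrary: a f)
  case (Cons v l)
  have "lookup (X * koszul_diff var (\<lambda>m. f (v # m)) l) (a + mon (v # l))
      = koszul_diff (\<lambda>_. 1) (\<lambda>m. lookup (X * f (v # m)) (a + mon (v # m))) l"
    using Cons.IH [of "\<lambda>m. f (v # m)" "a + mvar v"] by (simp add: add.assoc)
  moreover have "lookup (X * (var v * f l)) (a + mon (v # l)) = lookup (X * f l) (a + mon l)"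
    using lookup_single_mult [of "mvar v" "X * f l" "a + mon l"]
    by (simp add: var_eq ac_simps)
  ultimately show ?case by (simp add: right_diff_distrib lookup_minus)
qed simp

text \<open>
  The cochain with values \<open>D l * x\<^sup>(a + mon l - \<tau>)\<close>, where \<open>D\<close> is a wedge product, has a coboundary with
  values in \<open>I\<close>. Taking the coefficient of a cochain value at \<open>l\<close> in the multidegree \<open>a + mon l - \<tau>\<close>
  commutes with the differentials; the multiplication by \<open>x\<^sup>\<tau>\<close> avoids negative exponents.
\<close>

lemma depth_le:
  fixes I :: "('v::finite, 'k::field) mpol set" and \<theta> :: "'c \<Rightarrow> 'v \<Rightarrow> 'k" and \<tau> :: "'v \<Rightarrow>\<^sub>0 nat"
  assumes I: "I = {p. \<forall>t\<in>keys p. P t}" "ring_module.subspace I"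
    and "distinct Cs"
    and \<alpha>: "\<And>C D. C \<in> set Cs \<Longrightarrow> D \<in> set Cs \<Longrightarrow> \<theta> C (\<alpha> D) = of_bool (C = D)"
    and \<beta>: "\<And>C D. C \<in> set Cs \<Longrightarrow> D \<in> set Cs \<Longrightarrow> \<theta> C (\<beta> D) = 0"
    and \<tau>: "\<And>l. wedge (map \<theta> Cs) l \<noteq> 0 \<Longrightarrow> \<exists>r. a + mon l = \<tau> + r"
    and inside: "\<And>l t. length l = Suc (length Cs) \<Longrightarrow> koszul_diff (\<lambda>_. 1) (wedge (map \<theta> Cs)) l \<noteq> 0 \<Longrightarrow>
      a + mon l = \<tau> + t \<Longrightarrow> P t"
    and outside: "\<And>sel t. (\<And>C. C \<in> set Cs \<Longrightarrow> sel C = \<alpha> C \<or> sel C = \<beta> C) \<Longrightarrow>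
      a + mon (map sel Cs) = \<tau> + t \<Longrightarrow> \<not> P t"
  shows "depth (*) maximal_ideal I \<le> enat (Suc (length Cs))"
  unfolding depth_def
proof (rule SUP_least)
  fix fs :: "('v, 'k) mpol list"
  assume "fs \<in> {fs. set fs \<subseteq> maximal_ideal \<and> regular_sequence (*) I fs}"
  then have fs: "set fs \<subseteq> ideal_gen (range var)" "regular_sequence (*) I fs"
    by (auto simp: maximal_ideal_def)
  define D where "D = wedge (map \<theta> Cs)"
  define X :: "('v, 'k) mpol" where "X = single \<tau> 1"
  \<comment> \<open>Exponents are natural numbers; the subtraction is exact wherever
    \<open>D l\<close> is not 0, by the hypothesis on \<tau>.\<close>
  define \<omega> :: "'v list \<Rightarrow> ('v, 'k) mpol" where "\<omega> l = single (a + mon l - \<tau>) (D l)" for l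
  have X\<omega>: "X * \<omega> l = single (a + mon l) (D l)" for l
  proof (cases "D l = 0")
    case False
    with \<tau> obtain r where "a + mon l = \<tau> + r" by (auto simp: D_def)
    then show ?thesis by (simp add: X_def \<omega>_def mult_single)
  qed (simp add: \<omega>_def)
  have X_diff: "X * koszul_diff var \<omega> l = single (a + mon l) (koszul_diff (\<lambda>_. 1) D l)" for l
    by (simp add: X\<omega> koszul_diff_var_single flip: koszul_diff_mult)
  have koszul_diff_I: "koszul_diff var \<omega> l \<in> I" if "length l = Suc (length Cs)" for l
    unfolding I(1)
  proof safe
    fix t assume "t \<in> keys (koszul_diff var \<omega> l)"
    then have "lookup (X * koszul_diff var \<omega> l) (\<tau> + t) \<noteq> 0"
      by (simp add: X_def lookup_single_mult in_keys_iff)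
    then have "a + mon l = \<tau> + t" "koszul_diff (\<lambda>_. 1) D l \<noteq> 0"
      by (auto simp: X_diff lookup_single when_def split: if_splits)
    with inside [OF that] show "P t" by (simp add: D_def)
  qed
  show "enat (length fs) \<le> enat (Suc (length Cs))"
  proof (rule ccontr)
    assume "\<not> ?thesis"
    then have len: "0 + Suc (length Cs) < length fs" by simp
    \<comment> \<open>Only on lists one longer than \<open>Cs\<close> is the coboundary of \<omega>
      known to lie in I. Elsewhere 0 is put, which the differential in this degree does not
      see.\<close>
    define c where "c l = (if length l = Suc (length Cs) then koszul_diff var \<omega> l else 0)" for l
    have nil: "list_multiples (*) (take 0 fs) I = {0}"
      by (simp add: list_multiples_def)
    have "\<exists>b. (\<forall>l. b l \<in> I) \<and> (\<forall>l. length l = Suc (length Cs) \<longrightarrow>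
        c l - koszul_diff var b l \<in> list_multiples (*) (take 0 fs) I)"
    proof (rule koszul_vanishing [OF I(2) fs len])
      show "c l \<in> I" for l using koszul_diff_I ring_module.subspace_0 [OF I(2)] by (simp add: c_def)
      fix l :: "'v list" assume l: "length l = Suc (Suc (length Cs))"
      have "koszul_diff var c l = koszul_diff var (koszul_diff var \<omega>) l" by (rule koszul_diff_cong) (auto simp: c_def l)
      then show "koszul_diff var c l \<in> list_multiples (*) (take 0 fs) I" unfolding nil by simp
    qed
    then obtain b where b: "\<And>l. b l \<in> I" "\<And>l. length l = Suc (length Cs) \<Longrightarrow> koszul_diff var \<omega> l = koszul_diff var b l"
      unfolding nil c_def by auto
    \<comment> \<open>In this degree \<omega> - b is a cocycle over the whole ring. Since b has
      values in I, its coefficients vanish on the selected lists by \<open>outside\<close>, and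
      there e is the wedge product itself.\<close>
    define e where "e l = lookup (X * (\<omega> l - b l)) (a + mon l)" for l
    show False
    proof (rule wedge_not_cohomologous_to_zero [of Cs \<theta> \<alpha> \<beta> e, OF assms(3) \<alpha> \<beta>])
      show "koszul_diff (\<lambda>_. 1) e l = 0" if "length l = Suc (length Cs)" for l
        unfolding e_def lookup_koszul_diff_var [symmetric] koszul_diff_diff using b(2) [OF that] by simp
      fix sel assume sel: "\<And>C. C \<in> set Cs \<Longrightarrow> sel C = \<alpha> C \<or> sel C = \<beta> C"
      define l where "l = map sel Cs"
      have "lookup (X * b l) (a + mon l) = 0"
      proof (rule ccontr)
        assume "lookup (X * b l) (a + mon l) \<noteq> 0"
        then have "a + mon l \<in> keys (X * b l)" by (simp add: in_keys_iff)
        then obtain t where "t \<in> keys (b l)" "a + mon l = \<tau> + t"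
          unfolding X_def by (blast dest: keys_single_mult)
        with outside [OF sel] b(1) [of l] show False by (auto simp: l_def I(1))
      qed
      then show "e (map sel Cs) = wedge (map \<theta> Cs) (map sel Cs)"
        by (simp add: e_def right_diff_distrib lookup_minus X\<omega> flip: l_def D_def)
    qed
  qed
qed

section \<open>Connected graphs\<close>

text \<open>Connectedness without walks: this form feeds directly the induction that enlarges a
  vertex set along an edge leaving it.\<close>

definition cut_connected :: "'v set \<Rightarrow> 'v set set \<Rightarrow> bool" where
  "cut_connected C E \<longleftrightarrow> (\<forall>U\<subseteq>C. U \<noteq> {} \<longrightarrow> U \<noteq> C \<longrightarrow> (\<exists>y\<in>U. \<exists>z\<in>C - U. {y, z} \<in> E))"

lemma cut_connectedE:
  assumes "cut_connected C E" "U \<subseteq> C" "U \<noteq> {}" "U \<noteq> C"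
  obtains y z where "y \<in> U" "z \<in> C" "z \<notin> U" "{y, z} \<in> E"
  using assms unfolding cut_connected_def by blast

text \<open>U grows along an edge yz leaving it. A neighbour x of y is kept inside U so that each
  step can spend the edge xy, and m counts these steps: one edge for each new vertex.\<close>

lemma cut_connected_induct:
  fixes C :: "'v::finite set"
  assumes conn: "cut_connected C E"
    and step: "\<And>U m x y z. U \<subseteq> C \<Longrightarrow> x \<in> U \<Longrightarrow> y \<in> U \<Longrightarrow> {x, y} \<in> E \<Longrightarrow> z \<in> C \<Longrightarrow> z \<notin> U \<Longrightarrow>
      {y, z} \<in> E \<Longrightarrow> P U m \<Longrightarrow> P (insert z U) (Suc m)"
    and "U \<subseteq> C" "U \<noteq> {}" "\<forall>y\<in>U. \<exists>x\<in>U. {x, y} \<in> E" "P U m"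
  shows "P C (m + card (C - U))"
  using assms(3-)
proof (induction "card (C - U)" arbitrary: U m rule: less_induct)
  case less
  show ?case
  proof (cases "U = C")
    case False
    with less.prems obtain y z where yz: "y \<in> U" "z \<in> C" "z \<notin> U" "{y, z} \<in> E"
      using cut_connectedE [OF conn] by metis
    with less.prems(3) obtain x where x: "x \<in> U" "{x, y} \<in> E" by blast
    have card: "card (C - U) = Suc (card (C - insert z U))"
    proof -
      have "C - U = insert z (C - insert z U)" using yz by blast
      then show ?thesis by (simp add: card_insert_if)
    qed
    have "P C (Suc m + card (C - insert z U))"
    proof (rule less.hyps)
      show "\<forall>y\<in>insert z U. \<exists>x\<in>insert z U. {x, y} \<in> E"
        using less.prems(3) yz by blast
      show "P (insert z U) (Suc m)"
        by (rule step [OF less.prems(1) x(1) yz(1) x(2) yz(2,3,4) less.prems(4)])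
    qed (use card yz less.prems in auto)
    then show ?thesis by (simp add: card)
  qed (use less.prems in simp)
qed

section \<open>Completable monomials of a single component\<close>

lemma sum_lookup_mvar: "finite A \<Longrightarrow> sum (lookup (mvar x)) A = of_bool (x \<in> A)"
  by (simp add: lookup_mvar of_bool_def)

lemma keys_mvar: "keys (mvar x) = {x}"
  by (simp add: mvar_def)

text \<open>Growth starts from one edge with a = 0. To admit z adjacent to y, the edge xy is
  multiplied in; a pair containing z is then completed by the edge yz, with x in the place of z.
  Both sides are covers of weight exactly m, so even a times one more vertex stays outside the power
  m + 1.\<close>

lemma bipartite_certificate:
  fixes C :: "'v::finite set"
  assumes E: "\<forall>e\<in>E. e \<subseteq> C" and "cut_connected C E" "E \<noteq> {}"
    and AB: "A \<union> B = C" "A \<inter> B = {}" "\<forall>e\<in>E. \<exists>a\<in>A. \<exists>b\<in>B. e = {a, b}"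
    and "card C - 2 \<le> m"
  shows "\<exists>a. keys a \<subseteq> C \<and> edge_pow E m a \<and> sum (lookup a) A = m \<and> sum (lookup a) B = m \<and>
    (\<forall>u\<in>A. \<forall>w\<in>B. edge_pow E (Suc m) (a + mvar u + mvar w))"
proof -
  define P where "P U m \<longleftrightarrow> (\<exists>a. keys a \<subseteq> C \<and> edge_pow E m a \<and> sum (lookup a) A = m \<and> sum (lookup a) B = m \<and>
    (\<forall>u\<in>A \<inter> U. \<forall>w\<in>B \<inter> U. edge_pow E (Suc m) (a + mvar u + mvar w)))" for U m
  have cross: "x \<in> A \<and> y \<in> B \<or> x \<in> B \<and> y \<in> A" if "{x, y} \<in> E" for x y
    using AB(3) that by (fastforce simp: doubleton_eq_iff)
  have grow: "\<exists>b. keys b \<subseteq> C \<and> edge_pow E (Suc m) b \<and> sum (lookup b) A = Suc m \<and> sum (lookup b) B = Suc m \<and>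
      b = a + mvar x + mvar y"
    if a: "keys a \<subseteq> C" "edge_pow E m a" "sum (lookup a) A = m" "sum (lookup a) B = m"
      and xy: "{x, y} \<in> E" for a m x y
  proof (intro exI conjI)
    have "x \<in> C" "y \<in> C" using xy E by auto
    with a show "keys (a + mvar x + mvar y) \<subseteq> C" by (simp add: keys_add_nat keys_mvar)
    show "edge_pow E (Suc m) (a + mvar x + mvar y)"
      using edge_pow.step [OF xy a(2)] by (simp add: add_ac)
    show "sum (lookup (a + mvar x + mvar y)) A = Suc m" "sum (lookup (a + mvar x + mvar y)) B = Suc m"
      using cross [OF xy] AB(2) a(3,4) by (auto simp: lookup_add sum.distrib sum_lookup_mvar)
  qed simp
  have step: "P (insert z U) (Suc m)"
    if U: "U \<subseteq> C" "x \<in> U" "y \<in> U" "{x, y} \<in> E" "z \<in> C" "z \<notin> U" "{y, z} \<in> E" "P U m" for U m x y z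
  proof -
    from U(8) obtain a where a: "keys a \<subseteq> C" "edge_pow E m a" "sum (lookup a) A = m" "sum (lookup a) B = m"
      and au: "\<And>u w. u \<in> A \<inter> U \<Longrightarrow> w \<in> B \<inter> U \<Longrightarrow> edge_pow E (Suc m) (a + mvar u + mvar w)"
      unfolding P_def by blast
    have "edge_pow E (Suc (Suc m)) (a + mvar x + mvar y + mvar u + mvar w)"
      if uw: "u \<in> A \<inter> insert z U" "w \<in> B \<inter> insert z U" for u w
    proof -
      consider "u \<in> U" "w \<in> U" | "u = z" "w \<in> U" | "u \<in> U" "w = z"
        using uw AB(2) by blast
      then show ?thesis
      proof cases
        case 1
        with edge_pow.step [OF U(4) au [of u w]] uw show ?thesis by (simp add: add_ac)
      next
        case 2
        with uw cross [OF U(7)] cross [OF U(4)] AB(2) have "x \<in> A" by blast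
        with edge_pow.step [OF U(7) au [of x w]] 2 uw U(2) show ?thesis by (simp add: add_ac)
      next
        case 3
        with uw cross [OF U(7)] cross [OF U(4)] AB(2) have "x \<in> B" by blast
        with edge_pow.step [OF U(7) au [of u x]] 3 uw U(2) show ?thesis by (simp add: add_ac)
      qed
    qed
    with grow [OF a U(4)] show ?thesis unfolding P_def by blast
  qed
  from assms(3) obtain e where "e \<in> E" by blast
  from bspec [OF AB(3) this] obtain x0 y0 where "x0 \<in> A" "y0 \<in> B" "e = {x0, y0}" by blast
  with \<open>e \<in> E\<close> have x0y0: "x0 \<in> A" "y0 \<in> B" "{x0, y0} \<in> E" by simp_all
  with AB(2) have ne: "x0 \<noteq> y0" by blast
  have "P C (0 + card (C - {x0, y0}))"
  proof (rule cut_connected_induct [where P = P, OF assms(2) step])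
    show "\<forall>y\<in>{x0, y0}. \<exists>x\<in>{x0, y0}. {x, y} \<in> E" using x0y0 by (auto simp: insert_commute)
    have "edge_pow E 1 (0 + mvar u + mvar w)" if "u \<in> A \<inter> {x0, y0}" "w \<in> B \<inter> {x0, y0}" for u w
    proof -
      from that x0y0 AB(2) have "u = x0" "w = y0" by auto
      with edge_pow_edge [OF x0y0(3)] show ?thesis by simp
    qed
    then show "P {x0, y0} 0" unfolding P_def by (intro exI [of _ 0]) auto
  qed (use x0y0 AB in auto)
  moreover have "card (C - {x0, y0}) = card C - 2"
    using x0y0 AB ne by (subst card_Diff_subset) auto
  ultimately have base: "P C (card C - 2)" by simp
  \<comment> \<open>Edges beyond the |C| - 2 that growth consumes are spent on copies of the initial
    edge.\<close>
  have "P C m"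
    using \<open>card C - 2 \<le> m\<close>
  proof (induction rule: dec_induct)
    case base
    show ?case by (rule \<open>P C (card C - 2)\<close>)
  next
    case (step m)
    from step.IH obtain a where a: "keys a \<subseteq> C" "edge_pow E m a" "sum (lookup a) A = m" "sum (lookup a) B = m"
      and au: "\<And>u w. u \<in> A \<inter> C \<Longrightarrow> w \<in> B \<inter> C \<Longrightarrow> edge_pow E (Suc m) (a + mvar u + mvar w)"
      unfolding P_def by blast
    have "edge_pow E (Suc (Suc m)) (a + mvar x0 + mvar y0 + mvar u + mvar w)"
      if "u \<in> A \<inter> C" "w \<in> B \<inter> C" for u w
      using edge_pow.step [OF x0y0(3) au [OF that]] by (simp add: add_ac)
    with grow [OF a x0y0(3)] show ?case unfolding P_def by blast
  qed
  then show ?thesis using AB(1) unfolding P_def by blast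
qed

section \<open>Odd cycles in non-bipartite graphs\<close>

lemma sym_adjacency: "sym (adjacency E)"
  by (auto simp: sym_def adjacency_def insert_commute)

lemma relpow_sym: "sym R \<Longrightarrow> (u, v) \<in> R ^^ n \<Longrightarrow> (v, u) \<in> R ^^ n"
proof (induction n arbitrary: v)
  case (Suc n)
  then obtain w where "(u, w) \<in> R ^^ n" "(w, v) \<in> R" by auto
  with Suc have "(v, w) \<in> R" "(w, u) \<in> R ^^ n" by (auto dest: symD)
  then show ?case by (rule relpow_Suc_I2)
qed simp

text \<open>If all closed walks were even, the parity of walks from a root r would be well defined
  and give two sides; connectedness makes them exhaust C.\<close>

lemma odd_closed_walk:
  assumes E: "\<forall>e\<in>E. card e = 2" "\<forall>e\<in>E. e \<subseteq> C" and conn: "cut_connected C E"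
    and "\<not> bipartite C E"
  shows "\<exists>v n. odd n \<and> (v, v) \<in> adjacency E ^^ n"
proof (rule ccontr)
  assume contra: "\<nexists>v n. odd n \<and> (v, v) \<in> adjacency E ^^ n"
  have "C \<noteq> {}"
  proof
    assume "C = {}"
    with E have "E = {}" by force
    with \<open>C = {}\<close> assms(4) show False by (simp add: bipartite_def)
  qed
  then obtain r where r: "r \<in> C" by blast
  define A where "A = {v \<in> C. \<exists>n. even n \<and> (r, v) \<in> adjacency E ^^ n}"
  define B where "B = {v \<in> C. \<exists>n. odd n \<and> (r, v) \<in> adjacency E ^^ n}"
  have AB: "z \<in> B" if "y \<in> A" "{y, z} \<in> E" for y z
  proof -
    from that obtain n where "even n" "(r, y) \<in> adjacency E ^^ n" by (auto simp: A_def)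
    with that have "(r, z) \<in> adjacency E ^^ Suc n" "odd (Suc n)"
      by (auto simp: adjacency_def intro: relpow_Suc_I)
    moreover have "z \<in> C" using that E(2) by auto
    ultimately show ?thesis unfolding B_def by blast
  qed
  have BA: "z \<in> A" if "y \<in> B" "{y, z} \<in> E" for y z
  proof -
    from that obtain n where "odd n" "(r, y) \<in> adjacency E ^^ n" by (auto simp: B_def)
    with that have "(r, z) \<in> adjacency E ^^ Suc n" "even (Suc n)"
      by (auto simp: adjacency_def intro: relpow_Suc_I)
    moreover have "z \<in> C" using that E(2) by auto
    ultimately show ?thesis unfolding A_def by blast
  qed
  have "A \<inter> B = {}"
  proof (rule ccontr)
    assume "A \<inter> B \<noteq> {}"
    then obtain v n m where "even n" "odd m" "(r, v) \<in> adjacency E ^^ n" "(r, v) \<in> adjacency E ^^ m"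
      by (auto simp: A_def B_def)
    moreover from this(4) have "(v, r) \<in> adjacency E ^^ m" by (rule relpow_sym [OF sym_adjacency])
    ultimately have "(r, r) \<in> adjacency E ^^ (n + m)" "odd (n + m)" by (auto simp: relpow_add)
    with contra show False by blast
  qed
  moreover have "A \<union> B = C"
  proof (rule ccontr)
    assume ne: "A \<union> B \<noteq> C"
    have "even (0::nat)" "(r, r) \<in> adjacency E ^^ 0" by simp_all
    with r have "r \<in> A" unfolding A_def by blast
    then have "A \<union> B \<noteq> {}" by blast
    moreover have "A \<union> B \<subseteq> C" by (auto simp: A_def B_def)
    ultimately obtain y z where "y \<in> A \<union> B" "z \<notin> A \<union> B" "{y, z} \<in> E"
      using cut_connectedE [OF conn _ _ ne] by metis
    with AB BA show False by blast
  qed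
  moreover have "\<exists>a\<in>A. \<exists>b\<in>B. e = {a, b}" if e: "e \<in> E" for e
  proof -
    from e E(1) have "card e = 2" by blast
    then obtain x y where xy: "e = {x, y}" by (auto simp: card_2_iff)
    with e E(2) \<open>A \<union> B = C\<close> have "x \<in> A \<or> x \<in> B" by blast
    then show ?thesis
    proof
      assume "x \<in> A"
      with AB e xy show ?thesis by blast
    next
      assume "x \<in> B"
      with BA e xy have "y \<in> A" "e = {y, x}" by auto
      with \<open>x \<in> B\<close> show ?thesis by blast
    qed
  qed
  ultimately have "bipartite C E"
    unfolding bipartite_def by (intro exI [of _ A] exI [of _ B]) simp
  with assms(4) show False ..
qed

text \<open>A shortest odd closed walk repeats no vertex: a repetition cuts it into two shorter
  closed walks, one of them odd. The cycle is returned as a periodic sequence, so that it can be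
  read from any starting point; s is positive because there are no loops.\<close>

lemma odd_cycle:
  assumes E: "\<forall>e\<in>E. card e = 2" "\<forall>e\<in>E. e \<subseteq> C" and "cut_connected C E" "\<not> bipartite C E"
  obtains f :: "nat \<Rightarrow> 'v" and s where "0 < s" "\<And>i. {f i, f (Suc i)} \<in> E"
    "\<And>i. f (i + Suc (2 * s)) = f i" "card (range f) = Suc (2 * s)"
proof -
  define Q where "Q n \<longleftrightarrow> odd n \<and> (\<exists>v. (v, v) \<in> adjacency E ^^ n)" for n
  from odd_closed_walk [OF assms] have "\<exists>n. Q n" unfolding Q_def by (elim exE conjE) (intro exI conjI)
  from exists_least_iff [THEN iffD1, OF this] obtain n
    where n: "Q n" "\<And>m. m < n \<Longrightarrow> \<not> Q m" by blast
  from n(1) obtain v where v: "(v, v) \<in> adjacency E ^^ n" and "odd n" unfolding Q_def by blast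
  from v obtain g where g: "g 0 = v" "g n = v" "\<And>i. i < n \<Longrightarrow> (g i, g (Suc i)) \<in> adjacency E"
    unfolding relpow_fun_conv by blast
  from \<open>odd n\<close> obtain s where s: "n = Suc (2 * s)" by (auto elim: oddE)
  have walk: "(g i, g (i + d)) \<in> adjacency E ^^ d" if "i + d \<le> n" for i d
    unfolding relpow_fun_conv using g(3) that by (intro exI [of _ "\<lambda>j. g (i + j)"]) auto
  have inj: "inj_on g {..<n}"
  proof -
    have False if ij: "i < j" "j < n" "g i = g j" for i j
    proof -
      have "(g i, g i) \<in> adjacency E ^^ (j - i)" using walk [of i "j - i"] ij by simp
      moreover have "(v, g i) \<in> adjacency E ^^ i" using walk [of 0 i] ij g(1) by simp
      moreover have "(g i, v) \<in> adjacency E ^^ (n - j)" using walk [of j "n - j"] ij g(2) by simp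
      ultimately have "(g i, g i) \<in> adjacency E ^^ (j - i)" "(v, v) \<in> adjacency E ^^ (i + (n - j))"
        by (auto simp: relpow_add)
      moreover have "odd (j - i) \<or> odd (i + (n - j))" using \<open>odd n\<close> ij by presburger
      ultimately have "Q (j - i) \<or> Q (i + (n - j))" unfolding Q_def by blast
      with n(2) [of "j - i"] n(2) [of "i + (n - j)"] ij show False by auto
    qed
    then show ?thesis by (intro linorder_inj_onI') auto
  qed
  have "s \<noteq> 0"
  proof
    assume "s = 0"
    with s v have "{v} \<in> E" by (simp add: adjacency_def)
    with E(1) show False by fastforce
  qed
  define f where "f i = g (i mod n)" for i
  have "{f i, f (Suc i)} \<in> E" for i
  proof (cases "Suc (i mod n) = n")
    case True
    then have "Suc i mod n = 0" by (simp add: mod_Suc)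
    with True g(1,2) g(3) [of "i mod n"] show ?thesis
      by (auto simp: f_def adjacency_def)
  next
    case False
    moreover have "i mod n < n" by (simp add: s)
    ultimately show ?thesis
      using g(3) [of "i mod n"] by (simp add: f_def mod_Suc adjacency_def)
  qed
  moreover have "f (i + Suc (2 * s)) = f i" for i by (simp add: f_def flip: s)
  moreover have "range f = g ` {..<n}"
  proof
    show "range f \<subseteq> g ` {..<n}" by (auto simp: f_def s)
    show "g ` {..<n} \<subseteq> range f"
    proof safe
      fix i assume "i < n"
      then have "g i = f i" by (simp add: f_def)
      then show "g i \<in> range f" by simp
    qed
  qed
  then have "card (range f) = Suc (2 * s)" using card_image [OF inj] s by simp
  ultimately show thesis using \<open>s \<noteq> 0\<close> that [of s f] by simp
qed

lemma sum_periodic: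
  fixes h :: "nat \<Rightarrow> 'a::cancel_comm_monoid_add"
  assumes "\<And>i. h (i + n) = h i"
  shows "(\<Sum>t<n. h (j + t)) = (\<Sum>t<n. h t)"
proof (induction j)
  case (Suc j)
  have "h j + (\<Sum>t<n. h (Suc j + t)) = (\<Sum>t<n. h (j + t)) + h (j + n)"
    using sum.lessThan_Suc_shift [of "\<lambda>t. h (j + t)" n] sum.lessThan_Suc [of "\<lambda>t. h (j + t)" n]
    by simp
  then show ?case using assms [of j] Suc by (simp add: add.commute)
qed simp

lemma edge_pow_walk:
  assumes "\<And>i. {f i, f (Suc i)} \<in> E"
  shows "edge_pow E s (\<Sum>t<2 * s. mvar (f (j + t)))"
proof (induction s)
  case (Suc s)
  have "(\<Sum>t<2 * Suc s. mvar (f (j + t)))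
      = mvar (f (j + 2 * s)) + mvar (f (Suc (j + 2 * s))) + (\<Sum>t<2 * s. mvar (f (j + t)))"
    by (simp add: add_ac)
  with edge_pow.step [OF assms Suc] show ?case by simp
qed simp

text \<open>The base is the product of the vertices of an odd cycle of length 2 s + 1, which lies in
  the power s with one vertex to spare. The degree 2 m + 1 is one too small for the power m + 1, and
  one further vertex removes this obstruction; growth is as in the bipartite case.\<close>

lemma nonbipartite_certificate:
  fixes C :: "'v::finite set"
  assumes E: "\<forall>e\<in>E. card e = 2" "\<forall>e\<in>E. e \<subseteq> C" and conn: "cut_connected C E" "\<not> bipartite C E"
    and "card C - 2 \<le> m"
  shows "\<exists>a. keys a \<subseteq> C \<and> edge_pow E m a \<and> sum (lookup a) C = Suc (2 * m) \<and>
    (\<forall>v\<in>C. edge_pow E (Suc m) (a + mvar v))"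
proof -
  define P where "P U m \<longleftrightarrow> (\<exists>a. keys a \<subseteq> C \<and> edge_pow E m a \<and> sum (lookup a) C = Suc (2 * m) \<and>
    (\<forall>v\<in>U. edge_pow E (Suc m) (a + mvar v)))" for U m
  have grow: "\<exists>b. keys b \<subseteq> C \<and> edge_pow E (Suc m) b \<and> sum (lookup b) C = Suc (2 * Suc m) \<and>
      b = a + mvar x + mvar y"
    if a: "keys a \<subseteq> C" "edge_pow E m a" "sum (lookup a) C = Suc (2 * m)"
      and xy: "{x, y} \<in> E" for a m x y
  proof (intro exI conjI)
    have xyC: "x \<in> C" "y \<in> C" using xy E(2) by auto
    then show "keys (a + mvar x + mvar y) \<subseteq> C" using a by (simp add: keys_add_nat keys_mvar)
    show "edge_pow E (Suc m) (a + mvar x + mvar y)"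
      using edge_pow.step [OF xy a(2)] by (simp add: add_ac)
    show "sum (lookup (a + mvar x + mvar y)) C = Suc (2 * Suc m)"
      using a(3) xyC by (simp add: lookup_add sum.distrib sum_lookup_mvar)
  qed simp
  have step: "P (insert z U) (Suc m)"
    if U: "U \<subseteq> C" "x \<in> U" "y \<in> U" "{x, y} \<in> E" "z \<in> C" "z \<notin> U" "{y, z} \<in> E" "P U m" for U m x y z
  proof -
    from U(8) obtain a where a: "keys a \<subseteq> C" "edge_pow E m a" "sum (lookup a) C = Suc (2 * m)"
      and av: "\<And>v. v \<in> U \<Longrightarrow> edge_pow E (Suc m) (a + mvar v)"
      unfolding P_def by blast
    have "edge_pow E (Suc (Suc m)) (a + mvar x + mvar y + mvar v)" if "v \<in> insert z U" for v
    proof (cases "v = z")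
      case True
      with edge_pow.step [OF U(7) av [OF U(2)]] show ?thesis by (simp add: add_ac)
    next
      case False
      with that edge_pow.step [OF U(4) av [of v]] show ?thesis by (simp add: add_ac)
    qed
    with grow [OF a U(4)] show ?thesis unfolding P_def by blast
  qed
  obtain f s where f: "0 < s" "\<And>i. {f i, f (Suc i)} \<in> E" "\<And>i. f (i + Suc (2 * s)) = f i"
      "card (range f) = Suc (2 * s)"
    using odd_cycle [OF E conn] by metis
  have fC: "f i \<in> C" for i using f(2) [of i] E(2) by auto
  define a where "a = (\<Sum>t<Suc (2 * s). mvar (f t))"
  have a_shift: "a = mvar (f j) + (\<Sum>t<2 * s. mvar (f (Suc j + t)))" for j
  proof -
    have "a = (\<Sum>t<Suc (2 * s). mvar (f (j + t)))"
      unfolding a_def using f(3) by (intro sum_periodic [symmetric, of "\<lambda>t. mvar (f t)"]) simp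
    then show ?thesis by (simp add: sum.lessThan_Suc_shift del: sum.lessThan_Suc)
  qed
  have base: "P (range f) s"
    unfolding P_def
  proof (intro exI [of _ a] conjI ballI)
    show "keys a \<subseteq> C"
      unfolding keys_subset_iff a_def lookup_sum lookup_mvar
      using fC by (intro allI impI sum.neutral) auto
    have walk: "edge_pow E s (\<Sum>t<2 * s. mvar (f (j + t)))" for j
      by (rule edge_pow_walk) (rule f(2))
    from edge_pow_add_right [OF this, of "Suc 0" "mvar (f 0)"]
    have "edge_pow E s (mvar (f 0) + (\<Sum>t<2 * s. mvar (f (Suc 0 + t))))"
      by (simp add: add.commute)
    then show "edge_pow E s a" using a_shift [of 0] by simp
    have "sum (lookup a) C = (\<Sum>t<Suc (2 * s). \<Sum>v\<in>C. lookup (mvar (f t)) v)"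
      unfolding a_def lookup_sum by (rule sum.swap)
    then show "sum (lookup a) C = Suc (2 * s)" using fC by (simp add: sum_lookup_mvar)
    fix v assume "v \<in> range f"
    then obtain i where i: "v = f i" by blast
    \<comment> \<open>One copy of \<open>f i\<close> is paired with \<open>f (i + 1)\<close>; the 2
      s vertices from \<open>f (i + 2)\<close> round to the other copy of \<open>f i\<close> form a
      path with a perfect matching.\<close>
    show "edge_pow E (Suc s) (a + mvar v)"
      using edge_pow.step [OF f(2) [of i] walk [of "Suc (Suc i)"]]
      by (simp add: a_shift [of "Suc i"] i add_ac)
  qed
  have "P C (s + card (C - range f))"
  proof (rule cut_connected_induct [where P = P, OF conn(1) step _ _ _ base])
    show "\<forall>y\<in>range f. \<exists>x\<in>range f. {x, y} \<in> E" using f(2) by (auto simp: insert_commute) 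
  qed (use fC in auto)
  moreover have "card (C - range f) = card C - Suc (2 * s)" "Suc (2 * s) \<le> card C"
    using fC f(4) card_mono [of C "range f"] by (auto simp: card_Diff_subset image_subset_iff)
  \<comment> \<open>The cost s + |C| - (2 s + 1) is at most |C| - 2 because s is positive.\<close>
  then have "s + card (C - range f) \<le> m" using f(1) assms(5) by simp
  ultimately obtain m0 where "P C m0" "m0 \<le> m" by blast
  from this(2) have "P C m"
  proof (induction rule: dec_induct)
    case base
    show ?case by fact
  next
    case (step m)
    from step.IH obtain b where b: "keys b \<subseteq> C" "edge_pow E m b" "sum (lookup b) C = Suc (2 * m)"
      and bv: "\<And>v. v \<in> C \<Longrightarrow> edge_pow E (Suc m) (b + mvar v)"
      unfolding P_def by blast
    have "edge_pow E (Suc (Suc m)) (b + mvar (f 0) + mvar (f (Suc 0)) + mvar v)" if "v \<in> C" for v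
      using edge_pow.step [OF f(2) [of 0] bv [OF that]] by (simp add: add_ac)
    with grow [OF b f(2) [of 0]] show ?case unfolding P_def by blast
  qed
  then show ?thesis unfolding P_def by blast
qed

section \<open>Powers of edge ideals and their Stanley depth\<close>

definition polys_on :: "('v \<Rightarrow>\<^sub>0 nat) set \<Rightarrow> ('v, 'k::field) mpol set" where
  "polys_on L = {p. keys p \<subseteq> L}"

lemma sum_monomials: "(\<Sum>t\<in>keys p. single t (lookup p t)) = p"
proof (rule poly_mapping_eqI)
  fix s
  show "lookup (\<Sum>t\<in>keys p. single t (lookup p t)) s = lookup p s"
    by (cases "s \<in> keys p") (auto simp: lookup_sum lookup_single when_def in_keys_iff sum.delta')
qed

lemma subspace_polys_on:
  assumes "\<And>s t. t \<in> L \<Longrightarrow> s + t \<in> L"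
  shows "ring_module.subspace (polys_on L :: ('v, 'k::field) mpol set)"
proof (rule ring_module.subspaceI)
  fix p q :: "('v, 'k) mpol"
  assume "p \<in> polys_on L" "q \<in> polys_on L"
  then show "p + q \<in> polys_on L" using keys_add [of p q] unfolding polys_on_def by blast
next
  fix p q :: "('v, 'k) mpol"
  assume "q \<in> polys_on L"
  then show "p * q \<in> polys_on L"
    using keys_mult [of p q] assms unfolding polys_on_def by blast
qed (simp add: polys_on_def)

lemma span_eq_polys_on:
  fixes B :: "('v, 'k::field) mpol set"
  assumes "\<And>s t. t \<in> L \<Longrightarrow> s + t \<in> L" "B \<subseteq> polys_on L"
    and "\<And>t. t \<in> L \<Longrightarrow> single t 1 \<in> ring_module.span B"
  shows "ring_module.span B = polys_on L"
proof
  show "ring_module.span B \<subseteq> polys_on L"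
    using assms(2) subspace_polys_on [OF assms(1)] by (rule ring_module.span_minimal)
  show "polys_on L \<subseteq> ring_module.span B"
  proof
    fix p :: "('v, 'k) mpol" assume p: "p \<in> polys_on L"
    have "single t (lookup p t) \<in> ring_module.span B" if "t \<in> keys p" for t
    proof -
      have "single t (lookup p t) = single 0 (lookup p t) * single t 1" by (simp add: mult_single)
      moreover have "single t 1 \<in> ring_module.span B" using assms(3) p that by (auto simp: polys_on_def)
      ultimately show ?thesis using ring_module.span_scale by metis
    qed
    then have "(\<Sum>t\<in>keys p. single t (lookup p t)) \<in> ring_module.span B"
      by (rule ring_module.span_sum)
    then show "p \<in> ring_module.span B" by (simp add: sum_monomials)
  qed
qed

lemma edge_ideal_eq: "(edge_ideal E :: ('v, 'k::field) mpol set) = polys_on {t. edge_pow E 1 t}"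
  unfolding edge_ideal_def ideal_gen_def
proof (rule span_eq_polys_on)
  fix s t assume "t \<in> {t. edge_pow E 1 t}"
  then show "s + t \<in> {t. edge_pow E 1 t}" using edge_pow_add_right [of E 1 t s] by (simp add: add.commute)
next
  show "{var u * var w | u w. {u, w} \<in> E} \<subseteq> (polys_on {t. edge_pow E 1 t} :: ('v, 'k) mpol set)"
    using edge_pow_edge by (auto simp: polys_on_def var_eq mult_single)
next
  fix t assume "t \<in> {t. edge_pow E 1 t}"
  then obtain u w s where *: "{u, w} \<in> E" "t = mvar u + mvar w + s"
    by (auto simp: edge_pow_Suc [where k = 0, simplified])
  then have eq: "single t 1 = single s 1 * (var u * (var w :: ('v, 'k) mpol))"
    by (simp add: var_eq mult_single add_ac)
  have "var u * var w \<in> ring_module.span {var u * (var w :: ('v, 'k) mpol) | u w. {u, w} \<in> E}"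
    using *(1) by (intro ring_module.span_base) blast
  then show "single t 1 \<in> ring_module.span {var u * (var w :: ('v, 'k) mpol) | u w. {u, w} \<in> E}"
    unfolding eq by (rule ring_module.span_scale)
qed

lemma ideal_power_edge_ideal:
  "ideal_power (edge_ideal E :: ('v, 'k::field) mpol set) k = polys_on {t. edge_pow E k t}"
proof (induction k)
  case 0
  show ?case by (simp add: polys_on_def)
next
  case (Suc k)
  let ?B = "{a * b | a b. a \<in> polys_on {t. edge_pow E 1 t} \<and> b \<in> polys_on {t. edge_pow E k t}}
    :: ('v, 'k) mpol set"
  have "ring_module.span ?B = polys_on {t. edge_pow E (Suc k) t}"
  proof (rule span_eq_polys_on)
    fix s t assume "t \<in> {t. edge_pow E (Suc k) t}"
    then show "s + t \<in> {t. edge_pow E (Suc k) t}"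
      using edge_pow_add_right [of E "Suc k" t s] by (simp add: add.commute)
  next
    show "?B \<subseteq> polys_on {t. edge_pow E (Suc k) t}"
    proof safe
      fix a b :: "('v, 'k) mpol"
      assume "a \<in> polys_on {t. edge_pow E 1 t}" "b \<in> polys_on {t. edge_pow E k t}"
      then have a: "edge_pow E 1 s" if "s \<in> keys a" for s using that by (auto simp: polys_on_def)
      have b: "edge_pow E k s" if "s \<in> keys b" for s
        using that \<open>b \<in> polys_on {t. edge_pow E k t}\<close> by (auto simp: polys_on_def)
      have "edge_pow E (Suc k) t" if "t \<in> keys (a * b)" for t
      proof -
        from that keys_mult [of a b] obtain r s where "r \<in> keys a" "s \<in> keys b" "t = r + s" by blast
        with edge_pow_add [OF a b] show ?thesis by simp
      qed
      then show "a * b \<in> polys_on {t. edge_pow E (Suc k) t}" by (auto simp: polys_on_def)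
    qed
  next
    fix t assume "t \<in> {t. edge_pow E (Suc k) t}"
    then obtain u w s where *: "{u, w} \<in> E" "edge_pow E k s" "t = mvar u + mvar w + s"
      by (auto simp: edge_pow_Suc)
    have "single t 1 = single (mvar u + mvar w) 1 * (single s 1 :: ('v, 'k) mpol)"
      by (simp add: mult_single *(3))
    moreover have "single (mvar u + mvar w) (1 :: 'k) \<in> polys_on {t. edge_pow E 1 t}"
      using edge_pow_edge [OF *(1)] by (simp add: polys_on_def)
    moreover have "single s (1 :: 'k) \<in> polys_on {t. edge_pow E k t}"
      using *(2) by (simp add: polys_on_def)
    ultimately have "single t 1 \<in> ?B" by blast
    then show "single t 1 \<in> ring_module.span ?B" by (rule ring_module.span_base)
  qed
  then show ?case
    unfolding ideal_power.simps(2) ideal_gen_def Suc by (simp add: edge_ideal_eq)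
qed

section \<open>From cones of monomials to Stanley spaces\<close>

lemma stanley_subspace_eq:
  "stanley_subspace (*) (single b 1, Z) = (polys_on (cone b Z) :: ('v, 'k::field) mpol set)"
proof (intro set_eqI iffI)
  fix p :: "('v, 'k) mpol"
  assume "p \<in> stanley_subspace (*) (single b 1, Z)"
  then obtain f where f: "f \<in> subpolynomials Z" "p = single b 1 * f"
    by (auto simp: stanley_subspace_def mult.commute)
  show "p \<in> polys_on (cone b Z)"
    unfolding polys_on_def
  proof safe
    fix t assume "t \<in> keys p"
    then obtain r where "r \<in> keys f" "t = b + r" unfolding f(2) by (blast dest: keys_single_mult)
    with f(1) show "t \<in> cone b Z" by (auto simp: subpolynomials_def cone_def)
  qed
next
  fix p :: "('v, 'k) mpol"
  assume p: "p \<in> polys_on (cone b Z)"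
  define f where "f = (\<Sum>t\<in>keys p. single (t - b) (lookup p t))"
  have t: "b + (t - b) = t" "keys (t - b) \<subseteq> Z" if t: "t \<in> keys p" for t
  proof -
    from p t have "t \<in> cone b Z" by (auto simp: polys_on_def)
    then obtain z where "t = b + z" "keys z \<subseteq> Z" by (auto simp: cone_def)
    then show "b + (t - b) = t" "keys (t - b) \<subseteq> Z" by simp_all
  qed
  have "f \<in> subpolynomials Z"
    unfolding subpolynomials_def
  proof safe
    fix s v assume s: "s \<in> keys f" "v \<in> keys s"
    have "keys f \<subseteq> (\<Union>t\<in>keys p. keys (single (t - b) (lookup p t)))"
      unfolding f_def by (rule keys_sum)
    with s(1) obtain t' where "t' \<in> keys p" "s = t' - b" by (auto split: if_splits)
    with t(2) s(2) show "v \<in> Z" by blast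
  qed
  moreover have "f * single b 1 = p"
  proof -
    have "f * single b 1 = (\<Sum>t\<in>keys p. single (b + (t - b)) (lookup p t))"
      by (simp add: f_def sum_distrib_right mult_single add.commute)
    also have "\<dots> = (\<Sum>t\<in>keys p. single t (lookup p t))" using t(1) by (intro sum.cong) auto
    finally show ?thesis by (simp add: sum_monomials)
  qed
  ultimately show "p \<in> stanley_subspace (*) (single b 1, Z)"
    by (auto simp: stanley_subspace_def)
qed

text \<open>The monomial itself is a basis, since multiplication by it is injective.\<close>

lemma stanley_space_monomial:
  assumes "single b 1 \<in> (I :: ('v, 'k::field) mpol set)"
  shows "stanley_space (*) multidegree_component I (single b 1, Z)"
proof -
  let ?u = "single b 1 :: ('v, 'k) mpol"
  have "linear_combinations (*) (subpolynomials Z) {?u} = stanley_subspace (*) (?u, Z)"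
  proof (intro set_eqI iffI)
    fix p assume "p \<in> linear_combinations (*) (subpolynomials Z) {?u}"
    then obtain F c where F: "F \<subseteq> {?u}" "\<forall>b\<in>F. c b \<in> subpolynomials Z" "p = (\<Sum>b\<in>F. c b * b)"
      unfolding linear_combinations_def by blast
    from F(1) consider "F = {}" | "F = {?u}" by blast
    then show "p \<in> stanley_subspace (*) (?u, Z)"
    proof cases
      case 1
      with F(3) have "p = 0 * ?u" by simp
      moreover have "0 \<in> subpolynomials Z" by (simp add: subpolynomials_def)
      ultimately show ?thesis unfolding stanley_subspace_def by blast
    next
      case 2
      with F show ?thesis by (auto simp: stanley_subspace_def)
    qed
  next
    fix p assume "p \<in> stanley_subspace (*) (?u, Z)"
    then obtain f where f: "f \<in> subpolynomials Z" "p = f * ?u" by (auto simp: stanley_subspace_def)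
    then show "p \<in> linear_combinations (*) (subpolynomials Z) {?u}"
      unfolding linear_combinations_def
      by (intro CollectI exI [of _ "{?u}"] exI [of _ "\<lambda>_. f"]) auto
  qed
  moreover have "c = 0" if "c * ?u = 0" for c
  proof (rule poly_mapping_eqI)
    fix t
    have "lookup c t = lookup (?u * c) (b + t)" by (rule lookup_single_mult [symmetric])
    also have "\<dots> = 0" using that by (simp add: mult.commute)
    finally show "lookup c t = lookup 0 t" by simp
  qed
  then have "c b = 0" if "F \<subseteq> {?u}" "(\<Sum>b\<in>F. c b * b) = 0" "b \<in> F" for F c b
    using that by (auto simp: subset_singleton_iff)
  ultimately have "free_over (*) (subpolynomials Z) (stanley_subspace (*) (?u, Z))"
    unfolding free_over_def by blast
  moreover have "?u \<in> multidegree_component (\<lambda>v. int (lookup b v))"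
    by (simp add: multidegree_component_def)
  ultimately show ?thesis using assms by (auto simp: stanley_space_def)
qed

text \<open>The summands of a polynomial are its restrictions to the cones: every monomial of L lies
  in exactly one of them, which gives both existence and uniqueness.\<close>

lemma sdepth_ge:
  assumes L: "stanley_set UNIV d L"
  shows "enat d \<le> sdepth (*) multidegree_component (polys_on L :: ('v::finite, 'k::field) mpol set)"
proof -
  obtain D0 where D0: "finite D0" "\<forall>p\<in>D0. d \<le> card (snd p) \<and> cone (fst p) (snd p) \<subseteq> L"
      "\<forall>t\<in>L. \<exists>!p. p \<in> D0 \<and> t \<in> cone (fst p) (snd p)"
    using stanley_set_partition [OF L] by blast
  define \<phi> :: "('v \<Rightarrow>\<^sub>0 nat) \<times> 'v set \<Rightarrow> ('v, 'k) mpol \<times> 'v set" where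
    "\<phi> p = (single (fst p) 1, snd p)" for p
  \<comment> \<open>For c in the image of \<phi> this union is a single cone, by injectivity; it
    stands in for an inverse of \<phi>.\<close>
  define K where "K c = (\<Union>p\<in>{p \<in> D0. \<phi> p = c}. cone (fst p) (snd p))" for c
  have inj: "p = q" if "\<phi> p = \<phi> q" for p q
  proof -
    from that have "keys (single (fst p) (1 :: 'k)) = keys (single (fst q) (1 :: 'k))" "snd p = snd q"
      by (simp_all add: \<phi>_def)
    then show ?thesis by (simp add: prod_eq_iff)
  qed
  have K: "K (\<phi> p) = cone (fst p) (snd p)" if "p \<in> D0" for p
    using that inj unfolding K_def by blast
  have space: "stanley_subspace (*) c = (polys_on (K c) :: ('v, 'k) mpol set)" if "c \<in> \<phi> ` D0" for c
    using that K by (auto simp: \<phi>_def stanley_subspace_eq)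
  have uniq: "\<exists>!c. c \<in> \<phi> ` D0 \<and> t \<in> K c" if "t \<in> L" for t
  proof -
    from D0(3) that obtain p where p: "p \<in> D0" "t \<in> cone (fst p) (snd p)"
        "\<And>q. q \<in> D0 \<Longrightarrow> t \<in> cone (fst q) (snd q) \<Longrightarrow> q = p" by metis
    show ?thesis
    proof (rule ex1I [of _ "\<phi> p"])
      show "\<phi> p \<in> \<phi> ` D0 \<and> t \<in> K (\<phi> p)" using p(1,2) K by simp
      fix c assume "c \<in> \<phi> ` D0 \<and> t \<in> K c"
      then obtain q where "q \<in> D0" "c = \<phi> q" "t \<in> cone (fst q) (snd q)" using K by auto
      with p(3) show "c = \<phi> p" by blast
    qed
  qed
  have KL: "K c \<subseteq> L" for c using D0(2) unfolding K_def by blast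
  have "stanley_decomposition (*) multidegree_component (polys_on L :: ('v, 'k) mpol set) (\<phi> ` D0)"
    unfolding stanley_decomposition_def
  proof (intro conjI ballI)
    show "finite (\<phi> ` D0)" using D0(1) by simp
  next
    fix c assume c: "c \<in> \<phi> ` D0"
    then obtain p where p: "p \<in> D0" "c = \<phi> p" by blast
    have "fst p \<in> cone (fst p) (snd p)" by (auto simp: cone_def intro: exI [of _ 0])
    with D0(2) p have "single (fst p) 1 \<in> (polys_on L :: ('v, 'k) mpol set)" by (auto simp: polys_on_def)
    then show "stanley_space (*) multidegree_component (polys_on L) c"
      unfolding p \<phi>_def by (rule stanley_space_monomial)
    show "stanley_subspace (*) c \<subseteq> polys_on L"
      unfolding space [OF c] using KL [of c] by (auto simp: polys_on_def)
  next
    fix x :: "('v, 'k) mpol" assume x: "x \<in> polys_on L"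
    have only: "lookup (\<Sum>c\<in>\<phi> ` D0. s c) t = lookup (s c) t"
      if s: "\<And>c. c \<in> \<phi> ` D0 \<Longrightarrow> s c \<in> polys_on (K c)" and c: "c \<in> \<phi> ` D0" "t \<in> K c"
      for s :: "_ \<Rightarrow> ('v, 'k) mpol" and t c
    proof -
      have "lookup (s c') t = 0" if "c' \<in> \<phi> ` D0 - {c}" for c'
      proof -
        have "t \<notin> K c'" using uniq [of t] c KL [of c] that by blast
        with s [of c'] that show ?thesis by (auto simp: polys_on_def in_keys_iff)
      qed
      then have "(\<Sum>c'\<in>\<phi> ` D0 - {c}. lookup (s c') t) = 0" by (rule sum.neutral [OF ballI])
      with c(1) D0(1) show ?thesis
        by (simp add: lookup_sum sum.remove [of "\<phi> ` D0" c "\<lambda>c. lookup (s c) t"])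
    qed
    define s where "s = (\<lambda>c\<in>\<phi> ` D0. restr (K c) x)"
    show "\<exists>!s. s \<in> (\<Pi>\<^sub>E c\<in>\<phi> ` D0. stanley_subspace (*) c) \<and> x = (\<Sum>c\<in>\<phi> ` D0. s c)"
    proof (rule ex1I [of _ s])
      have s: "s c \<in> polys_on (K c)" if "c \<in> \<phi> ` D0" for c
        using that keys_restr [of "K c" x] by (simp add: s_def polys_on_def)
      have "x = (\<Sum>c\<in>\<phi> ` D0. s c)"
      proof (rule poly_mapping_eqI)
        fix t
        show "lookup x t = lookup (\<Sum>c\<in>\<phi> ` D0. s c) t"
        proof (cases "t \<in> L")
          case True
          then obtain c where c: "c \<in> \<phi> ` D0" "t \<in> K c" using uniq by blast
          with only [OF s c] show ?thesis by (simp add: s_def)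
        next
          case False
          with x have "lookup x t = 0" by (auto simp: polys_on_def in_keys_iff)
          moreover have "lookup (s c) t = 0" if "c \<in> \<phi> ` D0" for c
            using s [OF that] False KL [of c] by (auto simp: polys_on_def in_keys_iff)
          ultimately show ?thesis by (simp add: lookup_sum)
        qed
      qed
      moreover have s_PiE: "s \<in> (\<Pi>\<^sub>E c\<in>\<phi> ` D0. stanley_subspace (*) c)"
      proof (rule PiE_I)
        show "s c \<in> stanley_subspace (*) c" if "c \<in> \<phi> ` D0" for c
          unfolding space [OF that] by (rule s [OF that])
        show "s c = undefined" if "c \<notin> \<phi> ` D0" for c using that by (simp add: s_def)
      qed
      ultimately show "s \<in> (\<Pi>\<^sub>E c\<in>\<phi> ` D0. stanley_subspace (*) c) \<and> x = (\<Sum>c\<in>\<phi> ` D0. s c)"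
        by (rule conjI [rotated])
      fix s' assume s': "s' \<in> (\<Pi>\<^sub>E c\<in>\<phi> ` D0. stanley_subspace (*) c) \<and> x = (\<Sum>c\<in>\<phi> ` D0. s' c)"
      have s'_mem: "s' c \<in> polys_on (K c)" if "c \<in> \<phi> ` D0" for c
        using PiE_mem [OF conjunct1 [OF s'] that] unfolding space [OF that] .
      show "s' = s"
      proof (rule PiE_ext)
        show "s' \<in> (\<Pi>\<^sub>E c\<in>\<phi> ` D0. stanley_subspace (*) c)" using s' ..
        show "s \<in> (\<Pi>\<^sub>E c\<in>\<phi> ` D0. stanley_subspace (*) c)" by (rule s_PiE)
        fix c assume c: "c \<in> \<phi> ` D0"
        show "s' c = s c"
        proof (rule poly_mapping_eqI)
          fix t
          show "lookup (s' c) t = lookup (s c) t"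
          proof (cases "t \<in> K c")
            case True
            have "lookup (s' c) t = lookup x t"
              using only [OF s'_mem c True] conjunct2 [OF s'] by simp
            with True c show ?thesis by (simp add: s_def)
          next
            case False
            with s'_mem [OF c] c show ?thesis by (auto simp: s_def polys_on_def in_keys_iff)
          qed
        qed
      qed
    qed
  qed
  moreover have "enat d \<le> decomposition_sdepth (\<phi> ` D0)"
    unfolding decomposition_sdepth_def using D0(2) by (auto intro!: INF_greatest simp: \<phi>_def)
  ultimately show ?thesis
    unfolding sdepth_def by (meson SUP_upper mem_Collect_eq order_trans)
qed

section \<open>Connected components\<close>

definition components :: "'v set set \<Rightarrow> 'v set set" where
  "components E = component_vertices UNIV E"

lemma components_eq: "components E = {{w. (u, w) \<in> (adjacency E)\<^sup>*} | u. True}"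
  by (simp add: components_def component_vertices_def)

lemma component_memI: "\<exists>C\<in>components E. v \<in> C"
  unfolding components_eq by (intro bexI [of _ "{w. (v, w) \<in> (adjacency E)\<^sup>*}"]) auto

lemma component_eq:
  assumes "C \<in> components E" "v \<in> C"
  shows "C = {w. (v, w) \<in> (adjacency E)\<^sup>*}"
proof -
  from assms obtain u where u: "C = {w. (u, w) \<in> (adjacency E)\<^sup>*}" by (auto simp: components_eq)
  with assms have "(u, v) \<in> (adjacency E)\<^sup>*" by simp
  moreover from this have "(v, u) \<in> (adjacency E)\<^sup>*"
    by (rule symD [OF sym_rtrancl [OF sym_adjacency]])
  ultimately show ?thesis unfolding u by (auto intro: rtrancl_trans)
qed

lemma component_unique:
  "C \<in> components E \<Longrightarrow> D \<in> components E \<Longrightarrow> v \<in> C \<Longrightarrow> v \<in> D \<Longrightarrow> C = D"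
  using component_eq [of C E v] component_eq [of D E v] by simp

lemma component_nonempty: "C \<in> components E \<Longrightarrow> C \<noteq> {}"
  by (auto simp: components_eq)

lemma component_edge:
  assumes "C \<in> components E" "u \<in> C" "{u, w} \<in> E"
  shows "w \<in> C"
  using component_eq [OF assms(1,2)] assms(3) by (auto simp: adjacency_def)

lemma component_cut_connected:
  assumes "C \<in> components E"
  shows "cut_connected C (induced_edges E C)"
  unfolding cut_connected_def
proof (intro allI impI)
  fix U assume U: "U \<subseteq> C" "U \<noteq> {}" "U \<noteq> C"
  then obtain u w where uw: "u \<in> U" "w \<in> C" "w \<notin> U" by blast
  with U assms have "(u, w) \<in> (adjacency E)\<^sup>*" using component_eq [of C E u] by blast
  then have "w \<notin> U \<longrightarrow> (\<exists>y\<in>U. \<exists>z. z \<notin> U \<and> {y, z} \<in> E)"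
    by (induction rule: rtrancl_induct) (use uw(1) in \<open>auto simp: adjacency_def\<close>)
  with uw(3) obtain y z where yz: "y \<in> U" "z \<notin> U" "{y, z} \<in> E" by blast
  with U have "z \<in> C" using component_edge [OF assms, of y z] by blast
  with yz U have "{y, z} \<in> induced_edges E C" by (auto simp: induced_edges_def)
  with yz \<open>z \<in> C\<close> show "\<exists>y\<in>U. \<exists>z\<in>C - U. {y, z} \<in> induced_edges E C" by blast
qed

lemma component_edges_cover:
  assumes "\<forall>e\<in>E. card e = 2"
  shows "(\<Union>C\<in>components E. induced_edges E C) = E"
proof
  show "E \<subseteq> (\<Union>C\<in>components E. induced_edges E C)"
  proof
    fix e assume e: "e \<in> E"
    with assms obtain u w where uw: "e = {u, w}" by (metis card_2_iff)
    obtain C where C: "C \<in> components E" "u \<in> C" using component_memI by metis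
    with e uw have "w \<in> C" using component_edge by metis
    with e uw C show "e \<in> (\<Union>C\<in>components E. induced_edges E C)" by (auto simp: induced_edges_def)
  qed
qed (auto simp: induced_edges_def)

lemma sum_card_components:
  "(\<Sum>C\<in>components (E :: 'v::finite set set). card C) = CARD('v)"
proof -
  have "card (\<Union>(components E)) = (\<Sum>C\<in>components E. card C)"
    by (rule card_Union_disjoint) (auto simp: pairwise_def disjnt_def dest: component_unique)
  moreover have "\<Union>(components E) = UNIV" using component_memI [of E] by blast
  ultimately show ?thesis by simp
qed

lemma induced_edges_simple:
  "\<forall>e\<in>E. card e = 2 \<Longrightarrow> \<forall>e\<in>induced_edges E C. card e = 2"
  "\<forall>e\<in>induced_edges E C. e \<subseteq> C"
  by (auto simp: induced_edges_def)

text \<open>Isolated vertices count here. The cardinality of this set is the p in the bound p +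
  1.\<close>

abbreviation bip_components :: "'v set set \<Rightarrow> 'v set set" where
  "bip_components E \<equiv> {C \<in> components E. bipartite C (induced_edges E C)}"

text \<open>The other components are adjoined one at a time, each through its layers.
  \<open>C0\<close> is kept innermost because only its powers, not its layers, are assumed to have
  dimension d.\<close>

lemma stanley_set_components:
  fixes E :: "'v::finite set set"
  assumes E: "\<forall>e\<in>E. card e = 2" and C0: "C0 \<in> components E"
    and pow: "\<And>i. stanley_set C0 d (edge_pow_on (induced_edges E C0) C0 i)"
  shows "stanley_set UNIV (d + card (bip_components E - {C0})) {t. edge_pow E k t}"
proof -
  have *: "stanley_set (\<Union>\<D> \<union> C0) (card {C \<in> \<D>. bipartite C (induced_edges E C)} + d)
      (edge_pow_on ((\<Union>C\<in>\<D>. induced_edges E C) \<union> induced_edges E C0) (\<Union>\<D> \<union> C0) k)"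
    if "finite \<D>" "\<D> \<subseteq> components E - {C0}" for \<D> k
    using that
  proof (induction \<D> arbitrary: k rule: finite_induct)
    case empty
    with pow show ?case by simp
  next
    case (insert C \<D>)
    define b :: nat where "b = of_bool (bipartite C (induced_edges E C))"
    have C: "C \<in> components E" using insert.prems by blast
    then have ne: "C \<noteq> {}" by (rule component_nonempty)
    note simple = induced_edges_simple(1) [OF E, of C] induced_edges_simple(2) [of E C]
    have "stanley_set (C \<union> (\<Union>\<D> \<union> C0)) (b + (card {C \<in> \<D>. bipartite C (induced_edges E C)} + d))
        (edge_pow_on (induced_edges E C \<union> ((\<Union>C\<in>\<D>. induced_edges E C) \<union> induced_edges E C0)) (C \<union> (\<Union>\<D> \<union> C0)) k)"
    proof (rule stanley_set_Un_edge_pow_on)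
      show "C \<inter> (\<Union>\<D> \<union> C0) = {}"
        using insert.hyps(2) insert.prems C0 component_unique [OF C] by blast
      show "\<forall>e\<in>(\<Union>C\<in>\<D>. induced_edges E C) \<union> induced_edges E C0. e \<subseteq> \<Union>\<D> \<union> C0"
        by (auto simp: induced_edges_def)
      show "stanley_set C b (layer (induced_edges E C) C i)" for i
      proof (cases "bipartite C (induced_edges E C)")
        case True
        from stanley_set_1_layer [OF simple True ne] True show ?thesis by (simp add: b_def)
      next
        case False
        with stanley_set_0_layer [OF simple(1)] show ?thesis by (simp add: b_def)
      qed
      show "stanley_set C b (edge_pow_on (induced_edges E C) C i)" for i
      proof (cases "bipartite C (induced_edges E C)")
        case True
        from ne obtain v where "v \<in> C" by blast
        from stanley_set_1_edge_pow_on [OF simple(1) this] True show ?thesis by (simp add: b_def)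
      next
        case False
        with stanley_set_0_edge_pow_on [OF simple(1)] show ?thesis by (simp add: b_def)
      qed
      show "stanley_set (\<Union>\<D> \<union> C0) (card {C \<in> \<D>. bipartite C (induced_edges E C)} + d)
          (edge_pow_on ((\<Union>C\<in>\<D>. induced_edges E C) \<union> induced_edges E C0) (\<Union>\<D> \<union> C0) i)" for i
        using insert.prems by (intro insert.IH) auto
    qed (rule simple)
    moreover have "card {D \<in> insert C \<D>. bipartite D (induced_edges E D)}
        = b + card {D \<in> \<D>. bipartite D (induced_edges E D)}"
    proof (cases "bipartite C (induced_edges E C)")
      case True
      then have "{D \<in> insert C \<D>. bipartite D (induced_edges E D)}
          = insert C {D \<in> \<D>. bipartite D (induced_edges E D)}" by blast
      with True insert.hyps show ?thesis by (simp add: b_def)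
    next
      case False
      then have "{D \<in> insert C \<D>. bipartite D (induced_edges E D)}
          = {D \<in> \<D>. bipartite D (induced_edges E D)}" by blast
      with False show ?thesis by (simp add: b_def)
    qed
    ultimately show ?case by (simp add: Un_assoc add.assoc)
  qed
  have "\<Union>(components E - {C0}) \<union> C0 = UNIV"
    using component_memI [of E] by blast
  moreover have "(\<Union>C\<in>components E - {C0}. induced_edges E C) \<union> induced_edges E C0 = E"
    using component_edges_cover [OF E] C0 by blast
  moreover have "{C \<in> components E - {C0}. bipartite C (induced_edges E C)} = bip_components E - {C0}"
    by blast
  moreover have "edge_pow_on E UNIV k = {t. edge_pow E k t}" by (simp add: edge_pow_on_def)
  ultimately show ?thesis using * [of "components E - {C0}" k] by (simp add: add.commute)
qed

lemma edge_pow_components_split: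
  fixes E :: "'v::finite set set"
  assumes "edge_pow E k t" "\<forall>e\<in>E. card e = 2"
  shows "\<exists>\<kappa>. (\<Sum>C\<in>components E. \<kappa> C) = k \<and> (\<forall>C. edge_pow (induced_edges E C) (\<kappa> C) t)"
  using assms(1)
proof (induction rule: edge_pow.induct)
  case (zero t)
  show ?case by (rule exI [of _ "\<lambda>_. 0"]) simp
next
  case (step u w k t)
  then obtain \<kappa> where \<kappa>: "(\<Sum>C\<in>components E. \<kappa> C) = k" "\<And>C. edge_pow (induced_edges E C) (\<kappa> C) t"
    by blast
  obtain C where C: "C \<in> components E" "u \<in> C" using component_memI by metis
  with step(1) have "{u, w} \<in> induced_edges E C"
    using component_edge [OF C step(1)] by (simp add: induced_edges_def)
  then have "edge_pow (induced_edges E C) (Suc (\<kappa> C)) (mvar u + mvar w + t)"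
    using \<kappa>(2) by (rule edge_pow.step)
  moreover have "edge_pow (induced_edges E D) (\<kappa> D) (mvar u + mvar w + t)" for D
    using edge_pow_add_right [OF \<kappa>(2) [of D]] by (metis add.commute)
  moreover have "(\<Sum>D\<in>components E. (\<kappa>(C := Suc (\<kappa> C))) D) = Suc k"
    using C(1) \<kappa>(1) by (simp add: sum.remove [of "components E" C])
  ultimately show ?case by (intro exI [of _ "\<kappa>(C := Suc (\<kappa> C))"]) auto
qed

lemma edge_pow_sum:
  assumes "finite I" "\<And>i. i \<in> I \<Longrightarrow> edge_pow E (m i) (t i)"
  shows "edge_pow E (\<Sum>i\<in>I. m i) (\<Sum>i\<in>I. t i)"
  using assms by (induction I rule: finite_induct) (auto intro: edge_pow_add)

section \<open>The depth of large powers\<close>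

text \<open>A monomial just short of the power m + 1. The weights are the obstruction: in the
  bipartite case each side is a cover of weight m, otherwise the degree is less than 2 (m + 1). For
  an isolated vertex, with A = C and B empty, it forces m = 0 and a = 0.\<close>

definition certificate :: "'v set set \<Rightarrow> 'v set \<Rightarrow> 'v set \<Rightarrow> 'v set \<Rightarrow> nat \<Rightarrow> ('v \<Rightarrow>\<^sub>0 nat) \<Rightarrow> bool" where
  "certificate E C A B m a \<longleftrightarrow> keys a \<subseteq> C \<and> edge_pow E m a \<and>
     (if bipartite C E
      then sum (lookup a) A = m \<and> sum (lookup a) B = m \<and>
        (\<forall>u\<in>A. \<forall>w\<in>B. edge_pow E (Suc m) (a + mvar u + mvar w))
      else sum (lookup a) C = Suc (2 * m) \<and> (\<forall>v\<in>C. edge_pow E (Suc m) (a + mvar v)))"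

lemma certificate_exists:
  fixes C :: "'v::finite set"
  assumes E: "\<forall>e\<in>E. card e = 2" "\<forall>e\<in>E. e \<subseteq> C" and conn: "cut_connected C E"
    and AB: "bipartite C E \<Longrightarrow> A \<union> B = C \<and> A \<inter> B = {} \<and> (\<forall>e\<in>E. \<exists>a\<in>A. \<exists>b\<in>B. e = {a, b})"
      "E = {} \<Longrightarrow> B = {}"
    and m: "card C - 2 \<le> m" "E = {} \<Longrightarrow> m = 0"
  shows "\<exists>a. certificate E C A B m a"
proof (cases "bipartite C E")
  case True
  note bip = AB(1) [OF True]
  show ?thesis
  proof (cases "E = {}")
    case E0: True
    with AB(2) m(2) True show ?thesis by (intro exI [of _ 0]) (simp add: certificate_def)
  next
    case False
    from bip have "A \<union> B = C" "A \<inter> B = {}" "\<forall>e\<in>E. \<exists>a\<in>A. \<exists>b\<in>B. e = {a, b}" by simp_all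
    from bipartite_certificate [OF E(2) conn False this m(1)] True show ?thesis
      by (simp add: certificate_def)
  qed
next
  case False
  with nonbipartite_certificate [OF E conn False m(1)] show ?thesis by (simp add: certificate_def)
qed

lemma component_without_edges:
  assumes "C \<in> components E" "induced_edges E C = {}" "v \<in> C"
  shows "C = {v}"
proof (rule ccontr)
  assume "C \<noteq> {v}"
  with assms(3) component_cut_connected [OF assms(1)] have "\<exists>y\<in>{v}. \<exists>z\<in>C - {v}. {y, z} \<in> induced_edges E C"
    unfolding cut_connected_def by (metis empty_subsetI insert_not_empty insert_subset)
  with assms(2) show False by blast
qed

text \<open>The vertex \<open>\<alpha> C\<close> will be taken from A, so A has to be nonempty even
  without edges; the trivial bipartition then puts all of C there.\<close>

lemma bipartition_exists:
  assumes C: "C \<in> components E" and bip: "bipartite C (induced_edges E C)"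
  shows "\<exists>A B. A \<union> B = C \<and> A \<inter> B = {} \<and> (\<forall>e\<in>induced_edges E C. \<exists>a\<in>A. \<exists>b\<in>B. e = {a, b}) \<and>
    A \<noteq> {} \<and> (B = {} \<longleftrightarrow> induced_edges E C = {})"
proof (cases "induced_edges E C = {}")
  case True
  then show ?thesis using component_nonempty [OF C] by (intro exI [of _ C] exI [of _ "{}"]) simp
next
  case False
  from bip obtain A B where AB: "A \<union> B = C" "A \<inter> B = {}"
      "\<forall>e\<in>induced_edges E C. \<exists>a\<in>A. \<exists>b\<in>B. e = {a, b}"
    unfolding bipartite_def by metis
  with False have "A \<noteq> {}" "B \<noteq> {}" by fast+
  with AB False show ?thesis by (intro exI [of _ A] exI [of _ B]) simp
qed

text \<open>
  For an isolated vertex \<open>v\<close> the degree complex is considered in degree \<open>-1\<close> at \<open>v\<close>, which is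
  encoded by \<open>\<tau>\<close>. In place of the missing second side of its component, \<open>\<beta>\<close> takes the vertex \<open>b0\<close>
  at which all cochains \<open>\<theta> C\<close> vanish.
\<close>

lemma depth_ideal_power_le:
  fixes E :: "'v::finite set set"
  assumes E: "\<forall>e\<in>E. card e = 2" and C0: "C0 \<in> components E" "induced_edges E C0 \<noteq> {}"
    and k: "CARD('v) - 1 \<le> k"
  shows "depth (*) maximal_ideal (polys_on {t. edge_pow E k t} :: ('v, 'k::field) mpol set)
    \<le> enat (Suc (card (bip_components E)))"
proof -
  define EC where "EC = induced_edges E"
  define \<B> where "\<B> = bip_components E"
  have \<B>: "C \<in> \<B> \<longleftrightarrow> C \<in> components E \<and> bipartite C (EC C)" for C by (simp add: \<B>_def EC_def)
  define split where "split C A B \<longleftrightarrow> A \<union> B = C \<and> A \<inter> B = {} \<and>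
    (\<forall>e\<in>EC C. \<exists>a\<in>A. \<exists>b\<in>B. e = {a, b}) \<and> A \<noteq> {} \<and> (B = {} \<longleftrightarrow> EC C = {})" for C A B
  have "\<exists>A B. split C A B" if "C \<in> \<B>" for C
    using bipartition_exists [of C E] that unfolding \<B> EC_def split_def by blast
  then obtain A B where "\<And>C. C \<in> \<B> \<Longrightarrow> split C (A C) (B C)" by metis
  then have AB: "\<And>C. C \<in> \<B> \<Longrightarrow> A C \<union> B C = C" "\<And>C. C \<in> \<B> \<Longrightarrow> A C \<inter> B C = {}"
      "\<And>C. C \<in> \<B> \<Longrightarrow> \<forall>e\<in>EC C. \<exists>a\<in>A C. \<exists>b\<in>B C. e = {a, b}"
      "\<And>C. C \<in> \<B> \<Longrightarrow> A C \<noteq> {}" "\<And>C. C \<in> \<B> \<Longrightarrow> B C = {} \<longleftrightarrow> EC C = {}"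
    by (simp_all add: split_def)
  have unique: "C = D" if "C \<in> components E" "D \<in> components E" "v \<in> C" "v \<in> D" for C D v
    using component_unique that by metis
  have \<B>_comp: "C \<in> components E" if "C \<in> \<B>" for C using that by (simp add: \<B>)
  have AC: "A C \<subseteq> C" and BC: "B C \<subseteq> C" if "C \<in> \<B>" for C using AB(1) [OF that] by auto

  have card2: "2 \<le> card C0"
  proof -
    from C0(2) obtain e where e: "e \<in> induced_edges E C0" by blast
    then have "e \<subseteq> C0" "card e = 2" using E by (auto simp: induced_edges_def)
    with card_mono [of C0 e] show ?thesis by simp
  qed
  define S where "S = (\<Sum>C\<in>components E - {C0}. card C - 1)"
  \<comment> \<open>All of k - 1 is distributed, so that one more edge reaches k. The share |C| - 1
    is enough for a certificate and is 0 for an isolated vertex; \<open>C0\<close> absorbs the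
    rest.\<close>
  define m where "m C = (if C = C0 then k - 1 - S else card C - 1)" for C
  have total: "card C0 + (\<Sum>C\<in>components E - {C0}. card C) = CARD('v)"
    using sum_card_components [of E] C0(1) by (simp add: sum.remove)
  have "S \<le> (\<Sum>C\<in>components E - {C0}. card C)" unfolding S_def by (rule sum_mono) simp
  with total k card2 have S: "S + (card C0 - 2) \<le> k - 1" "1 \<le> k" by linarith+
  have sum_m: "(\<Sum>C\<in>components E. m C) = k - 1"
  proof -
    have "(\<Sum>C\<in>components E. m C) = m C0 + (\<Sum>C\<in>components E - {C0}. m C)"
      using C0(1) by (simp add: sum.remove)
    also have "(\<Sum>C\<in>components E - {C0}. m C) = S" unfolding S_def by (rule sum.cong) (auto simp: m_def)
    finally show ?thesis using S(1) by (simp add: m_def)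
  qed
  have isolated: "C = {v}" if "C \<in> components E" "EC C = {}" "v \<in> C" for C v
    using component_without_edges that unfolding EC_def by metis
  have "\<exists>a. certificate (EC C) C (A C) (B C) (m C) a" if C: "C \<in> components E" for C
  proof (cases "C \<in> \<B> \<or> EC C \<noteq> {}")
    case True
    show ?thesis
    proof (rule certificate_exists)
      show "\<forall>e\<in>EC C. card e = 2" "\<forall>e\<in>EC C. e \<subseteq> C" using E by (auto simp: EC_def induced_edges_def)
      show "cut_connected C (EC C)" unfolding EC_def by (rule component_cut_connected [OF C])
      show "A C \<union> B C = C \<and> A C \<inter> B C = {} \<and> (\<forall>e\<in>EC C. \<exists>a\<in>A C. \<exists>b\<in>B C. e = {a, b})"
        if "bipartite C (EC C)"
        using AB(1,2,3) [of C] C that by (simp add: \<B>)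
      show "B C = {}" if "EC C = {}" using True that AB(5) by blast
      show "card C - 2 \<le> m C" using S(1) by (auto simp: m_def)
      show "m C = 0" if "EC C = {}"
      proof -
        obtain v where "v \<in> C" using component_nonempty [OF C] by blast
        with isolated [OF C that] have "card C = 1" by (metis card.empty card_insert_disjoint empty_iff finite.emptyI One_nat_def)
        moreover have "C \<noteq> C0" using that C0(2) by (auto simp: EC_def)
        ultimately show ?thesis by (simp add: m_def)
      qed
    qed
  next
    case False
    then have "bipartite C (EC C)" by (auto simp: bipartite_def)
    with False C show ?thesis by (simp add: \<B>)
  qed
  then obtain aa where cert: "\<And>C. C \<in> components E \<Longrightarrow> certificate (EC C) C (A C) (B C) (m C) (aa C)"
    by metis
  define a where "a = (\<Sum>C\<in>components E. aa C)"
  have a: "lookup a v = lookup (aa C) v" if "C \<in> components E" "v \<in> C" for C v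
  proof -
    have "lookup (aa D) v = 0" if D: "D \<in> components E - {C}" for D
    proof -
      have "v \<notin> D" using unique [of C D v] \<open>C \<in> components E\<close> \<open>v \<in> C\<close> D by blast
      moreover have "keys (aa D) \<subseteq> D" using cert [of D] D by (simp add: certificate_def)
      ultimately show ?thesis by (auto simp: in_keys_iff)
    qed
    then have "(\<Sum>D\<in>components E - {C}. lookup (aa D) v) = 0" by (intro sum.neutral) blast
    with that(1) show ?thesis
      by (simp add: a_def lookup_sum sum.remove [of "components E" C "\<lambda>D. lookup (aa D) v"])
  qed
  \<comment> \<open>Reaching the next power in a single component suffices, since the other
    components supply the remaining edges.\<close>
  have extend: "edge_pow E k (a + r)"
    if C: "C \<in> components E" and r: "edge_pow (EC C) (Suc (m C)) (aa C + r)" for C r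
  proof -
    have mono: "edge_pow (EC D) n s \<Longrightarrow> edge_pow E n s" for D n s
      by (rule edge_pow_mono) (auto simp: EC_def induced_edges_def)
    have "edge_pow E (\<Sum>D\<in>components E - {C}. m D) (\<Sum>D\<in>components E - {C}. aa D)"
      using cert by (intro edge_pow_sum mono) (auto simp: certificate_def)
    from edge_pow_add [OF mono [OF r] this]
    have "edge_pow E (Suc (m C + (\<Sum>D\<in>components E - {C}. m D))) (aa C + (\<Sum>D\<in>components E - {C}. aa D) + r)"
      by (simp add: add_ac)
    moreover have "m C + (\<Sum>D\<in>components E - {C}. m D) = k - 1"
      using C sum_m by (simp add: sum.remove [of "components E" C])
    moreover have "aa C + (\<Sum>D\<in>components E - {C}. aa D) = a"
      using C by (simp add: a_def sum.remove [of "components E" C])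
    ultimately show ?thesis using S(2) by simp
  qed

  define Iso where "Iso = (\<Union>C\<in>{C \<in> \<B>. EC C = {}}. C)"
  define \<tau> where "\<tau> = (\<Sum>v\<in>Iso. mvar v)"
  have \<tau>: "lookup \<tau> v = of_bool (v \<in> Iso)" for v
    by (simp add: \<tau>_def lookup_sum lookup_mvar of_bool_def)
  have a_Iso: "lookup a v = 0" if "v \<in> Iso" for v
  proof -
    from that obtain C where C: "C \<in> \<B>" "EC C = {}" "v \<in> C" by (auto simp: Iso_def)
    have "edge_pow (EC C) (m C) (aa C)" "sum (lookup (aa C)) (A C) = m C"
      using cert [OF \<B>_comp [OF C(1)]] C(1) by (auto simp: certificate_def \<B>)
    with C(2) have "sum (lookup (aa C)) (A C) = 0" by simp
    moreover have "v \<in> A C" using C AB(1,5) [of C] by auto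
    ultimately have "lookup (aa C) v = 0" by simp
    with a [OF \<B>_comp [OF C(1)] C(3)] show ?thesis by simp
  qed

  \<comment> \<open>\<open>C0\<close> has an edge: if it is bipartite, its side B is not empty, and
    otherwise it is disjoint from all sides A.\<close>
  have "\<exists>b0\<in>C0. \<forall>C\<in>\<B>. b0 \<notin> A C"
  proof (cases "C0 \<in> \<B>")
    case True
    with AB(5) C0(2) obtain b where b: "b \<in> B C0" by (auto simp: EC_def)
    have "b \<notin> A C" if "C \<in> \<B>" for C
    proof
      assume "b \<in> A C"
      with b have "C = C0" using unique [of C C0 b] \<B>_comp that True AC BC by blast
      with b \<open>b \<in> A C\<close> AB(2) [OF True] show False by blast
    qed
    with b BC [OF True] show ?thesis by blast
  next
    case False
    obtain b where b: "b \<in> C0" using component_nonempty [OF C0(1)] by blast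
    have "b \<notin> A C" if "C \<in> \<B>" for C
      using unique [of C C0 b] \<B>_comp [OF that] C0(1) b AC [OF that] False that by blast
    with b show ?thesis by blast
  qed
  then obtain b0 where b0: "b0 \<in> C0" "\<And>C. C \<in> \<B> \<Longrightarrow> b0 \<notin> A C" by blast
  define \<theta> :: "'v set \<Rightarrow> 'v \<Rightarrow> 'k" where "\<theta> C v = of_bool (v \<in> A C)" for C v
  define \<alpha> where "\<alpha> C = (SOME v. v \<in> A C)" for C
  define \<beta> where "\<beta> C = (if EC C = {} then b0 else SOME v. v \<in> B C)" for C
  have \<alpha>: "\<alpha> C \<in> A C" if "C \<in> \<B>" for C
    unfolding \<alpha>_def using AB(4) [OF that] by (simp add: some_in_eq)
  have \<beta>: "\<beta> C \<in> B C" if "C \<in> \<B>" "EC C \<noteq> {}" for C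
    unfolding \<beta>_def using AB(5) [OF that(1)] that(2) by (simp add: some_in_eq)
  obtain Cs where Cs: "set Cs = \<B>" "distinct Cs"
    using finite_distinct_list [of \<B>] by (auto simp: \<B>_def)
  have len: "length Cs = card \<B>" using Cs distinct_card by metis

  have "depth (*) maximal_ideal (polys_on {t. edge_pow E k t} :: ('v, 'k) mpol set) \<le> enat (Suc (length Cs))"
  proof (rule depth_le [where \<theta> = \<theta> and \<alpha> = \<alpha> and \<beta> = \<beta> and a = a and \<tau> = \<tau> and P = "edge_pow E k"])
    show "polys_on {t. edge_pow E k t} = {p. \<forall>t\<in>keys p. edge_pow E k t}"
      by (auto simp: polys_on_def)
    show "ring_module.subspace (polys_on {t. edge_pow E k t})"
    proof (rule subspace_polys_on)
      fix s t assume "t \<in> {t. edge_pow E k t}"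
      then show "s + t \<in> {t. edge_pow E k t}" using edge_pow_add_right [of E k t s] by (simp add: add.commute)
    qed
    show "distinct Cs" by (rule Cs)
    show "\<theta> C (\<alpha> D) = of_bool (C = D)" if "C \<in> set Cs" "D \<in> set Cs" for C D
    proof -
      from that have CD: "C \<in> \<B>" "D \<in> \<B>" by (simp_all add: Cs)
      have "\<alpha> D \<in> A C \<longleftrightarrow> C = D"
        using unique [of C D "\<alpha> D"] \<B>_comp [OF CD(1)] \<B>_comp [OF CD(2)] \<alpha> [OF CD(2)] AC [OF CD(1)] AC [OF CD(2)]
        by blast
      then show ?thesis by (simp add: \<theta>_def)
    qed
    show "\<theta> C (\<beta> D) = 0" if "C \<in> set Cs" "D \<in> set Cs" for C D
    proof -
      from that have CD: "C \<in> \<B>" "D \<in> \<B>" by (simp_all add: Cs)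
      have "\<beta> D \<notin> A C"
      proof (cases "EC D = {}")
        case True
        with b0(2) [OF CD(1)] show ?thesis by (simp add: \<beta>_def)
      next
        case False
        then have "\<beta> D \<in> B D" using \<beta> CD by blast
        then show ?thesis
          using unique [of C D "\<beta> D"] \<B>_comp [OF CD(1)] \<B>_comp [OF CD(2)] AC [OF CD(1)] BC [OF CD(2)] AB(2) [OF CD(2)]
          by blast
      qed
      then show ?thesis by (simp add: \<theta>_def)
    qed
    have meets: "\<exists>v\<in>set l. v \<in> A C" if "wedge (map \<theta> Cs) l \<noteq> 0" "C \<in> \<B>" for l C
    proof (rule ccontr)
      assume "\<not> ?thesis"
      then have "wedge (map \<theta> Cs) l = 0"
        using that(2) Cs(1) by (intro wedge_vanish_coeff [of "\<theta> C"]) (auto simp: \<theta>_def)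
      with that(1) show False ..
    qed
    have Iso_meets: "v \<in> set l" if l: "\<And>C. C \<in> \<B> \<Longrightarrow> \<exists>v\<in>set l. v \<in> A C" and v: "v \<in> Iso" for l v
    proof -
      from v obtain C where C: "C \<in> \<B>" "EC C = {}" "v \<in> C" by (auto simp: Iso_def)
      from l [OF C(1)] obtain w where "w \<in> set l" "w \<in> C" using AC [OF C(1)] by blast
      with isolated [OF \<B>_comp [OF C(1)] C(2,3)] show ?thesis by simp
    qed
    show "\<exists>r. a + mon l = \<tau> + r" if "wedge (map \<theta> Cs) l \<noteq> 0" for l
    proof -
      have "lookup \<tau> v \<le> lookup (a + mon l) v" for v
      proof (cases "v \<in> Iso")
        case True
        with Iso_meets meets [OF that] have "v \<in> set l" by blast
        then have "1 \<le> count_list l v" using count_list_0_iff [of l v] by linarith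
        with True show ?thesis by (simp add: \<tau> lookup_add lookup_mon)
      qed (simp add: \<tau>)
      then show ?thesis using poly_mapping_le_iff_add by blast
    qed
    show "edge_pow E k t"
      if l: "length l = Suc (length Cs)" "koszul_diff (\<lambda>_. 1) (wedge (map \<theta> Cs)) l \<noteq> 0" "a + mon l = \<tau> + t" for l t
    proof -
      have meet: "\<exists>v\<in>set l. v \<in> A C" if "C \<in> \<B>" for C
      proof (rule ccontr)
        assume contra: "\<not> ?thesis"
        have "koszul_diff (\<lambda>_. 1) (wedge (map \<theta> Cs)) l = 0"
        proof (rule koszul_diff_vanish)
          fix l' assume "set l' \<subseteq> set l"
          with contra meets [of l' C] that show "wedge (map \<theta> Cs) l' = 0" by blast
        qed
        with l(2) show False ..
      qed
      \<comment> \<open>Division by \<tau> affects isolated vertices only, and there a vanishes; so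
        t is divisible by a times any product of distinct entries of l that are not
        isolated.\<close>
      have t: "lookup (a + r) z \<le> lookup t z"
        if r: "\<And>z. lookup r z \<le> of_bool (z \<in> set l)" "\<And>z. z \<in> Iso \<Longrightarrow> lookup r z = 0" for r z
      proof (cases "z \<in> Iso")
        case True
        with a_Iso r(2) show ?thesis by (simp add: lookup_add)
      next
        case False
        have "lookup (a + mon l) z = lookup (\<tau> + t) z" using l(3) by simp
        with False have "lookup a z + count_list l z = lookup t z" by (simp add: lookup_add lookup_mon \<tau>)
        moreover have "of_bool (z \<in> set l) \<le> count_list l z"
          by (cases "count_list l z") (auto simp: count_list_0_iff)
        ultimately show ?thesis using r(1) [of z] by (simp add: lookup_add)
      qed
      have noniso: "v \<notin> Iso" if "v \<in> C" "C \<in> components E" "C \<notin> \<B> \<or> EC C \<noteq> {}" for v C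
      proof
        assume "v \<in> Iso"
        then obtain D where D: "D \<in> \<B>" "EC D = {}" "v \<in> D" by (auto simp: Iso_def)
        with unique [of C D v] \<B>_comp [OF D(1)] that have "C = D" by simp
        with D that(3) show False by simp
      qed
      \<comment> \<open>If l contains a vertex of a non-bipartite component, or meets both sides of
        a bipartite one, these vertices complete a to the power k. Otherwise every entry lies on
        exactly one side A, so the \<theta> sum to 1 on l and the coboundary of the wedge product
        vanishes there.\<close>
      consider C v where "C \<in> components E" "C \<notin> \<B>" "v \<in> C" "v \<in> set l"
        | C u w where "C \<in> \<B>" "u \<in> A C" "w \<in> B C" "u \<in> set l" "w \<in> set l"
        | "\<And>C v. C \<in> components E \<Longrightarrow> v \<in> C \<Longrightarrow> v \<in> set l \<Longrightarrow> C \<in> \<B> \<and> v \<in> A C"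
      proof (cases "\<exists>C\<in>components E. C \<notin> \<B> \<and> (\<exists>v\<in>C. v \<in> set l)")
        case True
        with that(1) show thesis by blast
      next
        case all: False
        show thesis
        proof (cases "\<exists>C\<in>\<B>. \<exists>w\<in>B C. w \<in> set l")
          case True
          then obtain C w where "C \<in> \<B>" "w \<in> B C" "w \<in> set l" by blast
          with meet [of C] that(2) [of C] show thesis by blast
        next
          case False
          show thesis
          proof (rule that(3))
            fix C v assume Cv: "C \<in> components E" "v \<in> C" "v \<in> set l"
            with all have "C \<in> \<B>" by blast
            with AB(1) [OF this] False Cv show "C \<in> \<B> \<and> v \<in> A C" by blast
          qed
        qed
      qed
      then show ?thesis
      proof cases
        case 1
        have "edge_pow (EC C) (Suc (m C)) (aa C + mvar v)"
          using cert [OF 1(1)] 1 by (auto simp: certificate_def \<B>)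
        from extend [OF 1(1) this] show ?thesis
        proof (rule edge_pow_le)
          show "lookup (a + mvar v) z \<le> lookup t z" for z
            using 1 noniso [OF 1(3,1)] by (intro t) (auto simp: lookup_mvar)
        qed
      next
        case 2
        have "edge_pow (EC C) (Suc (m C)) (aa C + (mvar u + mvar w))"
          using cert [OF \<B>_comp [OF 2(1)]] 2 by (auto simp: certificate_def \<B> add.assoc)
        from extend [OF \<B>_comp [OF 2(1)] this] show ?thesis
        proof (rule edge_pow_le)
          have "u \<noteq> w" using AB(2) [OF 2(1)] 2 by blast
          moreover have "EC C \<noteq> {}" using AB(5) [OF 2(1)] 2(3) by blast
          then have "u \<notin> Iso" "w \<notin> Iso"
            using noniso [of _ C] \<B>_comp [OF 2(1)] AC [OF 2(1)] BC [OF 2(1)] 2 by blast+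
          ultimately show "lookup (a + (mvar u + mvar w)) z \<le> lookup t z" for z
            using 2 by (intro t) (auto simp: lookup_mvar lookup_add)
        qed
      next
        case 3
        have "(\<Sum>C\<in>set Cs. \<theta> C v) = 1" if "v \<in> set l" for v
        proof -
          obtain C where C: "C \<in> components E" "v \<in> C" using component_memI by metis
          with 3 that have CB: "C \<in> \<B>" "v \<in> A C" by blast+
          have "\<theta> D v = of_bool (D = C)" if D: "D \<in> \<B>" for D
          proof -
            have "D = C" if "v \<in> A D"
              using unique [OF \<B>_comp [OF D] C(1) _ C(2)] AC [OF D] that by blast
            with CB(2) have "v \<in> A D \<longleftrightarrow> D = C" by blast
            then show ?thesis by (simp add: \<theta>_def)
          qed
          then have "(\<Sum>D\<in>set Cs. \<theta> D v) = (\<Sum>D\<in>\<B>. of_bool (D = C))"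
            unfolding Cs(1) by (rule sum.cong [OF refl])
          also have "\<dots> = 1" using CB(1) by (simp add: of_bool_def)
          finally show ?thesis .
        qed
        with koszul_diff_wedge_sum_coeff [OF Cs(2)] l(2) show ?thesis by blast
      qed
    qed
    show "\<not> edge_pow E k t"
      if sel: "\<And>C. C \<in> set Cs \<Longrightarrow> sel C = \<alpha> C \<or> sel C = \<beta> C" and t: "a + mon (map sel Cs) = \<tau> + t" for sel t
    proof
      assume "edge_pow E k t"
      \<comment> \<open>Multiplying by \<tau> again removes the negative degree. The shares \<kappa>
        of the components sum to k, whereas their bounds m sum to k - 1.\<close>
      define T where "T = a + mon (map sel Cs)"
      have "edge_pow E k T"
        unfolding T_def t using edge_pow_add_right [OF \<open>edge_pow E k t\<close>] by (metis add.commute)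
      then obtain \<kappa> where \<kappa>: "(\<Sum>C\<in>components E. \<kappa> C) = k" "\<And>C. edge_pow (EC C) (\<kappa> C) T"
        using edge_pow_components_split [OF _ E] unfolding EC_def by blast
      have sel_mem: "sel C \<in> C \<or> EC C = {} \<and> sel C = b0" if "C \<in> \<B>" for C
      proof (cases "EC C = {}")
        case True
        then have "\<beta> C = b0" by (simp add: \<beta>_def)
        with sel [of C] that True \<alpha> [OF that] AC [OF that] Cs(1) show ?thesis by auto
      next
        case False
        with \<beta> [OF that] sel [of C] that \<alpha> [OF that] AC [OF that] BC [OF that] Cs(1) show ?thesis
          by auto
      qed
      \<comment> \<open>Divisibility by \<tau> forces the vertex of an isolated component C into the
        list, and no other component can supply it; so \<open>b0\<close> is not the choice for such
        a C.\<close>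
      have selC: "sel C \<in> C" if C: "C \<in> \<B>" for C
      proof (cases "EC C = {}")
        case True
        have "\<alpha> C \<in> C" using \<alpha> AC C by blast
        then have iso: "\<alpha> C \<in> Iso" using C True by (auto simp: Iso_def)
        have "lookup T (\<alpha> C) = lookup (\<tau> + t) (\<alpha> C)" by (simp add: T_def t)
        then have "lookup (mon (map sel Cs)) (\<alpha> C) \<noteq> 0"
          using iso a_Iso [OF iso] by (simp add: T_def lookup_add \<tau>)
        then have "\<alpha> C \<in> set (map sel Cs)" unfolding lookup_mon count_list_0_iff by simp
        then obtain D where D: "D \<in> \<B>" "\<alpha> C = sel D" using Cs(1) by auto
        have "sel D \<noteq> b0"
        proof
          assume "sel D = b0"
          with D(2) \<open>\<alpha> C \<in> C\<close> b0(1) have "C = C0" using unique [of C C0 b0] \<B>_comp [OF C] C0(1) by simp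
          with True C0(2) show False by (simp add: EC_def)
        qed
        with sel_mem [OF D(1)] have "sel D \<in> D" by blast
        with D \<open>\<alpha> C \<in> C\<close> have "C = D" using unique [of C D "\<alpha> C"] \<B>_comp [OF C] \<B>_comp [OF D(1)] by simp
        with \<open>sel D \<in> D\<close> show ?thesis by simp
      next
        case False
        with sel_mem [OF C] show ?thesis by blast
      qed
      have T: "lookup T v = lookup (aa C) v" if C: "C \<in> components E" "v \<in> C" "C \<in> \<B> \<Longrightarrow> v \<noteq> sel C" for C v
      proof -
        have "v \<notin> set (map sel Cs)"
        proof
          assume "v \<in> set (map sel Cs)"
          then obtain D where D: "D \<in> \<B>" "v = sel D" using Cs(1) by auto
          with selC [OF D(1)] C have "C = D" using unique [of C D v] \<B>_comp [OF D(1)] by simp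
          with D C(3) show False by simp
        qed
        with a [OF C(1,2)] show ?thesis by (simp add: T_def lookup_add lookup_mon count_notin)
      qed
      \<comment> \<open>A non-bipartite component receives no further vertex, and its degree 2 m + 1
        allows at most m edges. A bipartite one receives the single vertex \<open>sel C\<close>, and
        the side not containing it is a cover of weight m.\<close>
      have "\<kappa> C \<le> m C" if C: "C \<in> components E" for C
      proof (cases "C \<in> \<B>")
        case False
        have "2 * \<kappa> C \<le> (\<Sum>v\<in>UNIV. of_bool (v \<in> C) * lookup T v)"
          by (rule edge_pow_weight [OF \<kappa>(2) [of C]]) (auto simp: EC_def induced_edges_def)
        also have "\<dots> = sum (lookup T) C"
          by (simp add: of_bool_def if_distrib [of "\<lambda>x. x * _"] sum.If_cases)
        also have "\<dots> = sum (lookup (aa C)) C" using False by (intro sum.cong refl T [OF C]) auto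
        also have "\<dots> = Suc (2 * m C)" using cert [OF C] C False by (auto simp: certificate_def \<B>)
        finally show ?thesis by simp
      next
        case True
        note cover = AB(3) [OF True]
        have sums: "sum (lookup (aa C)) (A C) = m C" "sum (lookup (aa C)) (B C) = m C"
          using cert [OF C] True by (auto simp: certificate_def \<B>)
        have bound: "\<kappa> C \<le> m C" if X: "vertex_cover (EC C) X" "X \<subseteq> C" "sel C \<notin> X" "sum (lookup (aa C)) X = m C" for X
        proof -
          have "\<kappa> C \<le> sum (lookup T) X" by (rule edge_pow_vertex_cover [OF X(1) \<kappa>(2)])
          also have "\<dots> = sum (lookup (aa C)) X" using X by (intro sum.cong refl T [OF C]) auto
          finally show ?thesis using X(4) by simp
        qed
        have "vertex_cover (EC C) (A C)" "vertex_cover (EC C) (B C)"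
          using cover unfolding vertex_cover_def by fastforce+
        with bound [of "A C"] bound [of "B C"] sums AC [OF True] BC [OF True] AB(2) [OF True]
        show ?thesis by blast
      qed
      then have "(\<Sum>C\<in>components E. \<kappa> C) \<le> (\<Sum>C\<in>components E. m C)" by (rule sum_mono)
      with \<kappa>(1) sum_m S(2) show False by simp
    qed
  qed
  then show ?thesis by (simp add: len \<B>_def)
qed

theorem corollary3p6:
  fixes E :: "'v::finite set set" and k :: nat
  assumes "simple_graph UNIV E"
    and "\<not> bipartite UNIV E \<or>
         (\<exists>C \<in> component_vertices UNIV E. tree C (induced_edges E C) \<and> induced_edges E C \<noteq> {})"
    and "CARD('v) - 1 \<le> k"
  shows "stanley_inequality (ideal_power (edge_ideal E :: ('v, 'k::field) mpol set) k)"
proof -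
  have E: "\<forall>e\<in>E. card e = 2" using assms(1) by (simp add: simple_graph_def)
  let ?p = "card (bip_components E)"
  have "\<exists>C0\<in>components E. induced_edges E C0 \<noteq> {} \<and> (\<exists>d\<ge>Suc ?p. stanley_set UNIV d {t. edge_pow E k t})"
    using assms(2)
  proof
    assume nonbip: "\<not> bipartite UNIV E"
    \<comment> \<open>Otherwise the unions of the two sides over all components would form a
      bipartition of the graph.\<close>
    have "\<exists>C\<in>components E. \<not> bipartite C (induced_edges E C)"
    proof (rule ccontr)
      assume contra: "\<not> ?thesis"
      define split where "split C A B \<longleftrightarrow> A \<union> B = C \<and> A \<inter> B = {} \<and>
        (\<forall>e\<in>induced_edges E C. \<exists>a\<in>A. \<exists>b\<in>B. e = {a, b})" for C A B
      have "\<exists>A B. split C A B" if "C \<in> components E" for C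
        using contra that unfolding bipartite_def split_def by blast
      then obtain A B where "\<And>C. C \<in> components E \<Longrightarrow> split C (A C) (B C)" by metis
      then have AB: "A C \<union> B C = C \<and> A C \<inter> B C = {} \<and>
          (\<forall>e\<in>induced_edges E C. \<exists>a\<in>A C. \<exists>b\<in>B C. e = {a, b})" if "C \<in> components E" for C
        using that by (simp add: split_def)
      have "(\<Union>C\<in>components E. A C) \<union> (\<Union>C\<in>components E. B C) = UNIV"
      proof -
        have "v \<in> (\<Union>C\<in>components E. A C) \<union> (\<Union>C\<in>components E. B C)" for v
        proof -
          obtain C where "C \<in> components E" "v \<in> C" using component_memI by metis
          with AB [of C] show ?thesis by blast
        qed
        then show ?thesis by blast
      qed
      moreover have "(\<Union>C\<in>components E. A C) \<inter> (\<Union>C\<in>components E. B C) = {}"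
      proof (rule ccontr)
        assume "\<not> ?thesis"
        then obtain C D v where CD: "C \<in> components E" "D \<in> components E" "v \<in> A C" "v \<in> B D" by blast
        then have "v \<in> C" "v \<in> D" using AB [of C] AB [of D] by blast+
        with component_unique [OF CD(1,2)] have "C = D" by blast
        with CD AB [of C] show False by blast
      qed
      moreover have "\<exists>a\<in>\<Union>C\<in>components E. A C. \<exists>b\<in>\<Union>C\<in>components E. B C. e = {a, b}" if "e \<in> E" for e
      proof -
        from that component_edges_cover [OF E] obtain C where "C \<in> components E" "e \<in> induced_edges E C" by blast
        moreover from this AB [of C] obtain a b where "a \<in> A C" "b \<in> B C" "e = {a, b}" by meson
        ultimately show ?thesis by blast
      qed
      ultimately have "bipartite UNIV E"
        unfolding bipartite_def
        by (intro exI [of _ "\<Union>C\<in>components E. A C"] exI [of _ "\<Union>C\<in>components E. B C"]) simp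
      with nonbip show False ..
    qed
    then obtain C0 where C0: "C0 \<in> components E" "\<not> bipartite C0 (induced_edges E C0)" by blast
    obtain v where v: "v \<in> C0" using component_nonempty [OF C0(1)] by blast
    \<comment> \<open>\<open>C0\<close> is not among the p bipartite components, so its contribution
      1 comes on top of p.\<close>
    have "stanley_set UNIV (1 + card (bip_components E - {C0})) {t. edge_pow E k t}"
      by (rule stanley_set_components [OF E C0(1) stanley_set_1_edge_pow_on [OF induced_edges_simple(1) [OF E] v]])
    moreover have "bip_components E - {C0} = bip_components E" using C0(2) by blast
    moreover have "bipartite C0 {}"
      unfolding bipartite_def by (intro exI [of _ C0] exI [of _ "{}"]) simp
    then have "induced_edges E C0 \<noteq> {}" using C0(2) by metis
    ultimately show ?thesis using C0(1) by auto
  next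
    assume "\<exists>C \<in> component_vertices UNIV E. tree C (induced_edges E C) \<and> induced_edges E C \<noteq> {}"
    then obtain C0 where C0: "C0 \<in> components E" "tree C0 (induced_edges E C0)" "induced_edges E C0 \<noteq> {}"
      by (auto simp: components_def)
    have "stanley_set C0 2 (edge_pow_on (induced_edges E C0) C0 i)" for i
    proof (cases "i = 0")
      \<comment> \<open>The power 0 is the whole polynomial ring in the variables of
        \<open>C0\<close>, of which there are at least two because \<open>C0\<close> has an
        edge.\<close>
      case True
      from C0(3) obtain e where "e \<in> induced_edges E C0" by blast
      then have "e \<subseteq> C0" "card e = 2" using E by (auto simp: induced_edges_def)
      with card_mono [of C0 e] have "stanley_set C0 2 (cone 0 C0)" by (intro stanley_set.cone) auto
      moreover have "cone 0 C0 = edge_pow_on (induced_edges E C0) C0 i"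
        by (auto simp: cone_def edge_pow_on_def True)
      ultimately show ?thesis by simp
    next
      case False
      with C0(2) show ?thesis
        by (intro stanley_set_2_forest induced_edges_simple(1) [OF E] induced_edges_simple(2))
          (auto simp: tree_def)
    qed
    from stanley_set_components [OF E C0(1) this]
    have "stanley_set UNIV (2 + card (bip_components E - {C0})) {t. edge_pow E k t}" .
    \<comment> \<open>Leaving out \<open>C0\<close> lowers the number of bipartite components by at
      most one, and 2 + (p - 1) = p + 1.\<close>
    moreover have "Suc ?p \<le> 2 + card (bip_components E - {C0})"
      using card_Diff_singleton_if [of "bip_components E" C0] by (auto split: if_splits)
    ultimately show ?thesis using C0(1,3) by blast
  qed
  then obtain C0 d where C0: "C0 \<in> components E" "induced_edges E C0 \<noteq> {}"
    and d: "Suc ?p \<le> d" "stanley_set UNIV d {t. edge_pow E k t}" by blast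
  let ?I = "polys_on {t. edge_pow E k t} :: ('v, 'k) mpol set"
  have "depth (*) maximal_ideal ?I \<le> enat (Suc ?p)"
    by (rule depth_ideal_power_le [OF E C0 assms(3)])
  also have "\<dots> \<le> enat d" using d(1) by simp
  also have "\<dots> \<le> sdepth (*) multidegree_component ?I" by (rule sdepth_ge [OF d(2)])
  finally show ?thesis by (simp add: stanley_inequality_def ideal_power_edge_ideal)
qed

end
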